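(* Let $q$ be a prime power and let $n\ge5$ be an odd integer. Let $g=(q-1)(q^{n+1}+q^n-q^2)/2$ and $N=q^{2n+2}-q^{n+3}+q^{n+2}$. For every integer $\ell\in[3g-1,N-g]$, fix $s=N-2\ell$. Then there exists a quantum code with parameters $[[N,s,D]]_{q^{2n}}$ with $D\ge\ell+1-g$, whose relative quantum Singleton defect $\Delta_n^Q=(N-s-2D+2)/N$ satisfies $$\Delta_n^Q\le\frac{2g}{N}=\frac{(q-1)(q^{n+1}+q^n-q^2)}{q^{2n+2}-q^{n+3}+q^{n+2}}.$$ Hence, for fixed $q$, $\lim_{n\to\infty}\Delta_n^Q=0$.
   Context: For a prime power $r$, an $r$-ary quantum code of length $N$ and dimension $k$ is an $r^k$-dimensional Hilbert subspace of the $r^N$-dimensional Hilbert space $(\mathbb C^r)^{\otimes N}$; $[[N,k,D]]_r$ denotes such a code with minimum distance $D$ (a code of minimum distance $D$ can correct up to $\lfloor (D-1)/2\rfloor$ quantum errors). The quantum Singleton bound states that the quantum Singleton defect $N-k-2D+2$ is nonnegative; the relative quantum Singleton defect is this quantity divided by $N$.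
   Formalization: Only those ℓ in [3g−1, N−g] with 2ℓ ≤ N are covered, so that s = N−2ℓ ≥ 0; for larger ℓ the number s is negative and a code of dimension r^s does not exist (e.g. q=2, n=5, ℓ=3000 gives s=−2032). *)

theory Defs
  imports
    Complex_Main
    "HOL-Library.FuncSet"
    "HOL-Library.Function_Algebras"
    "HOL-Number_Theory.Prime_Powers"
begin

section \<open>Quantum codes\<close>

text \<open>
  The \<open>N\<close>-fold tensor power of \<open>\<complex>\<^sup>r\<close> is represented by coordinates: a vector
  assigns a complex amplitude to every basis label \<open>w\<close>, where \<open>w\<close> stands for the tensor product of
  the standard basis vectors with indices \<open>w 0, \<dots>, w (N - 1)\<close>, all below \<open>r\<close>.
\<close>

type_synonym qvec = "(nat \<Rightarrow> nat) \<Rightarrow> complex"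

definition words :: "nat \<Rightarrow> nat \<Rightarrow> (nat \<Rightarrow> nat) set" where
  "words r N = {..<N} \<rightarrow>\<^sub>E {..<r}"

definition qspace :: "nat \<Rightarrow> nat \<Rightarrow> qvec set" where
  "qspace r N = {\<psi>. \<forall>w. w \<notin> words r N \<longrightarrow> \<psi> w = 0}"

global_interpretation qvec: vector_space "\<lambda>(c::complex) (\<psi>::qvec) w. c * \<psi> w"
  by unfold_locales (auto simp: fun_eq_iff algebra_simps)

definition qinner :: "nat \<Rightarrow> nat \<Rightarrow> qvec \<Rightarrow> qvec \<Rightarrow> complex" where
  "qinner r N \<phi> \<psi> = (\<Sum>w\<in>words r N. cnj (\<phi> w) * \<psi> w)"

text \<open>
  A family \<open>A\<close> of matrices, of which only the entries \<open>A i a b\<close> with \<open>i < N\<close> and \<open>a, b < r\<close> matter,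
  stands for the error operator that is the tensor product of \<open>A 0, \<dots>, A (N - 1)\<close>.
  Its weight is the number of tensor factors that are not scalar multiples of the identity.
  As the errors of weight at most \<open>t\<close> include a basis of the operators supported on any given
  \<open>t\<close> positions, and as the conditions below are linear in the error, it suffices to
  consider tensor products.
\<close>

type_synonym qerror = "nat \<Rightarrow> nat \<Rightarrow> nat \<Rightarrow> complex"

definition apply_error :: "nat \<Rightarrow> nat \<Rightarrow> qerror \<Rightarrow> qvec \<Rightarrow> qvec" where
  "apply_error r N A \<psi> =
     (\<lambda>u. if u \<in> words r N then \<Sum>v\<in>words r N. (\<Prod>i<N. A i (u i) (v i)) * \<psi> v else 0)"

definition error_weight :: "nat \<Rightarrow> nat \<Rightarrow> qerror \<Rightarrow> nat" where
  "error_weight r N A =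
     card {i. i < N \<and> \<not> (\<exists>c. \<forall>a<r. \<forall>b<r. A i a b = (if a = b then c else 0))}"

definition error_trace :: "nat \<Rightarrow> nat \<Rightarrow> qerror \<Rightarrow> complex" where
  "error_trace r N A = (\<Prod>i<N. \<Sum>a<r. A i a a)"

text \<open>
  Detectability is the Knill--Laflamme condition: the compression of the error to the code is a
  scalar. This is void for a one-dimensional code, for which the usual convention is
  that distances are pure distances: the scalar has to be the normalised trace of the error,
  i.e. the reduced states on few positions are maximally mixed.
\<close>

definition detectable :: "nat \<Rightarrow> nat \<Rightarrow> qvec set \<Rightarrow> qerror \<Rightarrow> bool" where
  "detectable r N Q A \<longleftrightarrow>
     (\<exists>c. (\<forall>\<phi>\<in>Q. \<forall>\<psi>\<in>Q. qinner r N \<phi> (apply_error r N A \<psi>) = c * qinner r N \<phi> \<psi>) \<and>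
          (qvec.dim Q = 1 \<longrightarrow> c = error_trace r N A / of_nat (r ^ N)))"

definition has_min_distance :: "nat \<Rightarrow> nat \<Rightarrow> qvec set \<Rightarrow> nat \<Rightarrow> bool" where
  "has_min_distance r N Q D \<longleftrightarrow>
     (\<exists>A. error_weight r N A = D \<and> \<not> detectable r N Q A) \<and>
     (\<forall>A. error_weight r N A < D \<longrightarrow> detectable r N Q A)"

text \<open>\<open>quantum_code r N k D Q\<close>: \<open>Q\<close> is an \<open>[[N, k, D]]\<close> code over alphabet size \<open>r\<close>.\<close>

definition quantum_code :: "nat \<Rightarrow> nat \<Rightarrow> nat \<Rightarrow> nat \<Rightarrow> qvec set \<Rightarrow> bool" where
  "quantum_code r N k D Q \<longleftrightarrow>
     qvec.subspace Q \<and> Q \<subseteq> qspace r N \<and> qvec.dim Q = r ^ k \<and> has_min_distance r N Q D"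

definition rel_singleton_defect :: "nat \<Rightarrow> nat \<Rightarrow> nat \<Rightarrow> real" where
  "rel_singleton_defect N k D = (real N - real k - 2 * real D + 2) / real N"


section \<open>Parameters\<close>

text \<open>The division by 2 is exact for \<open>n \<ge> 1\<close>, since \<open>q - 1\<close> or \<open>q\<close> is even.\<close>

definition genus_param :: "nat \<Rightarrow> nat \<Rightarrow> int" where
  "genus_param q n = (int q - 1) * (int q ^ (n + 1) + int q ^ n - int q ^ 2) div 2"

definition length_param :: "nat \<Rightarrow> nat \<Rightarrow> int" where
  "length_param q n = int q ^ (2 * n + 2) - int q ^ (n + 3) + int q ^ (n + 2)"

end

theory Submission
  imports
    Defs
    "HOL-Computational_Algebra.Computational_Algebra"
    "HOL-Number_Theory.Cong"
begin

text \<open>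
  The codes come from the one-point evaluation codes at infinity on the curve
  \<open>x ^ q + x = y ^ (q + 1)\<close>, \<open>y ^ q\<^sup>2 - y = z ^ m\<close>, \<open>m = (q ^ n + 1) div (q + 1)\<close>, over the field with
  \<open>q ^ (2 * n)\<close> elements. The function field of the curve is a Galois extension of degree \<open>q ^ 3\<close> of
  the rational functions in \<open>z\<close>, unramified outside infinity, so its affine rational points form full
  fibres of \<open>z\<close>, and they can be counted by Hilbert 90. The Riemann--Roch theorem is replaced by the
  numerical semigroup of the pole orders \<open>m * (q + 1)\<close>, \<open>m * q\<close>, \<open>q ^ 3\<close> of \<open>x, y, z\<close>, which has at
  most \<open>g\<close> gaps: let \<open>C\<close> be spanned by the evaluations of the monomials with the first \<open>l\<close>
  pole orders. The Feng--Rao argument shows that the dual of \<open>C\<close> has minimum distance at least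
  \<open>l + 1 - g\<close>, and the residues of \<open>dz / h(z)\<close>, where \<open>h\<close> vanishes at the values of \<open>z\<close>, give
  column multipliers \<open>v\<close> for which \<open>v * C\<close> is orthogonal to \<open>C\<close>. The CSS construction yields
  the quantum code. The limit also needs the quantum Singleton bound as a lower estimate of the
  defect; it follows from the usual entropy argument with ranks in place of entropies.
\<close>

section \<open>CSS codes\<close>

text \<open>One distance bound serves both requirements on a CSS code. The distance of the dual of C
  is the Feng--Rao bound itself; uniformity of the cosets of v * C on few positions follows from it
  as well, because v vanishes nowhere. That v * C lies in the dual is a matter of degree: with g
  gaps, the first l pole orders lie below l + g, so a product of two functions has pole order at
  most 2l + 2g - 2. A sum of residues can be nonzero only from N + 2g - 1 on, and 2l is at most N.
  The length is q^3 times (q^n + 1) * (q^(n-1) - 1) + 1. The second factor bounds the number of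
  rational fibres of z from below, and exactly that many fibres are kept. Functions on the curve are
  present only through their pairing with vectors of field elements, and the weight of a monomial
  stands for its pole order. The distance D of the code is the least weight of an undetectable error
  and is bounded from below only. Nonnegativity of the defect therefore has to come from a bound
  valid for all codes.\<close>

lemma sum_apply_fun: "(\<Sum>x\<in>A. f x) w = (\<Sum>x\<in>A. f x w)"
  by (induction A rule: infinite_finite_induct) auto

lemma finite_words [simp]: "finite (words r N)"
  unfolding words_def by (auto intro: finite_PiE)

lemma card_words [simp]: "card (words r N) = r ^ N"
  unfolding words_def by (simp add: card_PiE)

lemma words_less: "w \<in> words r N \<Longrightarrow> i < N \<Longrightarrow> w i < r"
  unfolding words_def by auto

lemma words_eqI: "\<lbrakk>u \<in> words r N; v \<in> words r N; \<And>i. i < N \<Longrightarrow> u i = v i\<rbrakk> \<Longrightarrow> u = v"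
  unfolding words_def by (rule PiE_ext) auto

text \<open>A matrix unit of the whole space is a tensor product of matrix units, hence an
  admissible error. It isolates a single product of two amplitudes.\<close>

definition unit_error :: "(nat \<Rightarrow> nat) \<Rightarrow> (nat \<Rightarrow> nat) \<Rightarrow> qerror" where
  "unit_error u v = (\<lambda>i a b. if a = u i \<and> b = v i then 1 else 0)"

lemma prod_unit_error:
  assumes "u \<in> words r N" "v \<in> words r N" "x \<in> words r N" "y \<in> words r N"
  shows "(\<Prod>i<N. unit_error u v i (x i) (y i)) = (if x = u \<and> y = v then 1 else 0)"
proof (cases "x = u \<and> y = v")
  case False
  then obtain i where "i < N" "x i \<noteq> u i \<or> y i \<noteq> v i"
    using words_eqI assms by metis
  then have "\<exists>i\<in>{..<N}. unit_error u v i (x i) (y i) = 0"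
    by (auto simp: unit_error_def)
  then have "(\<Prod>i<N. unit_error u v i (x i) (y i)) = 0"
    by (simp add: prod_zero_iff)
  then show ?thesis using False by auto
qed (auto simp: unit_error_def)

lemma qinner_unit_error:
  assumes "u \<in> words r N" "v \<in> words r N"
  shows "qinner r N \<phi> (apply_error r N (unit_error u v) \<psi>) = cnj (\<phi> u) * \<psi> v"
proof -
  have "apply_error r N (unit_error u v) \<psi> x = (if x = u then \<psi> v else 0)"
    if x: "x \<in> words r N" for x
  proof -
    have "apply_error r N (unit_error u v) \<psi> x
        = (\<Sum>y\<in>words r N. (\<Prod>i<N. unit_error u v i (x i) (y i)) * \<psi> y)"
      unfolding apply_error_def using x by simp
    also have "\<dots> = (\<Sum>y\<in>words r N. if y = v then (if x = u then \<psi> v else 0) else 0)"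
      using prod_unit_error[OF assms x] by (intro sum.cong) auto
    also have "\<dots> = (if x = u then \<psi> v else 0)" using assms by simp
    finally show ?thesis .
  qed
  then have "qinner r N \<phi> (apply_error r N (unit_error u v) \<psi>)
      = (\<Sum>x\<in>words r N. if x = u then cnj (\<phi> u) * \<psi> v else 0)"
    unfolding qinner_def by (intro sum.cong) auto
  also have "\<dots> = cnj (\<phi> u) * \<psi> v" using assms by simp
  finally show ?thesis .
qed

lemma error_trace_unit_error:
  assumes "u \<in> words r N" "v \<in> words r N"
  shows "error_trace r N (unit_error u v) = (if u = v then 1 else 0)"
proof -
  have "(\<Sum>a<r. unit_error u v i a a) = (if u i = v i then 1 else 0)" if "i < N" for i
  proof -
    have "(\<Sum>a<r. unit_error u v i a a) = (\<Sum>a<r. if a = u i then (if u i = v i then 1 else 0) else 0)"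
      by (intro sum.cong) (auto simp: unit_error_def)
    then show ?thesis using words_less[OF assms(1) that] by simp
  qed
  then have "error_trace r N (unit_error u v) = (\<Prod>i<N. if u i = v i then 1 else 0)"
    unfolding error_trace_def by simp
  also have "\<dots> = (if u = v then 1 else 0)"
  proof (cases "u = v")
    case False
    then obtain i where "i < N" "u i \<noteq> v i" using words_eqI assms by metis
    then have "\<exists>i\<in>{..<N}. (if u i = v i then 1 else 0 :: complex) = 0" by auto
    then have "(\<Prod>i<N. if u i = v i then 1 else 0 :: complex) = 0"
      by (simp add: prod_zero_iff)
    then show ?thesis using False by simp
  qed simp
  finally show ?thesis .
qed

lemma qinner_self: "qinner r N \<psi> \<psi> = complex_of_real (\<Sum>w\<in>words r N. (cmod (\<psi> w))\<^sup>2)"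
  unfolding qinner_def by (simp add: complex_norm_square mult.commute del: of_real_power)

lemma qinner_self_eq_0_iff:
  assumes "\<psi> \<in> qspace r N"
  shows "qinner r N \<psi> \<psi> = 0 \<longleftrightarrow> \<psi> = 0"
proof
  assume "qinner r N \<psi> \<psi> = 0"
  then have "(\<Sum>w\<in>words r N. (cmod (\<psi> w))\<^sup>2) = 0"
    using qinner_self[of r N \<psi>] by (metis of_real_eq_0_iff)
  then have "\<psi> w = 0" for w
    using assms by (cases "w \<in> words r N") (auto simp: sum_nonneg_eq_0_iff qspace_def)
  then show "\<psi> = 0" by auto
qed (simp add: qinner_def)

text \<open>\<open>has_min_distance\<close> asks for an undetectable error. If all matrix units were
  detectable, then in dimension one the trace convention would make every amplitude nonzero and
  every product of two different amplitudes zero. In higher dimension, a code word vanishing at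
  \<open>u\<close> but not at \<open>v\<close> forces the scalar of the unit between them to be 0,
  although pairing that word with \<open>\<phi>\<close> gives a nonzero value.\<close>

lemma ex_undetectable:
  assumes Q: "qvec.subspace Q" "Q \<subseteq> qspace r N" and dim: "qvec.dim Q = r ^ s"
    and r: "r \<ge> 2" and N: "N \<ge> 1"
  shows "\<exists>A. \<not> detectable r N Q A"
proof (rule ccontr)
  assume "\<nexists>A. \<not> detectable r N Q A"
  then have det: "detectable r N Q A" for A by auto
  have "\<exists>\<phi>\<in>Q. \<phi> \<noteq> 0"
  proof (rule ccontr)
    assume "\<not> (\<exists>\<phi>\<in>Q. \<phi> \<noteq> 0)"
    then have "Q \<subseteq> qvec.span {}" by auto
    then have "qvec.dim Q \<le> card ({} :: qvec set)" by (intro qvec.dim_le_card) auto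
    then show False using dim r by simp
  qed
  then obtain \<phi> where \<phi>: "\<phi> \<in> Q" "\<phi> \<noteq> 0" by auto
  then obtain u where u: "\<phi> u \<noteq> 0" by (metis ext zero_fun_apply)
  have uw: "u \<in> words r N" using u \<phi> Q unfolding qspace_def by auto
  show False
  proof (cases "qvec.dim Q = 1")
    case True
    have "cnj (\<phi> u) * \<phi> v = (if u = v then 1 / of_nat (r ^ N) else 0) * qinner r N \<phi> \<phi>"
      if "u \<in> words r N" "v \<in> words r N" for u v
      using det[of "unit_error u v"] that True \<phi>
      unfolding detectable_def qinner_unit_error[OF that] error_trace_unit_error[OF that]
      by auto
    note 1 = this
    have nz: "\<phi> v \<noteq> 0" if "v \<in> words r N" for v
      using 1[OF that that] qinner_self_eq_0_iff[of \<phi> r N] \<phi> Q r by auto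
    have "card (words r N - {u}) > 0"
      using uw r N by (simp add: card_Diff_singleton) (metis One_nat_def less_le_trans one_less_power
        Suc_le_eq lessI numeral_2_eq_2)
    then have "words r N - {u} \<noteq> {}" by fastforce
    then obtain v where v: "v \<in> words r N" "v \<noteq> u" by auto
    then show False using 1[OF uw v(1)] nz[OF v(1)] u by auto
  next
    case False
    have "\<not> Q \<subseteq> qvec.span {\<phi>}"
    proof
      assume "Q \<subseteq> qvec.span {\<phi>}"
      then have "qvec.dim Q \<le> card {\<phi>}" by (intro qvec.dim_le_card) auto
      moreover have "qvec.dim Q \<ge> 1" using dim r by simp
      ultimately show False using False by simp
    qed
    then obtain \<psi>0 where \<psi>0: "\<psi>0 \<in> Q" "\<psi>0 \<notin> qvec.span {\<phi>}" by auto
    \<comment> \<open>\<open>\<psi>0\<close> is corrected by a multiple of \<open>\<phi>\<close> so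
      that its amplitude at \<open>u\<close> vanishes; independence from \<open>\<phi>\<close> keeps
      it nonzero.\<close>
    define \<psi> where "\<psi> = \<psi>0 - (\<lambda>w. (\<psi>0 u / \<phi> u) * \<phi> w)"
    have \<psi>Q: "\<psi> \<in> Q" unfolding \<psi>_def
      by (intro qvec.subspace_diff qvec.subspace_scale Q \<phi> \<psi>0)
    have "\<psi> \<noteq> 0"
    proof
      assume "\<psi> = 0"
      then have "\<psi>0 = (\<lambda>w. (\<psi>0 u / \<phi> u) * \<phi> w)" unfolding \<psi>_def by simp
      moreover have "(\<lambda>w. (\<psi>0 u / \<phi> u) * \<phi> w) \<in> qvec.span {\<phi>}"
        by (intro qvec.span_scale qvec.span_base) auto
      ultimately show False using \<psi>0 by simp
    qed
    then obtain v where v: "\<psi> v \<noteq> 0" by (metis ext zero_fun_apply)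
    have vw: "v \<in> words r N" using v \<psi>Q Q unfolding qspace_def by auto
    have \<psi>u: "\<psi> u = 0" unfolding \<psi>_def using u by simp
    obtain c where c: "\<And>\<alpha> \<beta>. \<alpha> \<in> Q \<Longrightarrow> \<beta> \<in> Q \<Longrightarrow> cnj (\<alpha> u) * \<beta> v = c * qinner r N \<alpha> \<beta>"
      using det[of "unit_error u v"] unfolding detectable_def qinner_unit_error[OF uw vw] by auto
    have "c * qinner r N \<psi> \<psi> = 0" using c[OF \<psi>Q \<psi>Q] \<psi>u by simp
    then have "c = 0" using qinner_self_eq_0_iff[of \<psi> r N] \<psi>Q Q \<open>\<psi> \<noteq> 0\<close> by auto
    then show False using c[OF \<phi>(1) \<psi>Q] u v by simp
  qed
qed

text \<open>The distance is the least weight of an undetectable error, which exceeds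
  \<open>t\<close> once all errors up to weight \<open>t\<close> are detectable.\<close>

lemma quantum_codeI:
  assumes Q: "qvec.subspace Q" "Q \<subseteq> qspace r N" and dim: "qvec.dim Q = r ^ s"
    and r: "r \<ge> 2" and N: "N \<ge> 1"
    and det: "\<And>A. error_weight r N A \<le> t \<Longrightarrow> detectable r N Q A"
  shows "\<exists>D>t. quantum_code r N s D Q"
proof -
  define W where "W = (\<lambda>D. \<exists>A. error_weight r N A = D \<and> \<not> detectable r N Q A)"
  obtain D0 where "W D0" using ex_undetectable[OF Q dim r N] unfolding W_def by blast
  then have D: "W (LEAST D. W D)" by (rule LeastI)
  have "has_min_distance r N Q (LEAST D. W D)"
    unfolding has_min_distance_def
  proof (intro conjI allI impI)
    show "\<exists>A. error_weight r N A = (LEAST D. W D) \<and> \<not> detectable r N Q A" using D unfolding W_def .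
  next
    fix A assume "error_weight r N A < (LEAST D. W D)"
    then show "detectable r N Q A" using not_less_Least[of "error_weight r N A" W] unfolding W_def by blast
  qed
  moreover have "(LEAST D. W D) > t" using D det unfolding W_def by (metis not_le)
  ultimately show ?thesis using Q dim unfolding quantum_code_def by blast
qed

text \<open>The blocks play the role of cosets, and code words are constant on each of them. By
  \<open>dist\<close> an error on few positions cannot link two different words of the union, so it
  acts diagonally there. By \<open>unif\<close> the words of a block run evenly over all patterns on
  the affected positions, so the average of the diagonal is the normalised trace. It is the same
  scalar for all blocks, and being the trace it also meets the convention for dimension one.\<close>

lemma css_detectable:
  assumes E: "\<And>B. B \<in> \<B> \<Longrightarrow> B \<subseteq> words r N" and fin: "finite \<B>" and disj: "pairwise disjnt \<B>"
    and dist: "\<And>u v T. \<lbrakk>u \<in> \<Union>\<B>; v \<in> \<Union>\<B>; T \<subseteq> {..<N}; card T \<le> t;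
        \<And>i. i < N \<Longrightarrow> i \<notin> T \<Longrightarrow> u i = v i\<rbrakk> \<Longrightarrow> u = v"
    and unif: "\<And>B T \<sigma> \<tau>. \<lbrakk>B \<in> \<B>; T \<subseteq> {..<N}; card T \<le> t; \<sigma> \<in> T \<rightarrow>\<^sub>E {..<r}; \<tau> \<in> T \<rightarrow>\<^sub>E {..<r}\<rbrakk>
        \<Longrightarrow> card {u\<in>B. restrict u T = \<sigma>} = card {u\<in>B. restrict u T = \<tau>}"
    and r: "r > 0"
    and Q: "\<And>\<psi> w. \<psi> \<in> Q \<Longrightarrow> w \<notin> \<Union>\<B> \<Longrightarrow> \<psi> w = 0"
      "\<And>\<psi> B w w'. \<lbrakk>\<psi> \<in> Q; B \<in> \<B>; w \<in> B; w' \<in> B\<rbrakk> \<Longrightarrow> \<psi> w = \<psi> w'"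
    and wt: "error_weight r N A \<le> t"
  shows "detectable r N Q A"
proof -
  define T where "T = {i. i < N \<and> \<not> (\<exists>c. \<forall>a<r. \<forall>b<r. A i a b = (if a = b then c else 0))}"
  have T: "T \<subseteq> {..<N}" "card T \<le> t" "finite T"
    using wt unfolding T_def error_weight_def by auto
  have "\<forall>i. i < N \<and> i \<notin> T \<longrightarrow> (\<exists>c. \<forall>a<r. \<forall>b<r. A i a b = (if a = b then c else 0))"
    unfolding T_def by auto
  then obtain c where c: "\<And>i a b. \<lbrakk>i < N; i \<notin> T; a < r; b < r\<rbrakk> \<Longrightarrow> A i a b = (if a = b then c i else 0)"
    by metis
  define d where "d = (\<lambda>u. \<Prod>i<N. A i (u i) (u i))"
  define C where "C = (\<Prod>i\<in>{..<N} - T. c i)"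
  define tr where "tr = error_trace r N A / of_nat (r ^ N)"
  have UB: "\<Union>\<B> \<subseteq> words r N" using E by auto
  have finB: "finite B" if "B \<in> \<B>" for B using E[OF that] finite_words finite_subset by blast
  have split: "(\<Prod>i<N. h i) = (\<Prod>i\<in>T. h i) * (\<Prod>i\<in>{..<N} - T. h i)" for h :: "nat \<Rightarrow> complex"
    using prod.subset_diff[OF T(1), of h] by (simp add: mult.commute)
  have d: "d u = (\<Prod>i\<in>T. A i (u i) (u i)) * C" if "u \<in> words r N" for u
  proof -
    have "(\<Prod>i\<in>{..<N} - T. A i (u i) (u i)) = C"
      unfolding C_def using words_less[OF that] by (intro prod.cong) (auto simp: c)
    then show ?thesis unfolding d_def split by simp
  qed
  have trd: "error_trace r N A = (\<Prod>i\<in>T. \<Sum>a<r. A i a a) * (of_nat r ^ (N - card T) * C)"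
  proof -
    have "(\<Prod>i\<in>{..<N} - T. \<Sum>a<r. A i a a) = (\<Prod>i\<in>{..<N} - T. of_nat r * c i)"
      by (intro prod.cong) (auto simp: c)
    also have "\<dots> = of_nat r ^ (N - card T) * C"
      unfolding C_def using T by (simp add: prod.distrib card_Diff_subset)
    finally show ?thesis unfolding error_trace_def split by simp
  qed
  \<comment> \<open>The words of a block are grouped by their pattern on \<open>T\<close>. Each of
    the \<open>r ^ card T\<close> patterns occurs \<open>\<kappa>\<close> times, and the sum over
    all patterns factors into local traces.\<close>
  have sumd: "(\<Sum>u\<in>B. d u) = of_nat (card B) * tr" if B: "B \<in> \<B>" for B
  proof -
    let ?P = "T \<rightarrow>\<^sub>E {..<r}"
    have finP: "finite ?P" using T by (auto intro: finite_PiE)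
    have cardP: "card ?P = r ^ card T" using T by (simp add: card_PiE)
    define \<kappa> where "\<kappa> = card {u\<in>B. restrict u T = restrict (\<lambda>_. 0) T}"
    have \<kappa>: "card {u\<in>B. restrict u T = \<tau>} = \<kappa>" if "\<tau> \<in> ?P" for \<tau>
      unfolding \<kappa>_def by (rule unif[OF B T(1,2) that]) (use r in auto)
    have resP: "restrict u T \<in> ?P" if "u \<in> B" for u
      using E[OF B] that T(1) words_less[of u r N] by (auto simp: subset_iff)
    have gr: "(\<Sum>u\<in>B. h u) = (\<Sum>\<tau>\<in>?P. \<Sum>u\<in>{u\<in>B. restrict u T = \<tau>}. h u)" for h :: "_ \<Rightarrow> complex"
      using sum.group[OF finB[OF B] finP, of "\<lambda>u. restrict u T" h] resP by (auto simp: image_subset_iff)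
    have "of_nat (card B) = (\<Sum>u\<in>B. (1::complex))" by simp
    also have "\<dots> = (\<Sum>\<tau>\<in>?P. of_nat \<kappa>)"
      unfolding gr by (intro sum.cong) (auto simp: \<kappa>)
    also have "\<dots> = of_nat (r ^ card T) * of_nat \<kappa>" using cardP by simp
    finally have cB: "(of_nat (card B) :: complex) = of_nat r ^ card T * of_nat \<kappa>" by simp
    have "(\<Sum>u\<in>B. d u) = (\<Sum>u\<in>B. (\<Prod>i\<in>T. A i (u i) (u i)) * C)"
      using E[OF B] by (intro sum.cong) (auto simp: d subset_iff)
    also have "\<dots> = (\<Sum>\<tau>\<in>?P. \<Sum>u\<in>{u\<in>B. restrict u T = \<tau>}. (\<Prod>i\<in>T. A i (\<tau> i) (\<tau> i)) * C)"
      unfolding gr by (intro sum.cong refl arg_cong2[where f = "(*)"] prod.cong) auto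
    also have "\<dots> = (\<Sum>\<tau>\<in>?P. of_nat \<kappa> * ((\<Prod>i\<in>T. A i (\<tau> i) (\<tau> i)) * C))"
      by (intro sum.cong) (auto simp: \<kappa>)
    also have "\<dots> = of_nat \<kappa> * C * (\<Sum>\<tau>\<in>?P. \<Prod>i\<in>T. A i (\<tau> i) (\<tau> i))"
      by (simp add: sum_distrib_left mult_ac)
    also have "\<dots> = of_nat \<kappa> * C * (\<Prod>i\<in>T. \<Sum>a<r. A i a a)"
      using T by (subst prod_sum_PiE) auto
    also have "\<dots> = of_nat (card B) * tr"
    proof -
      have "card T \<le> N" using T card_mono[OF _ T(1)] by simp
      then have "(of_nat r :: complex) ^ N = of_nat r ^ card T * of_nat r ^ (N - card T)"
        by (simp flip: power_add)
      then show ?thesis unfolding tr_def trd cB using r by (simp add: field_simps)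
    qed
    finally show ?thesis .
  qed
  have diag: "(\<Prod>i<N. A i (u i) (v i)) = 0"
    if uv: "u \<in> \<Union>\<B>" "v \<in> \<Union>\<B>" "u \<noteq> v" for u v
  proof -
    obtain i where i: "i < N" "i \<notin> T" "u i \<noteq> v i" using dist[OF uv(1,2) T(1,2)] uv(3) by blast
    moreover have "u i < r" "v i < r" using words_less i UB uv by blast+
    ultimately have "\<exists>i\<in>{..<N}. A i (u i) (v i) = 0" using c by (intro bexI[of _ i]) auto
    then show ?thesis by (simp add: prod_zero_iff)
  qed
  have "qinner r N \<phi> (apply_error r N A \<psi>) = tr * qinner r N \<phi> \<psi>"
    if \<phi>: "\<phi> \<in> Q" and \<psi>: "\<psi> \<in> Q" for \<phi> \<psi>
  proof -
    have app: "apply_error r N A \<psi> u = d u * \<psi> u" if u: "u \<in> \<Union>\<B>" for u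
    proof -
      have "apply_error r N A \<psi> u = (\<Sum>v\<in>words r N. (\<Prod>i<N. A i (u i) (v i)) * \<psi> v)"
        unfolding apply_error_def using u UB by auto
      also have "\<dots> = (\<Sum>v\<in>words r N. if v = u then d u * \<psi> u else 0)"
      proof (intro sum.cong refl)
        fix v assume "v \<in> words r N"
        show "(\<Prod>i<N. A i (u i) (v i)) * \<psi> v = (if v = u then d u * \<psi> u else 0)"
          using diag[OF u, of v] Q(1)[OF \<psi>, of v] by (cases "v \<in> \<Union>\<B>"; cases "v = u") (auto simp: d_def)
      qed
      also have "\<dots> = d u * \<psi> u" using u UB by auto
      finally show ?thesis .
    qed
    have restr: "(\<Sum>u\<in>words r N. cnj (\<phi> u) * h u) = (\<Sum>B\<in>\<B>. \<Sum>u\<in>B. cnj (\<phi> u) * h u)" for h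
    proof -
      have "(\<Sum>u\<in>words r N. cnj (\<phi> u) * h u) = (\<Sum>u\<in>\<Union>\<B>. cnj (\<phi> u) * h u)"
        by (rule sum.mono_neutral_right) (use UB Q(1)[OF \<phi>] in auto)
      also have "\<dots> = (\<Sum>B\<in>\<B>. \<Sum>u\<in>B. cnj (\<phi> u) * h u)"
        using sum.Union_disjoint[of \<B> "\<lambda>u. cnj (\<phi> u) * h u"] finB disj
        by (auto simp: pairwise_def disjnt_def)
      finally show ?thesis .
    qed
    have "(\<Sum>u\<in>B. cnj (\<phi> u) * apply_error r N A \<psi> u) = tr * (\<Sum>u\<in>B. cnj (\<phi> u) * \<psi> u)"
      if B: "B \<in> \<B>" for B
    proof (cases "B = {}")
      case False
      then obtain w where w: "w \<in> B" by auto
      have "(\<Sum>u\<in>B. cnj (\<phi> u) * apply_error r N A \<psi> u) = (\<Sum>u\<in>B. cnj (\<phi> w) * \<psi> w * d u)"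
      proof (intro sum.cong refl)
        fix u assume "u \<in> B"
        then show "cnj (\<phi> u) * apply_error r N A \<psi> u = cnj (\<phi> w) * \<psi> w * d u"
          using app[of u] Q(2)[OF \<phi> B _ w, of u] Q(2)[OF \<psi> B _ w, of u] B by (auto simp: mult_ac)
      qed
      also have "\<dots> = cnj (\<phi> w) * \<psi> w * (of_nat (card B) * tr)"
        using sumd[OF B] by (simp flip: sum_distrib_left)
      also have "\<dots> = tr * (\<Sum>u\<in>B. cnj (\<phi> w) * \<psi> w)" by simp
      also have "(\<Sum>u\<in>B. cnj (\<phi> w) * \<psi> w) = (\<Sum>u\<in>B. cnj (\<phi> u) * \<psi> u)"
        using Q(2)[OF \<phi> B _ w] Q(2)[OF \<psi> B _ w] by (intro sum.cong refl) auto
      finally show ?thesis .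
    qed simp
    then show ?thesis unfolding qinner_def restr by (simp add: sum_distrib_left)
  qed
  then show ?thesis unfolding detectable_def tr_def by blast
qed

text \<open>Exactly \<open>r ^ s\<close> of the blocks are selected, and their indicator functions
  form a basis of the code. A lower bound for the number of blocks thus yields the exact
  dimension.\<close>

theorem css_code:
  assumes E: "\<And>B. B \<in> \<B> \<Longrightarrow> B \<subseteq> words r N" "\<And>B. B \<in> \<B> \<Longrightarrow> B \<noteq> {}" and disj: "pairwise disjnt \<B>"
    and card: "card \<B> \<ge> r ^ s"
    and dist: "\<And>u v T. \<lbrakk>u \<in> \<Union>\<B>; v \<in> \<Union>\<B>; T \<subseteq> {..<N}; card T \<le> t;
        \<And>i. i < N \<Longrightarrow> i \<notin> T \<Longrightarrow> u i = v i\<rbrakk> \<Longrightarrow> u = v"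
    and unif: "\<And>B T \<sigma> \<tau>. \<lbrakk>B \<in> \<B>; T \<subseteq> {..<N}; card T \<le> t; \<sigma> \<in> T \<rightarrow>\<^sub>E {..<r}; \<tau> \<in> T \<rightarrow>\<^sub>E {..<r}\<rbrakk>
        \<Longrightarrow> card {u\<in>B. restrict u T = \<sigma>} = card {u\<in>B. restrict u T = \<tau>}"
    and r: "r \<ge> 2" and N: "N \<ge> 1"
  shows "\<exists>Q D. quantum_code r N s D Q \<and> D > t"
proof -
  obtain \<B>' where \<B>': "\<B>' \<subseteq> \<B>" "card \<B>' = r ^ s" "finite \<B>'"
    using obtain_subset_with_card_n[OF card] by blast
  define ind :: "(nat \<Rightarrow> nat) set \<Rightarrow> qvec" where "ind = (\<lambda>B w. if w \<in> B then 1 else 0)"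
  define Q where "Q = qvec.span (ind ` \<B>')"
  have eqB: "B = B'" if "B \<in> \<B>" "B' \<in> \<B>" "w \<in> B" "w \<in> B'" for B B' w
    using disj that unfolding pairwise_def disjnt_def by blast
  have inj: "inj_on ind \<B>'"
  proof (rule inj_onI)
    fix B B' assume B: "B \<in> \<B>'" "B' \<in> \<B>'" "ind B = ind B'"
    have "w \<in> B \<longleftrightarrow> w \<in> B'" for w
      using fun_cong[OF B(3), of w] unfolding ind_def by (auto split: if_splits)
    then show "B = B'" by auto
  qed
  have ind: "qvec.independent (ind ` \<B>')"
    unfolding qvec.independent_explicit_module
  proof (intro allI impI)
    fix U f and x :: qvec
    assume U: "finite U" "U \<subseteq> ind ` \<B>'" and s: "(\<Sum>v\<in>U. (\<lambda>w. f v * v w)) = 0" and x: "x \<in> U"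
    obtain B where B: "B \<in> \<B>'" "x = ind B" using U x by auto
    obtain w where w: "w \<in> B" using B E(2) \<B>' by blast
    have "0 = (\<Sum>v\<in>U. (\<lambda>w. f v * v w)) w" using s by simp
    also have "\<dots> = (\<Sum>v\<in>U. f v * v w)" by (simp add: sum_apply_fun)
    also have "\<dots> = (\<Sum>v\<in>U. if v = x then f x else 0)"
    proof (intro sum.cong refl)
      fix v assume "v \<in> U"
      then obtain B' where B': "B' \<in> \<B>'" "v = ind B'" using U by auto
      show "f v * v w = (if v = x then f x else 0)"
      proof (cases "v = x")
        case False
        then have "w \<notin> B'" using eqB[of B B' w] B B' w \<B>' by auto
        then show ?thesis using False B' by (simp add: ind_def)
      qed (use B w in \<open>simp add: ind_def\<close>)
    qed
    also have "\<dots> = f x" using U x by simp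
    finally show "f x = 0" by simp
  qed
  have dim: "qvec.dim Q = r ^ s"
    unfolding Q_def using qvec.dim_span_eq_card_independent[OF ind] \<B>' card_image[OF inj] by simp
  have sub: "qvec.subspace Q" unfolding Q_def by simp
  have zero: "\<psi> w = 0" if "\<psi> \<in> Q" "w \<notin> \<Union>\<B>'" for \<psi> w
    using that(1) unfolding Q_def
  proof (induction rule: qvec.span_induct)
    case base show ?case by (auto simp: qvec.subspace_def)
  next
    case (step x) then show ?case using that(2) by (auto simp: ind_def)
  qed
  have const: "\<psi> w = \<psi> w'" if "\<psi> \<in> Q" "B \<in> \<B>'" "w \<in> B" "w' \<in> B" for \<psi> w w' B
    using that(1) unfolding Q_def
  proof (induction rule: qvec.span_induct)
    case base show ?case by (auto simp: qvec.subspace_def)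
  next
    case (step x)
    then obtain X where X: "X \<in> \<B>'" "x = ind X" by auto
    have "w \<in> X \<longleftrightarrow> w' \<in> X" using that(2-4) X(1) eqB[of B X] \<B>'(1) by blast
    then show ?case using X by (simp add: ind_def)
  qed
  have Qsp: "Q \<subseteq> qspace r N"
    unfolding qspace_def using zero E(1) \<B>' by blast
  have "\<exists>D>t. quantum_code r N s D Q"
  proof (rule quantum_codeI[OF sub Qsp dim r N])
    fix A assume wt: "error_weight r N A \<le> t"
    show "detectable r N Q A"
    proof (rule css_detectable[where \<B> = \<B>' and t = t])
      fix B assume "B \<in> \<B>'"
      then have B: "B \<in> \<B>" using \<B>' by auto
      then show "B \<subseteq> words r N" by (rule E)
      show "card {u\<in>B. restrict u T = \<sigma>} = card {u\<in>B. restrict u T = \<tau>}"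
        if "T \<subseteq> {..<N}" "card T \<le> t" "\<sigma> \<in> T \<rightarrow>\<^sub>E {..<r}" "\<tau> \<in> T \<rightarrow>\<^sub>E {..<r}" for T \<sigma> \<tau>
        using unif[OF B that] .
    next
      show "u = v" if "u \<in> \<Union>\<B>'" "v \<in> \<Union>\<B>'" "T \<subseteq> {..<N}" "card T \<le> t"
        "\<And>i. i < N \<Longrightarrow> i \<notin> T \<Longrightarrow> u i = v i" for u v T
        using dist[of u v T] that \<B>' by blast
    next
      show "pairwise disjnt \<B>'" using disj \<B>'(1) pairwise_subset by blast
    next
      show "\<psi> w = 0" if "\<psi> \<in> Q" "w \<notin> \<Union>\<B>'" for \<psi> w
        using zero[OF that] .
    next
      show "\<psi> w = \<psi> w'" if "\<psi> \<in> Q" "B \<in> \<B>'" "w \<in> B" "w' \<in> B" for \<psi> B w w'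
        using const[OF that] .
    next
      show "finite \<B>'" "r > 0" "error_weight r N A \<le> t"
        using \<B>'(3) r wt by simp_all
    qed
  qed
  then show ?thesis by blast
qed

section \<open>The quantum Singleton bound\<close>

text \<open>Gaussian elimination without division, modulo a prime ideal. The zero ideal serves the
  complex rank estimates, the maximal ideal of a finite field the evaluation codes.\<close>

lemma underdetermined_system:
  fixes I :: "'a::comm_ring_1 set" and M :: "'b \<Rightarrow> 'c \<Rightarrow> 'a"
  assumes I: "0 \<in> I" "\<And>a b. a \<in> I \<Longrightarrow> b \<in> I \<Longrightarrow> a + b \<in> I" "\<And>a b. a \<in> I \<Longrightarrow> a * b \<in> I"
    and prime: "\<And>a b. a * b \<in> I \<Longrightarrow> a \<in> I \<or> b \<in> I" and one: "1 \<notin> I"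
    and fin: "finite E" "finite X" and card: "card E < card X"
  shows "\<exists>\<nu>. (\<exists>x\<in>X. \<nu> x \<notin> I) \<and> (\<forall>e\<in>E. (\<Sum>x\<in>X. \<nu> x * M x e) \<in> I)"
  using fin card
proof (induction E arbitrary: X M rule: finite_induct)
  case empty
  then obtain x where "x \<in> X" by fastforce
  then show ?case using one by (intro exI[of _ "\<lambda>_. 1"]) auto
next
  case (insert e E)
  have sumI: "(\<Sum>x\<in>S. f x) \<in> I" if "\<And>x. x \<in> S \<Longrightarrow> f x \<in> I" for S and f :: "'b \<Rightarrow> 'a"
    using that by (induction S rule: infinite_finite_induct) (auto intro: I)
  show ?case
  proof (cases "\<forall>x\<in>X. M x e \<in> I")
    case True
    obtain \<nu> where "\<exists>x\<in>X. \<nu> x \<notin> I" "\<forall>e\<in>E. (\<Sum>x\<in>X. \<nu> x * M x e) \<in> I"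
      using insert.IH[of X M] insert.prems insert.hyps by auto
    moreover have "(\<Sum>x\<in>X. \<nu> x * M x e) \<in> I"
      using True I(3) by (intro sumI) (metis mult.commute)
    ultimately show ?thesis by blast
  next
    case False
    then obtain x0 where x0: "x0 \<in> X" "M x0 e \<notin> I" by auto
    define X' where "X' = X - {x0}"
    have X': "finite X'" "x0 \<notin> X'" "X = insert x0 X'" "card E < card X'"
      using insert x0 unfolding X'_def by auto
    obtain \<nu> where \<nu>: "\<exists>x\<in>X'. \<nu> x \<notin> I"
      "\<And>e'. e' \<in> E \<Longrightarrow> (\<Sum>x\<in>X'. \<nu> x * (M x e' * M x0 e - M x e * M x0 e')) \<in> I"
      using insert.IH[of X' "\<lambda>x e'. M x e' * M x0 e - M x e * M x0 e'"] X' by auto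
    \<comment> \<open>The coefficient of \<open>x0\<close> is chosen to satisfy equation
      \<open>e\<close>. Multiplying the others by the pivot \<open>M x0 e\<close> replaces a
      division, and primality keeps some coefficient outside \<open>I\<close>.\<close>
    define \<mu> where "\<mu> = (\<lambda>x. if x = x0 then - (\<Sum>x\<in>X'. \<nu> x * M x e) else \<nu> x * M x0 e)"
    have \<mu>: "(\<Sum>x\<in>X. \<mu> x * M x e') = (\<Sum>x\<in>X'. \<nu> x * (M x e' * M x0 e - M x e * M x0 e'))" for e'
    proof -
      have "(\<Sum>x\<in>X. \<mu> x * M x e') = \<mu> x0 * M x0 e' + (\<Sum>x\<in>X'. \<mu> x * M x e')"
        using X' by simp
      also have "(\<Sum>x\<in>X'. \<mu> x * M x e') = (\<Sum>x\<in>X'. \<nu> x * M x0 e * M x e')"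
        using X' by (intro sum.cong) (auto simp: \<mu>_def)
      also have "\<mu> x0 * M x0 e' = - (\<Sum>x\<in>X'. \<nu> x * M x e * M x0 e')"
        by (simp add: \<mu>_def sum_distrib_right)
      finally show ?thesis by (simp add: sum_subtractf algebra_simps)
    qed
    have "\<exists>x\<in>X. \<mu> x \<notin> I"
    proof -
      obtain x where "x \<in> X'" "\<nu> x \<notin> I" using \<nu> by auto
      then show ?thesis using prime[of "\<nu> x" "M x0 e"] x0 X'
        by (intro bexI[of _ x]) (auto simp: \<mu>_def)
    qed
    moreover have "(\<Sum>x\<in>X. \<mu> x * M x e) \<in> I"
      unfolding \<mu> using I(1) by (simp add: mult.commute)
    ultimately show ?thesis using \<mu> \<nu> by (intro exI[of _ \<mu>]) auto
  qed
qed

corollary underdetermined_system_complex: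
  fixes M :: "'b \<Rightarrow> 'c \<Rightarrow> complex"
  assumes "finite E" "finite X" "card E < card X"
  shows "\<exists>\<nu>. (\<exists>x\<in>X. \<nu> x \<noteq> 0) \<and> (\<forall>e\<in>E. (\<Sum>x\<in>X. \<nu> x * M x e) = 0)"
  using underdetermined_system[of "{0}", OF _ _ _ _ _ assms, of M] by simp

lemma sum_rotate: "(\<Sum>y\<in>Y. \<Sum>a\<in>A. \<Sum>b\<in>B. f y a b) = (\<Sum>a\<in>A. \<Sum>b\<in>B. \<Sum>y\<in>Y. f y a b)"
proof -
  have "(\<Sum>y\<in>Y. \<Sum>a\<in>A. \<Sum>b\<in>B. f y a b) = (\<Sum>a\<in>A. \<Sum>y\<in>Y. \<Sum>b\<in>B. f y a b)" by (rule sum.swap)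
  also have "\<dots> = (\<Sum>a\<in>A. \<Sum>b\<in>B. \<Sum>y\<in>Y. f y a b)" by (intro sum.cong refl sum.swap)
  finally show ?thesis .
qed

section \<open>Slices of code words and their ranks\<close>

definition glue :: "nat set \<Rightarrow> (nat \<Rightarrow> nat) \<Rightarrow> (nat \<Rightarrow> nat) \<Rightarrow> nat \<Rightarrow> nat" where
  "glue A a u = (\<lambda>i. if i \<in> A then a i else u i)"

abbreviation subwords :: "nat \<Rightarrow> nat set \<Rightarrow> (nat \<Rightarrow> nat) set" where
  "subwords r A \<equiv> A \<rightarrow>\<^sub>E {..<r}"

lemma glue_in_words:
  "\<lbrakk>A \<subseteq> {..<N}; a \<in> subwords r A; y \<in> subwords r ({..<N} - A)\<rbrakk> \<Longrightarrow> glue A a y \<in> words r N"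
  unfolding words_def glue_def by (auto simp: PiE_iff extensional_def)

text \<open>The matrix unit from \<open>a'\<close> to \<open>a\<close> on the positions in
  \<open>A\<close>, tensored with the identity elsewhere.\<close>

definition transition_error :: "nat set \<Rightarrow> (nat \<Rightarrow> nat) \<Rightarrow> (nat \<Rightarrow> nat) \<Rightarrow> qerror" where
  "transition_error A a a' =
     (\<lambda>i x y. if (if i \<in> A then x = a i \<and> y = a' i else x = y) then 1 else 0)"

lemma error_weight_transition_error:
  assumes "finite A"
  shows "error_weight r N (transition_error A a a') \<le> card A"
  unfolding error_weight_def
proof (rule card_mono[OF assms], rule subsetI, rule ccontr)
  fix i
  assume i: "i \<in> {i. i < N \<and> \<not> (\<exists>c. \<forall>x<r. \<forall>y<r. transition_error A a a' i x y = (if x = y then c else 0))}"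
    and "i \<notin> A"
  then have "\<forall>x<r. \<forall>y<r. transition_error A a a' i x y = (if x = y then 1 else 0)"
    by (simp add: transition_error_def)
  then show False using i by blast
qed

lemma error_trace_transition_error:
  assumes "A \<subseteq> {..<N}" "a \<in> subwords r A" "a' \<in> subwords r A" "r > 0"
  shows "error_trace r N (transition_error A a a') / of_nat (r ^ N)
      = (if a = a' then 1 / of_nat r ^ card A else 0)"
proof -
  have fA: "finite A" using assms finite_subset by blast
  have "(\<Sum>x<r. transition_error A a a' i x x) =
      (if i \<in> A then (if a i = a' i then 1 else 0) else of_nat r)" for i
  proof (cases "i \<in> A")
    case True
    then have "(\<Sum>x<r. transition_error A a a' i x x) = (\<Sum>x<r. if x = a i then if a i = a' i then 1 else 0 else 0)"
      by (intro sum.cong) (auto simp: transition_error_def)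
    then show ?thesis using True assms(2) by (auto simp: PiE_iff)
  qed (auto simp: transition_error_def)
  then have "error_trace r N (transition_error A a a') =
     (\<Prod>i<N. if i \<in> A then (if a i = a' i then 1 else 0) else of_nat r)"
    unfolding error_trace_def by simp
  also have "\<dots> = (\<Prod>i\<in>A. if a i = a' i then 1 else 0) * of_nat r ^ (N - card A)"
    using prod.subset_diff[OF assms(1), of "\<lambda>i. if i \<in> A then (if a i = a' i then 1 else 0 :: complex) else of_nat r"]
      fA assms(1) by (simp add: card_Diff_subset mult.commute)
  also have "(\<Prod>i\<in>A. if a i = a' i then 1 else 0 :: complex) = (if a = a' then 1 else 0)"
  proof (cases "a = a'")
    case False
    then obtain i where "i \<in> A" "a i \<noteq> a' i" using PiE_ext[OF assms(2,3)] by blast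
    then have "\<exists>i\<in>A. (if a i = a' i then 1 else 0 :: complex) = 0" by auto
    then show ?thesis using False fA by (simp add: prod_zero_iff)
  qed simp
  finally have e: "error_trace r N (transition_error A a a')
      = (if a = a' then 1 else 0) * of_nat r ^ (N - card A)" .
  have "card A \<le> N" using card_mono[OF _ assms(1)] by simp
  then have "(of_nat r :: complex) ^ N = of_nat r ^ card A * of_nat r ^ (N - card A)"
    by (simp flip: power_add)
  then show ?thesis unfolding e using assms(4) by simp
qed

text \<open>Only words that continue \<open>a\<close> and \<open>a'\<close> by the same
  \<open>y\<close> contribute. Detectability therefore says that inner products of slices are those
  of the code words, up to a factor depending on \<open>a\<close> and \<open>a'\<close>.\<close>

lemma qinner_transition_error:
  assumes A: "A \<subseteq> {..<N}" and a: "a \<in> subwords r A" "a' \<in> subwords r A"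
  shows "qinner r N \<phi> (apply_error r N (transition_error A a a') \<psi>) =
    (\<Sum>y\<in>subwords r ({..<N} - A). cnj (\<phi> (glue A a y)) * \<psi> (glue A a' y))"
proof -
  let ?P = "\<lambda>u. \<forall>i\<in>A. u i = a i"
  have app: "apply_error r N (transition_error A a a') \<psi> u = (if ?P u then \<psi> (glue A a' u) else 0)"
    if u: "u \<in> words r N" for u
  proof -
    have gw: "glue A a' u \<in> words r N"
      using u A a unfolding words_def glue_def by (auto simp: PiE_iff extensional_def)
    have "(\<Prod>i<N. transition_error A a a' i (u i) (v i)) = (if ?P u \<and> v = glue A a' u then 1 else 0)"
      if v: "v \<in> words r N" for v
    proof (cases "?P u \<and> v = glue A a' u")
      case True
      then have "\<And>i. transition_error A a a' i (u i) (v i) = 1"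
        by (auto simp: transition_error_def glue_def)
      then show ?thesis using True by simp
    next
      case False
      have "\<exists>i\<in>{..<N}. transition_error A a a' i (u i) (v i) = 0"
      proof (cases "?P u")
        case True
        then have "v \<noteq> glue A a' u" using False by simp
        then obtain i where "i < N" "v i \<noteq> glue A a' u i" using words_eqI[OF v gw] by blast
        then show ?thesis by (intro bexI[of _ i]) (auto simp: transition_error_def glue_def)
      next
        case f: False
        then obtain i where "i \<in> A" "u i \<noteq> a i" by blast
        then show ?thesis using A by (intro bexI[of _ i]) (auto simp: transition_error_def)
      qed
      then have "(\<Prod>i<N. transition_error A a a' i (u i) (v i)) = 0" by (simp add: prod_zero_iff)
      then show ?thesis by (simp only: False if_False)
    qed
    note pr = this
    have "apply_error r N (transition_error A a a') \<psi> u =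
        (\<Sum>v\<in>words r N. (\<Prod>i<N. transition_error A a a' i (u i) (v i)) * \<psi> v)"
      unfolding apply_error_def using u by simp
    also have "\<dots> = (\<Sum>v\<in>words r N. if v = glue A a' u then if ?P u then \<psi> (glue A a' u) else 0 else 0)"
      by (intro sum.cong refl) (simp add: pr)
    also have "\<dots> = (if ?P u then \<psi> (glue A a' u) else 0)" using gw by simp
    finally show ?thesis .
  qed
  have "qinner r N \<phi> (apply_error r N (transition_error A a a') \<psi>) =
      (\<Sum>u\<in>words r N. if ?P u then cnj (\<phi> u) * \<psi> (glue A a' u) else 0)"
    unfolding qinner_def by (intro sum.cong) (auto simp: app)
  also have "\<dots> = (\<Sum>u | u \<in> words r N \<and> ?P u. cnj (\<phi> u) * \<psi> (glue A a' u))"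
    by (simp add: sum.inter_filter)
  also have "\<dots> = (\<Sum>y\<in>subwords r ({..<N} - A). cnj (\<phi> (glue A a y)) * \<psi> (glue A a' y))"
  proof (rule sum.reindex_bij_witness[where i = "glue A a" and j = "\<lambda>u. restrict u ({..<N} - A)"])
    fix u assume "u \<in> {u \<in> words r N. ?P u}"
    then have u: "u \<in> words r N" "?P u" by auto
    then show g: "glue A a (restrict u ({..<N} - A)) = u"
      by (auto simp: glue_def fun_eq_iff words_def PiE_iff extensional_def)
    show "restrict u ({..<N} - A) \<in> subwords r ({..<N} - A)"
      using u by (auto simp: words_def)
    have "glue A a' (restrict u ({..<N} - A)) = glue A a' u"
      using u A by (auto simp: glue_def fun_eq_iff words_def PiE_iff extensional_def)
    then show "cnj (\<phi> (glue A a (restrict u ({..<N} - A)))) * \<psi> (glue A a' (restrict u ({..<N} - A)))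
        = cnj (\<phi> u) * \<psi> (glue A a' u)" using g by simp
  next
    fix y assume y: "y \<in> subwords r ({..<N} - A)"
    show "restrict (glue A a y) ({..<N} - A) = y"
      using y by (auto simp: glue_def fun_eq_iff PiE_iff extensional_def)
    show "glue A a y \<in> {u \<in> words r N. ?P u}"
      using glue_in_words[OF A a(1) y] by (auto simp: glue_def)
  qed
  finally show ?thesis .
qed

text \<open>The values \<open>\<psi> (glue A a y)\<close> form a matrix with rows \<open>a\<close>
  and columns \<open>(\<psi>, y)\<close>. An independent and spanning set of rows has as many
  elements as the rank of the reduced state on \<open>A\<close> of the uniform mixture over the
  code; this rank takes the place of the entropy.\<close>

definition slice_independent :: "nat \<Rightarrow> nat \<Rightarrow> qvec set \<Rightarrow> nat set \<Rightarrow> (nat \<Rightarrow> nat) set \<Rightarrow> bool" where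
  "slice_independent r N Q A A0 \<longleftrightarrow>
     (\<forall>x. (\<forall>\<psi>\<in>Q. \<forall>y\<in>subwords r ({..<N} - A). (\<Sum>a\<in>A0. x a * \<psi> (glue A a y)) = 0)
        \<longrightarrow> (\<forall>a\<in>A0. x a = 0))"

definition slice_spanning :: "nat \<Rightarrow> nat \<Rightarrow> qvec set \<Rightarrow> nat set \<Rightarrow> (nat \<Rightarrow> nat) set \<Rightarrow> bool" where
  "slice_spanning r N Q A A0 \<longleftrightarrow>
     (\<forall>a\<in>subwords r A. \<exists>x. \<forall>\<psi>\<in>Q. \<forall>y\<in>subwords r ({..<N} - A).
        \<psi> (glue A a y) = (\<Sum>a0\<in>A0. x a0 * \<psi> (glue A a0 y)))"

lemma finite_subwords: "finite A \<Longrightarrow> finite (subwords r A)"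
  by (auto intro: finite_PiE)

lemma ex_slice_basis:
  assumes "finite A"
  shows "\<exists>A0\<subseteq>subwords r A. slice_independent r N Q A A0 \<and> slice_spanning r N Q A A0"
proof -
  let ?P = "\<lambda>A0. A0 \<subseteq> subwords r A \<and> slice_independent r N Q A A0"
  have fin: "finite (subwords r A)" using finite_subwords[OF assms] .
  have "\<exists>A0. ?P A0 \<and> (\<forall>A1. ?P A1 \<longrightarrow> card A1 \<le> card A0)"
  proof (rule Lattices_Big.ex_has_greatest_nat)
    show "?P {}" by (simp add: slice_independent_def)
    show "\<forall>A0. ?P A0 \<longrightarrow> card A0 < Suc (card (subwords r A))"
      using card_mono[OF fin] by (simp add: less_Suc_eq_le)
  qed
  then obtain A0 where A0: "?P A0" and mx: "\<And>A1. ?P A1 \<Longrightarrow> card A1 \<le> card A0" by blast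
  have finA0: "finite A0" using A0 fin finite_subset by blast
  have "slice_spanning r N Q A A0"
    unfolding slice_spanning_def
  proof
    fix b assume b: "b \<in> subwords r A"
    show "\<exists>x. \<forall>\<psi>\<in>Q. \<forall>y\<in>subwords r ({..<N} - A). \<psi> (glue A b y) = (\<Sum>a0\<in>A0. x a0 * \<psi> (glue A a0 y))"
    proof (cases "b \<in> A0")
      case True
      have "(\<Sum>a0\<in>A0. (if a0 = b then 1 else 0) * \<psi> (glue A a0 y)) = \<psi> (glue A b y)" for \<psi> :: qvec and y
      proof -
        have "(\<Sum>a0\<in>A0. (if a0 = b then 1 else 0) * \<psi> (glue A a0 y)) = (\<Sum>a0\<in>A0. if a0 = b then \<psi> (glue A b y) else 0)"
          by (intro sum.cong) auto
        then show ?thesis using True finA0 by simp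
      qed
      then show ?thesis by (intro exI[of _ "\<lambda>a0. if a0 = b then 1 else 0"]) simp
    next
      case False
      then have "\<not> ?P (insert b A0)" using mx[of "insert b A0"] finA0 by auto
      then have "\<not> slice_independent r N Q A (insert b A0)" using A0 b by auto
      then obtain x where x: "\<And>\<psi> y. \<psi> \<in> Q \<Longrightarrow> y \<in> subwords r ({..<N} - A) \<Longrightarrow>
          (\<Sum>a\<in>insert b A0. x a * \<psi> (glue A a y)) = 0" and nz: "\<exists>a\<in>insert b A0. x a \<noteq> 0"
        unfolding slice_independent_def by blast
      have x': "x b * \<psi> (glue A b y) + (\<Sum>a\<in>A0. x a * \<psi> (glue A a y)) = 0"
        if "\<psi> \<in> Q" "y \<in> subwords r ({..<N} - A)" for \<psi> y
        using x[OF that] False finA0 by simp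
      have "x b \<noteq> 0"
      proof
        assume "x b = 0"
        then have "\<forall>a\<in>A0. x a = 0" using x' A0 unfolding slice_independent_def by auto
        then show False using nz \<open>x b = 0\<close> by auto
      qed
      have e: "\<psi> (glue A b y) = (\<Sum>a0\<in>A0. (- x a0 / x b) * \<psi> (glue A a0 y))"
        if "\<psi> \<in> Q" "y \<in> subwords r ({..<N} - A)" for \<psi> y
      proof -
        have "x b * (\<Sum>a0\<in>A0. (- x a0 / x b) * \<psi> (glue A a0 y)) = - (\<Sum>a\<in>A0. x a * \<psi> (glue A a y))"
          using \<open>x b \<noteq> 0\<close> by (simp add: sum_distrib_left sum_negf)
        also have "\<dots> = x b * \<psi> (glue A b y)" using x'[OF that] by (metis add.commute add_eq_0_iff)
        finally show ?thesis using \<open>x b \<noteq> 0\<close> by simp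
      qed
      show ?thesis by (intro exI[of _ "\<lambda>a0. - x a0 / x b"] ballI) (rule e)
    qed
  qed
  then show ?thesis using A0 by blast
qed

text \<open>
  If the Knill--Laflamme condition holds on the positions \<open>A\<close> with matrix \<open>M\<close>, then a family
  \<open>\<phi> a\<close> of code words with \<open>\<Sum>a. \<phi> a (a, \<cdot>) = 0\<close> satisfies
  \<open>0 = \<parallel>\<Sum>a. \<phi> a (a, \<cdot>)\<parallel>\<^sup>2 = \<Sum>w. \<Sum>a a'. M a a' * cnj (\<phi> a w) * \<phi> a' w\<close>. As \<open>M\<close> is positive
  semidefinite, every summand vanishes, so that all vectors \<open>(\<phi> a w)\<^sub>a\<close> annihilate the slices
  of the code.
\<close>

lemma slices_direct:
  assumes A: "A \<subseteq> {..<N}" and A0: "A0 \<subseteq> subwords r A" and ind: "slice_independent r N Q A A0"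
    and Q: "Q \<subseteq> qspace r N" "\<psi>1 \<in> Q" "\<psi>1 \<noteq> 0"
    and M: "\<And>\<phi> \<psi> a a'. \<lbrakk>\<phi> \<in> Q; \<psi> \<in> Q; a \<in> A0; a' \<in> A0\<rbrakk> \<Longrightarrow>
      (\<Sum>y\<in>subwords r ({..<N} - A). cnj (\<phi> (glue A a y)) * \<psi> (glue A a' y)) = M a a' * qinner r N \<phi> \<psi>"
    and \<phi>: "\<And>a. a \<in> A0 \<Longrightarrow> \<phi> a \<in> Q"
    and zero: "\<And>y. y \<in> subwords r ({..<N} - A) \<Longrightarrow> (\<Sum>a\<in>A0. \<phi> a (glue A a y)) = 0"
    and a: "a \<in> A0"
  shows "\<phi> a = 0"
proof -
  let ?Y = "subwords r ({..<N} - A)"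
  have fin: "finite A0" "finite ?Y"
    using A A0 finite_subwords[of A r] finite_subset finite_subset[OF A] by (blast, simp add: finite_subwords)
  define qf where "qf = (\<lambda>x. \<Sum>a\<in>A0. \<Sum>a'\<in>A0. M a a' * (cnj (x a) * x a'))"
  have sq: "of_real ((cmod (\<Sum>a\<in>A0. h a))\<^sup>2) = (\<Sum>a\<in>A0. \<Sum>a'\<in>A0. cnj (h a) * h a')" for h :: "_ \<Rightarrow> complex"
  proof -
    have "of_real ((cmod (sum h A0))\<^sup>2) = cnj (sum h A0) * sum h A0"
      by (simp only: complex_norm_square mult.commute)
    then show ?thesis by (simp only: cnj_sum sum_product)
  qed
  have qf: "of_real (\<Sum>y\<in>?Y. (cmod (\<Sum>a\<in>A0. x a * \<psi> (glue A a y)))\<^sup>2) = qf x * qinner r N \<psi> \<psi>"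
    if "\<psi> \<in> Q" for x \<psi>
  proof -
    have "of_real (\<Sum>y\<in>?Y. (cmod (\<Sum>a\<in>A0. x a * \<psi> (glue A a y)))\<^sup>2) =
       (\<Sum>y\<in>?Y. \<Sum>a\<in>A0. \<Sum>a'\<in>A0. (cnj (x a) * x a') * (cnj (\<psi> (glue A a y)) * \<psi> (glue A a' y)))"
      unfolding of_real_sum sq by (simp add: mult_ac)
    also have "\<dots> = (\<Sum>a\<in>A0. \<Sum>a'\<in>A0. (cnj (x a) * x a') * (\<Sum>y\<in>?Y. cnj (\<psi> (glue A a y)) * \<psi> (glue A a' y)))"
      unfolding sum_distrib_left by (rule sum_rotate)
    also have "\<dots> = qf x * qinner r N \<psi> \<psi>"
      unfolding qf_def sum_distrib_right by (intro sum.cong refl) (subst M[OF that that], simp_all add: mult_ac)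
    finally show ?thesis .
  qed
  have tot: "(\<Sum>w\<in>words r N. qf (\<lambda>a. \<phi> a w)) = 0"
  proof -
    have "0 = (\<Sum>y\<in>?Y. complex_of_real ((cmod (\<Sum>a\<in>A0. \<phi> a (glue A a y)))\<^sup>2))"
      using zero by simp
    also have "\<dots> = (\<Sum>y\<in>?Y. \<Sum>a\<in>A0. \<Sum>a'\<in>A0. cnj (\<phi> a (glue A a y)) * \<phi> a' (glue A a' y))"
      unfolding sq ..
    also have "\<dots> = (\<Sum>a\<in>A0. \<Sum>a'\<in>A0. \<Sum>y\<in>?Y. cnj (\<phi> a (glue A a y)) * \<phi> a' (glue A a' y))"
      by (rule sum_rotate)
    also have "\<dots> = (\<Sum>a\<in>A0. \<Sum>a'\<in>A0. \<Sum>w\<in>words r N. M a a' * (cnj (\<phi> a w) * \<phi> a' w))"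
      unfolding sum_distrib_left[symmetric] qinner_def[symmetric] by (intro sum.cong refl M \<phi>)
    also have "\<dots> = (\<Sum>w\<in>words r N. qf (\<lambda>a. \<phi> a w))"
      unfolding qf_def by (rule sum_rotate[symmetric])
    finally show ?thesis by simp
  qed
  \<comment> \<open>Positivity of the form \<open>qf\<close> is read off from the one nonzero code
    word \<open>\<psi>1\<close>: the value of \<open>qf\<close> times the squared norm of
    \<open>\<psi>1\<close> is a sum of squares.\<close>
  define sn where "sn = (\<lambda>w. \<Sum>y\<in>?Y. (cmod (\<Sum>a\<in>A0. \<phi> a w * \<psi>1 (glue A a y)))\<^sup>2)"
  have snq: "of_real (sn w) = qf (\<lambda>a. \<phi> a w) * qinner r N \<psi>1 \<psi>1" for w
    unfolding sn_def by (rule qf[OF Q(2)])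
  have "of_real (\<Sum>w\<in>words r N. sn w) = (\<Sum>w\<in>words r N. qf (\<lambda>a. \<phi> a w)) * qinner r N \<psi>1 \<psi>1"
    by (simp only: of_real_sum snq sum_distrib_right)
  then have "(\<Sum>w\<in>words r N. sn w) = 0" by (simp only: tot mult_zero_left of_real_eq_0_iff)
  moreover have "sn w \<ge> 0" for w unfolding sn_def by (intro sum_nonneg) auto
  ultimately have sn0: "sn w = 0" if "w \<in> words r N" for w
    using that by (simp add: sum_nonneg_eq_0_iff)
  have n1: "qinner r N \<psi>1 \<psi>1 \<noteq> 0" using qinner_self_eq_0_iff[of \<psi>1 r N] Q by auto
  have "\<phi> a w = 0" if w: "w \<in> words r N" for w
  proof -
    have q0: "qf (\<lambda>a. \<phi> a w) = 0"
      using snq[of w] sn0[OF w] n1 by simp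
    have "(\<Sum>a\<in>A0. \<phi> a w * \<psi> (glue A a y)) = 0" if "\<psi> \<in> Q" "y \<in> ?Y" for \<psi> y
    proof -
      have "complex_of_real (\<Sum>y\<in>?Y. (cmod (\<Sum>a\<in>A0. \<phi> a w * \<psi> (glue A a y)))\<^sup>2) = 0"
        by (simp only: qf[OF that(1)] q0 mult_zero_left)
      then have "(\<Sum>y\<in>?Y. (cmod (\<Sum>a\<in>A0. \<phi> a w * \<psi> (glue A a y)))\<^sup>2) = 0"
        by (simp only: of_real_eq_0_iff)
      then show ?thesis using that(2) fin by (simp add: sum_nonneg_eq_0_iff)
    qed
    then show ?thesis 
      using ind[unfolded slice_independent_def, rule_format, of "\<lambda>a. \<phi> a w"] a by blast
  qed
  moreover have "\<phi> a w = 0" if "w \<notin> words r N" for w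
    using \<phi>[OF a] Q(1) that unfolding qspace_def by auto
  ultimately show ?thesis by (auto simp: fun_eq_iff)
qed

text \<open>In terms of entropy: a reference system of dimension \<open>K\<close> is decoupled from
  \<open>A\<close>, so both together have rank \<open>K * card A0\<close>, and they are purified by
  \<open>B\<close> and the remaining positions. Concretely, the map that sends a family
  \<open>\<phi> a\<close> of code words to the sum of \<open>\<phi> a (glue A a y)\<close> is
  injective by \<open>slices_direct\<close>, and its image is determined by the arguments whose part
  on \<open>B\<close> lies in \<open>B0\<close>.\<close>

lemma slice_rank_bound:
  assumes AB: "A \<subseteq> {..<N}" "B \<subseteq> {..<N}" "A \<inter> B = {}"
    and A0: "A0 \<subseteq> subwords r A" "slice_independent r N Q A A0"
    and B0: "B0 \<subseteq> subwords r B" "slice_spanning r N Q B B0"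
    and Q: "qvec.subspace Q" "Q \<subseteq> qspace r N" and dim: "qvec.dim Q = K" "K > 0"
    and M: "\<And>\<phi> \<psi> a a'. \<lbrakk>\<phi> \<in> Q; \<psi> \<in> Q; a \<in> A0; a' \<in> A0\<rbrakk> \<Longrightarrow>
      (\<Sum>y\<in>subwords r ({..<N} - A). cnj (\<phi> (glue A a y)) * \<psi> (glue A a' y)) = M a a' * qinner r N \<phi> \<psi>"
  shows "K * card A0 \<le> card B0 * r ^ (N - card A - card B)"
proof (rule ccontr)
  let ?C = "{..<N} - A - B"
  have finAB: "finite A" "finite B" using AB finite_subset by blast+
  have finB0: "finite B0" "finite A0"
    using finite_subset[OF B0(1)] finite_subset[OF A0(1)] finite_subwords finAB by blast+
  have finC: "finite (subwords r ?C)" by (simp add: finite_subwords)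
  have "card ?C = N - card A - card B"
  proof -
    have "?C = {..<N} - (A \<union> B)" by auto
    then show ?thesis using AB finAB by (simp add: card_Diff_subset card_Un_disjoint)
  qed
  then have cC: "card (subwords r ?C) = r ^ (N - card A - card B)" by (simp add: card_PiE)
  obtain Bs where Bs: "Bs \<subseteq> Q" "qvec.independent Bs" "Q \<subseteq> qvec.span Bs" "card Bs = qvec.dim Q"
    using qvec.basis_exists by blast
  have finBs: "finite Bs" using Bs(4) dim card_gt_0_iff by metis
  assume "\<not> K * card A0 \<le> card B0 * r ^ (N - card A - card B)"
  \<comment> \<open>The unknowns are the coefficients of a family \<open>\<phi> a\<close> in a basis
    of the code, the equations ask its image to vanish at all arguments with part in
    \<open>B0\<close>. A surplus of unknowns will contradict injectivity.\<close>
  then have lt: "card (B0 \<times> subwords r ?C) < card (Bs \<times> A0)"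
    using cC Bs(4) dim by (simp add: card_cartesian_product)
  obtain \<nu> where nz: "\<exists>x\<in>Bs \<times> A0. \<nu> x \<noteq> 0" and
    eq: "\<And>e. e \<in> B0 \<times> subwords r ?C \<Longrightarrow>
      (\<Sum>x\<in>Bs \<times> A0. \<nu> x * (\<lambda>(\<psi>,a) (b,c). \<psi> (glue A a (glue B b c))) x e) = 0"
    using underdetermined_system_complex[OF _ _ lt, of "\<lambda>(\<psi>,a) (b,c). \<psi> (glue A a (glue B b c))"]
      finB0 finC finBs by blast
  define \<phi> where "\<phi> = (\<lambda>a. \<Sum>\<psi>\<in>Bs. (\<lambda>w. \<nu> (\<psi>, a) * \<psi> w))"
  have \<phi>Q: "\<phi> a \<in> Q" for a
    unfolding \<phi>_def using Bs(1) by (intro qvec.subspace_sum Q qvec.subspace_scale) auto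
  have comm: "glue A a (glue B b c) = glue B b (glue A a c)" for a b c
    using AB(3) by (auto simp: glue_def fun_eq_iff)
  have zero0: "(\<Sum>a\<in>A0. \<phi> a (glue A a (glue B b c))) = 0" if "b \<in> B0" "c \<in> subwords r ?C" for b c
  proof -
    have "(\<Sum>a\<in>A0. \<phi> a (glue A a (glue B b c))) = (\<Sum>\<psi>\<in>Bs. \<Sum>a\<in>A0. \<nu> (\<psi>, a) * \<psi> (glue A a (glue B b c)))"
      unfolding \<phi>_def sum_apply_fun by (rule sum.swap)
    also have "\<dots> = 0" using eq[of "(b, c)"] that by (simp add: sum.cartesian_product split_def)
    finally show ?thesis .
  qed
  have zero: "(\<Sum>a\<in>A0. \<phi> a (glue A a y)) = 0" if y: "y \<in> subwords r ({..<N} - A)" for y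
  proof -
    define b where "b = restrict y B"
    define c where "c = restrict y ?C"
    have b: "b \<in> subwords r B" and c: "c \<in> subwords r ?C"
      using y AB unfolding b_def c_def by auto
    have yb: "y = glue B b c"
      using y AB by (auto simp: b_def c_def glue_def fun_eq_iff PiE_iff extensional_def)
    have Ac: "glue A a c \<in> subwords r ({..<N} - B)" if "a \<in> A0" for a
      using that c A0(1) AB by (auto simp: glue_def PiE_iff extensional_def)
    obtain x where x: "\<And>\<psi> y. \<psi> \<in> Q \<Longrightarrow> y \<in> subwords r ({..<N} - B) \<Longrightarrow>
        \<psi> (glue B b y) = (\<Sum>b0\<in>B0. x b0 * \<psi> (glue B b0 y))"
      using B0(2) b unfolding slice_spanning_def by blast
    have "(\<Sum>a\<in>A0. \<phi> a (glue A a y)) = (\<Sum>a\<in>A0. \<Sum>b0\<in>B0. x b0 * \<phi> a (glue A a (glue B b0 c)))"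
      unfolding yb comm by (intro sum.cong refl x \<phi>Q Ac)
    also have "\<dots> = (\<Sum>b0\<in>B0. x b0 * (\<Sum>a\<in>A0. \<phi> a (glue A a (glue B b0 c))))"
      by (subst sum.swap) (simp add: sum_distrib_left)
    also have "\<dots> = 0" using zero0[OF _ c] by simp
    finally show ?thesis .
  qed
  obtain \<psi>1 where \<psi>1: "\<psi>1 \<in> Q" "\<psi>1 \<noteq> 0"
  proof -
    have "Bs \<noteq> {}" using Bs(4) dim by auto
    then obtain \<psi>1 where "\<psi>1 \<in> Bs" by auto
    moreover have "\<psi>1 \<noteq> 0" using Bs(2) \<open>\<psi>1 \<in> Bs\<close> qvec.dependent_zero by metis
    ultimately show ?thesis using that Bs(1) by blast
  qed
  have \<phi>0: "\<phi> a = 0" if "a \<in> A0" for a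
    by (rule slices_direct[OF AB(1) A0 Q(2) \<psi>1 M \<phi>Q zero that])
  obtain \<psi> a where "\<psi> \<in> Bs" "a \<in> A0" "\<nu> (\<psi>, a) \<noteq> 0" using nz by auto
  note * = this
  have "\<phi> a = 0" using *(2) by (rule \<phi>0)
  then have "(\<Sum>\<psi>\<in>Bs. (\<lambda>w. \<nu> (\<psi>, a) * \<psi> w)) = 0" unfolding \<phi>_def .
  then have "\<nu> (\<psi>, a) = 0"
    by (rule qvec.independentD[OF Bs(2) finBs subset_refl]) (rule *(1))
  with *(3) show False by contradiction
qed

text \<open>For disjoint \<open>A\<close> and \<open>B\<close> of size below \<open>D\<close>, the
  rank inequality is applied in both orders; the two ranks cancel and leave
  \<open>r ^ k \<le> r ^ (N - card A - card B)\<close>.\<close>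

theorem quantum_singleton_bound:
  assumes code: "quantum_code r N k D Q" and r: "r \<ge> 2" and D: "D \<ge> 1"
  shows "k + 2 * D \<le> N + 2"
proof -
  have Q: "qvec.subspace Q" "Q \<subseteq> qspace r N" "qvec.dim Q = r ^ k" and md: "has_min_distance r N Q D"
    using code by (simp_all only: quantum_code_def)
  have Q: "qvec.subspace Q" "Q \<subseteq> qspace r N" "qvec.dim Q = r ^ k" "r ^ k > 0"
    using Q r by simp_all
  have det: "detectable r N Q A" if "error_weight r N A < D" for A
    using md that unfolding has_min_distance_def by blast
  obtain E where "error_weight r N E = D" using md unfolding has_min_distance_def by blast
  then have DN: "D \<le> N" unfolding error_weight_def
    using card_mono[of "{..<N}" "{i. i < N \<and> \<not> (\<exists>c. \<forall>a<r. \<forall>b<r. E i a b = (if a = b then c else 0))}"] by auto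
  define KLM where "KLM = (\<lambda>A M. \<forall>a\<in>subwords r A. \<forall>a'\<in>subwords r A. (\<forall>\<phi>\<in>Q. \<forall>\<psi>\<in>Q.
        (\<Sum>y\<in>subwords r ({..<N} - A). cnj (\<phi> (glue A a y)) * \<psi> (glue A a' y)) = M a a' * qinner r N \<phi> \<psi>)
      \<and> (r ^ k = 1 \<longrightarrow> M a a' = (if a = a' then 1 / of_nat r ^ card A else 0)))"
  have KL: "\<exists>M. KLM A M"
    if A: "A \<subseteq> {..<N}" "card A < D" for A
  proof -
    have fA: "finite A" using A finite_subset by blast
    define P where "P = (\<lambda>a a' c. (\<forall>\<phi>\<in>Q. \<forall>\<psi>\<in>Q.
        (\<Sum>y\<in>subwords r ({..<N} - A). cnj (\<phi> (glue A a y)) * \<psi> (glue A a' y)) = c * qinner r N \<phi> \<psi>)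
        \<and> (r ^ k = 1 \<longrightarrow> c = (if a = a' then 1 / of_nat r ^ card A else 0)))"
    have "\<exists>c. P a a' c" if "a \<in> subwords r A" "a' \<in> subwords r A" for a a'
      using det[of "transition_error A a a'"] error_weight_transition_error[OF fA, of r N a a'] A Q(3) r
      unfolding detectable_def qinner_transition_error[OF A(1) that] P_def
      by (simp only: error_trace_transition_error[OF A(1) that])
    then obtain M where "\<And>a a'. a \<in> subwords r A \<Longrightarrow> a' \<in> subwords r A \<Longrightarrow> P a a' (M a a')" by metis
    note PM = this
    show ?thesis unfolding KLM_def by (intro exI[of _ M] ballI PM[unfolded P_def])
  qed
  have pos: "card A0 > 0" if A: "A \<subseteq> {..<N}" and A0: "A0 \<subseteq> subwords r A" "slice_spanning r N Q A A0" for A A0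
  proof (rule ccontr)
    assume "\<not> card A0 > 0"
    moreover have "finite A0"
      using A A0(1) finite_subwords finite_subset by (metis finite_lessThan)
    ultimately have e: "A0 = {}" by auto
    have "\<psi> = 0" if "\<psi> \<in> Q" for \<psi>
    proof
      fix w
      show "\<psi> w = 0 w"
      proof (cases "w \<in> words r N")
        case True
        have g: "glue A (restrict w A) (restrict w ({..<N} - A)) = w"
          using True A by (auto simp: glue_def fun_eq_iff words_def PiE_iff extensional_def)
        have rw: "restrict w A \<in> subwords r A" "restrict w ({..<N} - A) \<in> subwords r ({..<N} - A)"
          using True A by (auto simp: words_def)
        obtain x where "\<forall>\<psi>\<in>Q. \<forall>y\<in>subwords r ({..<N} - A).
            \<psi> (glue A (restrict w A) y) = (\<Sum>a0\<in>A0. x a0 * \<psi> (glue A a0 y))"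
          using A0(2)[unfolded slice_spanning_def, rule_format, OF rw(1)] ..
        from this[rule_format, OF that rw(2)] show ?thesis by (simp add: g e)
      qed (use that Q(2) in \<open>auto simp: qspace_def\<close>)
    qed
    then have "Q \<subseteq> qvec.span {}" by auto
    then have "qvec.dim Q \<le> card ({} :: qvec set)" by (intro qvec.dim_le_card) auto
    then show False using Q(3,4) by simp
  qed
  have KL_eq: "(\<Sum>y\<in>subwords r ({..<N} - A). cnj (\<phi> (glue A a y)) * \<psi> (glue A a' y)) = M a a' * qinner r N \<phi> \<psi>"
    if "KLM A M" "A0 \<subseteq> subwords r A" "\<phi> \<in> Q" "\<psi> \<in> Q" "a \<in> A0" "a' \<in> A0" for A A0 M \<phi> \<psi> a a'
    using that unfolding KLM_def by (simp add: subset_iff)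
  have rank: "r ^ k \<le> r ^ (N - card A - card B)"
    if AB: "A \<subseteq> {..<N}" "B \<subseteq> {..<N}" "A \<inter> B = {}" "card A < D" "card B < D" for A B
  proof -
    let ?c = "r ^ (N - card A - card B)"
    have fin: "finite A" "finite B" using finite_subset[OF AB(1)] finite_subset[OF AB(2)] by simp_all
    have BA: "B \<inter> A = {}" using AB(3) by (simp only: Int_commute)
    obtain A0 where A0: "A0 \<subseteq> subwords r A" "slice_independent r N Q A A0" "slice_spanning r N Q A A0"
      using ex_slice_basis[OF fin(1), of r N Q] by (elim exE conjE) (rule that)
    obtain B0 where B0: "B0 \<subseteq> subwords r B" "slice_independent r N Q B B0" "slice_spanning r N Q B B0"
      using ex_slice_basis[OF fin(2), of r N Q] by (elim exE conjE) (rule that)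
    obtain MA where MA: "KLM A MA" using KL[OF AB(1,4)] ..
    obtain MB where MB: "KLM B MB" using KL[OF AB(2,5)] ..
    have 1: "r ^ k * card A0 \<le> card B0 * ?c"
      by (rule slice_rank_bound[OF AB(1-3) A0(1,2) B0(1,3) Q(1,2) Q(3) Q(4)]) (rule KL_eq[OF MA A0(1)])
    have "r ^ k * card B0 \<le> card A0 * r ^ (N - card B - card A)"
      by (rule slice_rank_bound[OF AB(2,1) BA B0(1,2) A0(1,3) Q(1,2) Q(3) Q(4)]) (rule KL_eq[OF MB B0(1)])
    then have 2: "r ^ k * card B0 \<le> card A0 * ?c" by (simp only: diff_commute)
    show ?thesis
    proof (rule ccontr)
      assume "\<not> r ^ k \<le> ?c"
      then have lt: "?c < r ^ k" by simp
      note 1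
      also have "card B0 * ?c \<le> card B0 * r ^ k" using lt by simp
      finally have "r ^ k * card A0 \<le> r ^ k * card B0" by (simp only: mult.commute)
      then have le: "card A0 \<le> card B0" using Q(4) by (simp only: mult_le_cancel1)
      have "card A0 * ?c < card A0 * r ^ k" using lt pos[OF AB(1) A0(1,3)] by simp
      also have "\<dots> \<le> r ^ k * card B0" using le by simp
      finally show False using 2 by simp
    qed
  qed
  define t where "t = D - 1"
  have tD: "t < D" "D = Suc t" using D unfolding t_def by auto
  show ?thesis
  proof (cases "2 * t \<le> N")
    case True
    have "r ^ k \<le> r ^ (N - card {..<t} - card {t..<2 * t})" using True tD by (intro rank) auto
    then have "k \<le> N - t - t" using r by (simp add: power_le_imp_le_exp)
    then show ?thesis using tD True by simp
  next
    \<comment> \<open>Two disjoint sets of size \<open>t\<close> do not fit, so \<open>B\<close> is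
      the complement of \<open>A\<close>. This forces dimension one, where purity makes the reduced
      state on \<open>A\<close> maximally mixed, of rank \<open>r ^ t\<close>. The rank on
      \<open>B\<close> is at least as large but at most \<open>r ^ (N - t)\<close>, a
      contradiction.\<close>
    case False
    define A where "A = {..<t}"
    define B where "B = {t..<N}"
    have AB: "A \<subseteq> {..<N}" "B \<subseteq> {..<N}" "A \<inter> B = {}" "card A = t" "card B = N - t" "finite A" "finite B"
      and tN: "t < N" "N - t < t"
      using False DN tD unfolding A_def B_def by auto
    have fw: "finite (subwords r A)" "finite (subwords r B)" using AB finite_subwords by blast+
    have "r ^ k \<le> r ^ (N - card A - card B)" using AB tD tN by (intro rank) simp_all
    then have "r ^ k \<le> 1" by (simp add: AB(4,5))
    then have K1: "r ^ k = 1" using Q(4) by linarith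
    obtain B0 where B0: "B0 \<subseteq> subwords r B" "slice_independent r N Q B B0" "slice_spanning r N Q B B0"
      using ex_slice_basis[OF AB(7), of r N Q] by (elim exE conjE) (rule that)
    obtain MA where KA: "KLM A MA" using KL[OF AB(1)] AB(4) tD(1) by auto
    note MA = KL_eq[OF KA subset_refl]
    have pure: "MA a a' = (if a = a' then 1 / of_nat r ^ card A else 0)"
      if "r ^ k = 1" "a \<in> subwords r A" "a' \<in> subwords r A" for a a'
      using KA that unfolding KLM_def by simp
    have indA: "slice_independent r N Q A (subwords r A)"
      unfolding slice_independent_def
    proof (intro allI impI ballI)
      fix x a
      assume x: "\<forall>\<psi>\<in>Q. \<forall>y\<in>subwords r ({..<N} - A). (\<Sum>a\<in>subwords r A. x a * \<psi> (glue A a y)) = 0"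
        and a: "a \<in> subwords r A"
      obtain \<psi> where \<psi>: "\<psi> \<in> Q" "\<psi> \<noteq> 0"
      proof -
        have "\<not> Q \<subseteq> {0}"
        proof
          assume "Q \<subseteq> {0}"
          then have "Q \<subseteq> qvec.span {}" by auto
          then have "qvec.dim Q \<le> card ({} :: qvec set)" by (intro qvec.dim_le_card) auto
          then show False using Q(3,4) by simp
        qed
        then show ?thesis using that by blast
      qed
      have "0 = (\<Sum>y\<in>subwords r ({..<N} - A). cnj (\<psi> (glue A a y)) * (\<Sum>a'\<in>subwords r A. x a' * \<psi> (glue A a' y)))"
        using x \<psi> by simp
      also have "\<dots> = (\<Sum>a'\<in>subwords r A. x a' * (\<Sum>y\<in>subwords r ({..<N} - A). cnj (\<psi> (glue A a y)) * \<psi> (glue A a' y)))"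
        unfolding sum_distrib_left by (subst sum.swap) (simp add: mult_ac)
      also have "\<dots> = (\<Sum>a'\<in>subwords r A. if a' = a then x a * (1 / of_nat r ^ card A) * qinner r N \<psi> \<psi> else 0)"
        by (intro sum.cong refl) (auto simp: MA[OF \<psi>(1) \<psi>(1) a] pure[OF K1 a])
      also have "\<dots> = x a * (1 / of_nat r ^ card A) * qinner r N \<psi> \<psi>" using a fw by simp
      finally show "x a = 0" using r \<psi> Q(2) qinner_self_eq_0_iff[of \<psi> r N] by auto
    qed
    have "r ^ k * card (subwords r A) \<le> card B0 * r ^ (N - card A - card B)"
      by (rule slice_rank_bound[OF AB(1-3) subset_refl indA B0(1,3) Q(1,2) Q(3) Q(4)]) (rule MA)
    then have "r ^ t \<le> card B0" using K1 AB(6) by (simp add: card_PiE AB(4,5))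
    also have "\<dots> \<le> r ^ (N - t)" using card_mono[OF fw(2) B0(1)] AB by (simp add: card_PiE)
    finally have "t \<le> N - t" using r by (simp add: power_le_imp_le_exp)
    then show ?thesis using tN by simp
  qed
qed

section \<open>Finite fields as residue rings\<close>

text \<open>
  A finite field is represented by a ring type with a maximal ideal \<open>I\<close>, equality in the field
  being congruence modulo \<open>I\<close>: the order of the field is a term and cannot be read off a type.
\<close>

locale max_ideal =
  fixes I :: "'a::comm_ring_1 set"
  assumes zero_mem: "0 \<in> I" and add_mem: "a \<in> I \<Longrightarrow> b \<in> I \<Longrightarrow> a + b \<in> I"
    and mult_mem: "a \<in> I \<Longrightarrow> a * b \<in> I" and one_mem: "1 \<notin> I"
    and inverse_mem: "a \<notin> I \<Longrightarrow> \<exists>b. a * b - 1 \<in> I"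
begin

definition congr :: "'a \<Rightarrow> 'a \<Rightarrow> bool" (infix "\<simeq>" 50) where
  "a \<simeq> b \<longleftrightarrow> a - b \<in> I"

lemma uminus_mem: "a \<in> I \<Longrightarrow> - a \<in> I"
  using mult_mem[of a "-1"] by simp

lemma mem_iff: "a \<in> I \<longleftrightarrow> a \<simeq> 0"
  by (simp add: congr_def)

lemma congr_refl [simp, intro]: "a \<simeq> a"
  by (simp add: congr_def zero_mem)

lemma congr_sym: "a \<simeq> b \<Longrightarrow> b \<simeq> a"
  using uminus_mem[of "a - b"] by (simp add: congr_def)

lemma congr_trans [trans]: "a \<simeq> b \<Longrightarrow> b \<simeq> c \<Longrightarrow> a \<simeq> c"
  using add_mem[of "a - b" "b - c"] by (simp add: congr_def)

lemma congr_add: "a \<simeq> b \<Longrightarrow> c \<simeq> d \<Longrightarrow> a + c \<simeq> b + d"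
  using add_mem[of "a - b" "c - d"] by (simp add: congr_def algebra_simps)

lemma congr_minus: "a \<simeq> b \<Longrightarrow> - a \<simeq> - b"
  using uminus_mem[of "a - b"] by (simp add: congr_def)

lemma congr_diff: "a \<simeq> b \<Longrightarrow> c \<simeq> d \<Longrightarrow> a - c \<simeq> b - d"
  using congr_add[of a b "- c" "- d"] congr_minus[of c d] by simp

lemma congr_mult: "a \<simeq> b \<Longrightarrow> c \<simeq> d \<Longrightarrow> a * c \<simeq> b * d"
  using add_mem[of "(a - b) * c" "(c - d) * b"] mult_mem[of "a - b" c] mult_mem[of "c - d" b]
  by (simp add: congr_def algebra_simps)

lemma congr_power: "a \<simeq> b \<Longrightarrow> a ^ n \<simeq> b ^ n"
  by (induction n) (auto intro: congr_mult)

lemma congr_sum: "(\<And>x. x \<in> S \<Longrightarrow> f x \<simeq> h x) \<Longrightarrow> sum f S \<simeq> sum h S"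
  by (induction S rule: infinite_finite_induct) (auto intro: congr_add)

lemma congr_0_iff_diff: "a \<simeq> b \<longleftrightarrow> a - b \<simeq> 0"
  by (simp add: congr_def)

lemma sum_congr_0: "(\<And>x. x \<in> S \<Longrightarrow> f x \<simeq> 0) \<Longrightarrow> sum f S \<simeq> 0"
  using congr_sum[of S f "\<lambda>_. 0"] by simp

lemma one_not_congr_0 [simp]: "\<not> 1 \<simeq> 0"
  using one_mem by (simp add: congr_def)

lemma ex_inverse: "\<not> a \<simeq> 0 \<Longrightarrow> \<exists>b. a * b \<simeq> 1"
  using inverse_mem[of a] by (simp add: congr_def)

lemma mult_congr_0: "a \<simeq> 0 \<Longrightarrow> a * b \<simeq> 0" "b \<simeq> 0 \<Longrightarrow> a * b \<simeq> 0"
  using congr_mult[of a 0 b b] congr_mult[of a a b 0] by auto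

lemma mult_cancel:
  assumes "a * c \<simeq> b * c" "\<not> c \<simeq> 0"
  shows "a \<simeq> b"
proof -
  obtain d where d: "c * d \<simeq> 1" using ex_inverse[OF assms(2)] by auto
  have "a = a * 1" by simp
  also have "\<dots> \<simeq> a * (c * d)" using congr_sym[OF d] by (rule congr_mult[OF congr_refl])
  also have "\<dots> = (a * c) * d" by (simp add: mult_ac)
  also have "\<dots> \<simeq> (b * c) * d" by (rule congr_mult[OF assms(1) congr_refl])
  also have "\<dots> = b * (c * d)" by (simp add: mult_ac)
  also have "\<dots> \<simeq> b * 1" using d by (rule congr_mult[OF congr_refl])
  finally show ?thesis by simp
qed

lemma mult_congr_0_iff: "a * b \<simeq> 0 \<longleftrightarrow> a \<simeq> 0 \<or> b \<simeq> 0"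
  using mult_cancel[of a b 0] mult_congr_0 by auto

lemma power_congr_0_iff: "a ^ n \<simeq> 0 \<longleftrightarrow> a \<simeq> 0 \<and> n > 0"
  by (induction n) (auto simp: mult_congr_0_iff)

lemma prod_congr_0_iff: "finite S \<Longrightarrow> prod f S \<simeq> 0 \<longleftrightarrow> (\<exists>x\<in>S. f x \<simeq> 0)"
  by (induction S rule: finite_induct) (auto simp: mult_congr_0_iff)

text \<open>The bound on the number of roots over a field, transported to residue classes: the
  polynomial may be nonzero over the ring, so the conclusion concerns its coefficients, and the
  roots are pairwise incongruent.\<close>

lemma coeffs_congr_0_if_many_roots:
  assumes "finite S" "card S > degree f" "\<And>s. s \<in> S \<Longrightarrow> poly f s \<simeq> 0"
    and "\<And>s t. s \<in> S \<Longrightarrow> t \<in> S \<Longrightarrow> s \<simeq> t \<Longrightarrow> s = t"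
  shows "coeff f i \<simeq> 0"
  using assms
proof (induction "degree f" arbitrary: f S i)
  case 0
  then obtain s where s: "s \<in> S" by fastforce
  obtain c where c: "f = [:c:]" using 0 by (metis degree_eq_zeroE)
  have "c \<simeq> 0" using 0(4)[OF s] c by simp
  then show ?case using c by (cases i) auto
next
  case (Suc n)
  obtain s where s: "s \<in> S" using Suc.prems(2) by fastforce
  define h where "h = synthetic_div f s"
  have f: "f = [:-s, 1:] * h + [:poly f s:]" unfolding h_def by (rule synthetic_div_correct'[symmetric])
  have dh: "degree h = n" unfolding h_def degree_synthetic_div using Suc(2) by simp
  have hc: "coeff h j \<simeq> 0" for j
  proof (rule Suc(1)[of h "S - {s}"])
    show "n = degree h" using dh by simp
    show "finite (S - {s})" "degree h < card (S - {s})" using Suc s dh by auto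
    show "a = b" if "a \<in> S - {s}" "b \<in> S - {s}" "a \<simeq> b" for a b
      using Suc.prems(4)[of a b] that by auto
    fix t assume t: "t \<in> S - {s}"
    have "poly f t = (t - s) * poly h t + poly f s"
      by (subst f) (simp add: algebra_simps)
    moreover have "poly f t - poly f s \<simeq> 0 - 0"
      using t s Suc.prems(3) by (intro congr_diff) auto
    ultimately have "(t - s) * poly h t \<simeq> 0" by simp
    moreover have "\<not> t - s \<simeq> 0" using Suc.prems(4)[of t s] t s by (auto simp flip: congr_0_iff_diff)
    ultimately show "poly h t \<simeq> 0" by (simp add: mult_congr_0_iff)
  qed
  have "coeff f i = coeff ([:-s, 1:] * h) i + coeff [:poly f s:] i"
    by (metis f coeff_add)
  moreover have "coeff ([:-s, 1:] * h) i \<simeq> 0"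
  proof (cases i)
    case 0
    then have "coeff ([:-s, 1:] * h) i = (- s) * coeff h 0" by simp
    then show ?thesis using hc[of 0] by (simp only: mult_congr_0)
  next
    case (Suc j)
    then have "coeff ([:-s, 1:] * h) i = (- s) * coeff h (Suc j) + coeff h j" by simp
    moreover have "(- s) * coeff h (Suc j) + coeff h j \<simeq> 0 + 0"
      using hc by (intro congr_add mult_congr_0)
    ultimately show ?thesis by simp
  qed
  moreover have "coeff [:poly f s:] i \<simeq> 0"
    using Suc.prems(3)[OF s] by (cases i) auto
  ultimately show ?case using congr_add[of _ 0 _ 0] by simp
qed

end

section \<open>Existence of finite fields of prescribed order\<close>

lemma ex_max_ideal:
  fixes J :: "'a::comm_ring_1 set"
  assumes "0 \<in> J" "\<And>a b. a \<in> J \<Longrightarrow> b \<in> J \<Longrightarrow> a + b \<in> J" "\<And>a b. a \<in> J \<Longrightarrow> a * b \<in> J" "1 \<notin> J"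
  shows "\<exists>I. J \<subseteq> I \<and> max_ideal I"
proof -
  define \<A> where "\<A> = {K :: 'a set. J \<subseteq> K \<and> 0 \<in> K \<and> (\<forall>a\<in>K. \<forall>b\<in>K. a + b \<in> K) \<and> (\<forall>a\<in>K. \<forall>b. a * b \<in> K) \<and> 1 \<notin> K}"
  have "\<exists>M\<in>\<A>. \<forall>X\<in>\<A>. M \<subseteq> X \<longrightarrow> X = M"
  proof (rule subset_Zorn_nonempty)
    have "J \<in> \<A>" unfolding \<A>_def using assms by simp
    then show "\<A> \<noteq> {}" by blast
    fix \<C> assume C: "\<C> \<noteq> {}" "subset.chain \<A> \<C>"
    then have CA: "\<And>K. K \<in> \<C> \<Longrightarrow> K \<in> \<A>" and tot: "\<And>K L. K \<in> \<C> \<Longrightarrow> L \<in> \<C> \<Longrightarrow> K \<subseteq> L \<or> L \<subseteq> K"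
      by (auto simp: subset_chain_def)
    obtain K0 where K0: "K0 \<in> \<C>" using C by auto
    have "a + b \<in> \<Union>\<C>" if "a \<in> \<Union>\<C>" "b \<in> \<Union>\<C>" for a b
    proof -
      obtain K L where KL: "K \<in> \<C>" "L \<in> \<C>" "a \<in> K" "b \<in> L" using \<open>a \<in> \<Union>\<C>\<close> \<open>b \<in> \<Union>\<C>\<close> by auto
      then have "a \<in> K \<union> L" "b \<in> K \<union> L" "K \<union> L \<in> \<C>" using tot[OF KL(1,2)] by (auto simp: Un_absorb1 Un_absorb2)
      then show ?thesis using CA[of "K \<union> L"] unfolding \<A>_def by blast
    qed
    moreover have "a * b \<in> \<Union>\<C>" if "a \<in> \<Union>\<C>" for a b
      using that CA unfolding \<A>_def by blast
    moreover have "J \<subseteq> \<Union>\<C>" "0 \<in> \<Union>\<C>" using CA[OF K0] K0 unfolding \<A>_def by blast+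
    moreover have "1 \<notin> \<Union>\<C>" using CA unfolding \<A>_def by blast
    ultimately show "\<Union>\<C> \<in> \<A>" unfolding \<A>_def by simp
  qed
  then obtain I where I: "I \<in> \<A>" and mx: "\<And>X. X \<in> \<A> \<Longrightarrow> I \<subseteq> X \<Longrightarrow> X = I" by blast
  have I': "J \<subseteq> I" "0 \<in> I" "\<And>a b. a \<in> I \<Longrightarrow> b \<in> I \<Longrightarrow> a + b \<in> I" "\<And>a b. a \<in> I \<Longrightarrow> a * b \<in> I" "1 \<notin> I"
    using I unfolding \<A>_def by auto
  have "\<exists>b. a * b - 1 \<in> I" if a: "a \<notin> I" for a
  proof -
    define X where "X = {x + a * b | x b. x \<in> I}"
    have XI: "x + a * b \<in> X" if "x \<in> I" for x b using that unfolding X_def by blast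
    have IX: "I \<subseteq> X" using XI[of _ 0] by auto
    have "a \<in> X" using XI[OF I'(2), of 1] by simp
    then have "X \<noteq> I" using a by auto
    then have "X \<notin> \<A>" using mx IX by blast
    moreover have "u + v \<in> X" if "u \<in> X" "v \<in> X" for u v
    proof -
      obtain x b y c where "u = x + a * b" "v = y + a * c" "x \<in> I" "y \<in> I" using \<open>u \<in> X\<close> \<open>v \<in> X\<close> unfolding X_def by auto
      then have "u + v = (x + y) + a * (b + c)" by (simp add: algebra_simps)
      then show ?thesis using XI I'(3) \<open>x \<in> I\<close> \<open>y \<in> I\<close> by metis
    qed
    moreover have "u * v \<in> X" if "u \<in> X" for u v
    proof -
      obtain x b where "u = x + a * b" "x \<in> I" using \<open>u \<in> X\<close> unfolding X_def by auto
      then have "u * v = x * v + a * (b * v)" by (simp add: algebra_simps)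
      then show ?thesis using XI I'(4) \<open>x \<in> I\<close> by metis
    qed
    ultimately have "1 \<in> X" using IX I' unfolding \<A>_def by blast
    then obtain x b where x: "1 = x + a * b" "x \<in> I" unfolding X_def by auto
    then have "a * b - 1 = x * (-1)" by (simp add: algebra_simps)
    then show ?thesis using I'(4)[OF x(2)] by metis
  qed
  then have "max_ideal I" using I' by unfold_locales auto
  then show ?thesis using I' by blast
qed

context max_ideal
begin

lemma of_nat_congr_0_dvd:
  assumes "of_nat p \<simeq> 0" "p dvd n"
  shows "of_nat n \<simeq> 0"
  using assms mult_congr_0(1) by (auto elim!: dvdE)

lemma frobenius_prime:
  assumes "prime p" "of_nat p \<simeq> 0"
  shows "(a + b) ^ p \<simeq> a ^ p + b ^ p"
proof -
  have p: "p > 0" using assms(1) prime_gt_0_nat by blast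
  have "(a + b) ^ p = (\<Sum>k\<le>p. of_nat (p choose k) * a ^ k * b ^ (p - k))"
    by (rule binomial_ring)
  also have "\<dots> \<simeq> (\<Sum>k\<le>p. if k = 0 then b ^ p else if k = p then a ^ p else 0)"
  proof (rule congr_sum)
    fix k assume k: "k \<in> {..p}"
    show "of_nat (p choose k) * a ^ k * b ^ (p - k) \<simeq> (if k = 0 then b ^ p else if k = p then a ^ p else 0)"
    proof (cases "k = 0 \<or> k = p")
      case False
      then have "p dvd (p choose k)" using k p assms(1) by (intro dvd_choose_prime) auto
      then have "of_nat (p choose k) \<simeq> 0" by (rule of_nat_congr_0_dvd[OF assms(2)])
      then show ?thesis using False by (simp add: mult.assoc mult_congr_0)
    qed (use p in auto)
  qed
  also have "(\<Sum>k\<le>p. if k = 0 then b ^ p else if k = p then a ^ p else 0) = a ^ p + b ^ p"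
    using p by (subst sum.remove[of _ 0]) (auto simp: sum.delta' sum.If_cases add.commute
      intro!: arg_cong2[where f = "(+)"] sum.mono_neutral_cong_right[of _ "{p}" _ "\<lambda>_. a ^ p", simplified])
  finally show ?thesis .
qed

lemma frobenius:
  assumes "prime p" "of_nat p \<simeq> 0"
  shows "(a + b) ^ (p ^ k) \<simeq> a ^ (p ^ k) + b ^ (p ^ k)"
proof (induction k)
  case (Suc k)
  have "(a + b) ^ (p ^ Suc k) = ((a + b) ^ (p ^ k)) ^ p" by (simp add: mult.commute flip: power_mult)
  also have "\<dots> \<simeq> (a ^ (p ^ k) + b ^ (p ^ k)) ^ p" by (rule congr_power[OF Suc.IH])
  also have "\<dots> \<simeq> (a ^ (p ^ k)) ^ p + (b ^ (p ^ k)) ^ p" by (rule frobenius_prime[OF assms])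
  also have "\<dots> = a ^ (p ^ Suc k) + b ^ (p ^ Suc k)" by (simp add: mult.commute flip: power_mult)
  finally show ?case .
qed auto

end

text \<open>\<open>r\<close> is the order of the field and \<open>g\<close> a generator of its unit
  group. Fixing \<open>g\<close> turns power equations into congruences between exponents modulo
  \<open>r - 1\<close>.\<close>

locale finite_residue_field = max_ideal I for I :: "'a::comm_ring_1 set" +
  fixes p r :: nat and g :: 'a
  assumes prime_p: "prime p" and char_p: "of_nat p \<simeq> 0" and r_ge: "r \<ge> 2"
    and g_pow: "g ^ (r - 1) \<simeq> 1"
    and g_gen: "\<not> a \<simeq> 0 \<Longrightarrow> \<exists>i<r - 1. a \<simeq> g ^ i"
    and g_inj: "i < r - 1 \<Longrightarrow> j < r - 1 \<Longrightarrow> g ^ i \<simeq> g ^ j \<Longrightarrow> i = j"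

text \<open>
  The quotient of \<open>x ^ d - 1\<close> by the least common multiple of all \<open>x ^ e - 1\<close> is the cyclotomic
  polynomial. Modulo a prime \<open>p\<close> not dividing \<open>d\<close>, its roots have order exactly \<open>d\<close>.
\<close>

lemma ex_cyclotomic_factor:
  fixes x :: "int poly"
  defines "x \<equiv> [:0, 1:]"
  assumes d: "d > 0"
  shows "\<exists>\<Phi>. degree \<Phi> > 0 \<and> lead_coeff \<Phi> dvd 1 \<and> \<Phi> dvd x ^ d - 1 \<and>
    (\<forall>e. e dvd d \<longrightarrow> e < d \<longrightarrow> \<Phi> * (x ^ e - 1) dvd x ^ d - 1)"
proof -
  define S where "S = {e. e dvd d \<and> e < d}"
  define P where "P = Lcm ((\<lambda>e. x ^ e - 1) ` S)"
  have finS: "finite S" unfolding S_def by auto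
  have xd: "x ^ e - 1 dvd x ^ d - 1" if ed: "e dvd d" for e
  proof -
    obtain k where k: "d = e * k" using ed by (elim dvdE)
    have "x ^ d - 1 = (x ^ e - 1) * (\<Sum>i<k. (x ^ e) ^ i)"
      unfolding k power_mult by (rule power_diff_1_eq)
    then show ?thesis by simp
  qed
  have "P dvd x ^ d - 1" unfolding P_def S_def using xd by (intro Lcm_least) auto
  then obtain \<Phi> where \<Phi>: "x ^ d - 1 = P * \<Phi>" by blast
  have deg: "degree (x ^ d - 1) = d" and lc: "lead_coeff (x ^ d - 1) = 1"
  proof -
    have "x ^ d = monom 1 d" unfolding x_def by (simp add: monom_altdef)
    then have "degree (x ^ d + (- 1)) = d"
      using d by (simp only: degree_add_eq_left[of "- 1 :: int poly" "monom 1 d"] degree_monom_eq degree_minus degree_1)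
    then show 1: "degree (x ^ d - 1) = d" by simp
    have "coeff (x ^ d - 1) d = 1" unfolding \<open>x ^ d = monom 1 d\<close> using d by simp
    then show "lead_coeff (x ^ d - 1) = 1" by (simp only: 1)
  qed
  have nz: "P \<noteq> 0" "\<Phi> \<noteq> 0" using \<Phi> deg d by auto
  have lcm1: "lead_coeff P * lead_coeff \<Phi> = 1" using lc unfolding \<Phi> by (simp add: lead_coeff_mult)
  have "degree \<Phi> > 0"
  proof (rule ccontr)
    assume "\<not> degree \<Phi> > 0"
    then have "\<Phi> = [:lead_coeff \<Phi>:]" by (metis degree_0_id neq0_conv)
    then obtain c where c: "\<Phi> = [:c:]" "c dvd 1" using lcm1 by (metis dvd_triv_right)
    then have "\<Phi> dvd 1" by (simp add: is_unit_const_poly_iff)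
    then obtain c' where "\<Phi> * c' = 1" by (metis dvdE)
    then have "P = (x ^ d - 1) * c'" unfolding \<Phi> by (simp add: mult.assoc)
    then have "x ^ d - 1 dvd P" by simp
    also have "P dvd (\<Prod>e\<in>S. x ^ e - 1)"
      unfolding P_def using finS by (intro Lcm_least) (auto intro: dvd_prod_eqI)
    finally obtain h where h: "(\<Prod>e\<in>S. x ^ e - 1) = (x ^ d - 1) * h" by blast
    \<comment> \<open>A constant \<open>\<Phi>\<close> would make \<open>x ^ d - 1\<close> divide
      the product of the polynomials \<open>x ^ e - 1\<close> with \<open>e < d\<close>. Evaluation
      at a primitive complex \<open>d\<close>-th root of unity refutes this.\<close>
    define ev :: "int poly \<Rightarrow> complex" where "ev = (\<lambda>f. poly (map_poly of_int f) (cis (2 * pi * real 1 / real d)))"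
    have ev_mult: "ev (a * b) = ev a * ev b" for a b
    proof -
      have "map_poly of_int (a * b) = (map_poly of_int a * map_poly of_int b :: complex poly)"
        by (rule poly_eqI) (simp add: coeff_map_poly coeff_mult)
      then show ?thesis unfolding ev_def by simp
    qed
    have ev_diff: "ev (a - b) = ev a - ev b" for a b
    proof -
      have "map_poly of_int (a - b) = (map_poly of_int a - map_poly of_int b :: complex poly)"
        by (rule poly_eqI) (simp add: coeff_map_poly)
      then show ?thesis unfolding ev_def by simp
    qed
    have ev1: "ev 1 = 1" unfolding ev_def by (simp add: map_poly_1)
    have evx: "ev x = cis (2 * pi * real 1 / real d)" unfolding ev_def x_def by (simp add: map_poly_pCons)
    have ev_pow: "ev (x ^ e) = cis (2 * pi * real e / real d)" for e
    proof -
      have "ev (x ^ e) = ev x ^ e" by (induction e) (auto simp: ev_mult ev1)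
      then show ?thesis unfolding evx DeMoivre by (simp add: mult_ac)
    qed
    have "ev (x ^ d - 1) = 0" using d by (simp add: ev_diff ev1 ev_pow)
    then have "ev (\<Prod>e\<in>S. x ^ e - 1) = 0" unfolding h ev_mult by simp
    moreover have "ev (\<Prod>e\<in>S. x ^ e - 1) = (\<Prod>e\<in>S. ev (x ^ e - 1))"
      using finS by (induction S rule: finite_induct) (auto simp: ev_mult ev1)
    ultimately obtain e where e: "e \<in> S" "ev (x ^ e - 1) = 0" using finS by (auto simp: prod_zero_iff)
    then have "cis (2 * pi * real e / real d) = cis (2 * pi * real 0 / real d)"
      by (simp add: ev_diff ev1 ev_pow)
    moreover have "inj_on (\<lambda>k. cis (2 * pi * real k / real d)) {..<d}"
      using bij_betw_roots_unity[OF d] by (simp add: bij_betw_def)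
    moreover have "e \<in> {..<d}" "0 \<in> {..<d}" using e(1) d unfolding S_def by auto
    ultimately have "e = 0" using inj_onD[of "\<lambda>k. cis (2 * pi * real k / real d)"] by blast
    then show False using e(1) d unfolding S_def by simp
  qed
  moreover have "\<Phi> * (x ^ e - 1) dvd x ^ d - 1" if "e dvd d" "e < d" for e
  proof -
    have "x ^ e - 1 dvd P" unfolding P_def using that by (intro dvd_Lcm) (auto simp: S_def)
    then show ?thesis unfolding \<Phi> mult.commute[of P] by (rule mult_dvd_mono[OF dvd_refl])
  qed
  moreover have "lead_coeff \<Phi> dvd 1" using lcm1 by (metis dvd_triv_right)
  moreover have "\<Phi> dvd x ^ d - 1" unfolding \<Phi> by simp
  ultimately show ?thesis by blast
qed

text \<open>Modulo \<open>p\<close> the polynomial \<open>\<Phi>\<close> keeps its positive degree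
  because its leading coefficient is a unit, so no multiple of it becomes 1.\<close>

lemma one_not_in_ideal:
  fixes \<Phi> :: "int poly"
  assumes "degree \<Phi> > 0" "lead_coeff \<Phi> dvd 1" "prime p"
  shows "1 \<noteq> of_nat p * a + \<Phi> * h"
proof
  assume eq: "1 = of_nat p * a + \<Phi> * h"
  have p: "\<not> int p dvd 1" using assms(3) by (simp add: prime_nat_iff)
  have ca: "int p dvd coeff (of_nat p * a) i" for i
    by (simp add: of_nat_poly)
  have "\<exists>j. \<not> int p dvd coeff h j"
  proof (rule ccontr)
    assume "\<nexists>j. \<not> int p dvd coeff h j"
    then have "int p dvd coeff (\<Phi> * h) 0" by (simp add: coeff_mult)
    then have "int p dvd coeff (of_nat p * a + \<Phi> * h) 0"
      using ca[of 0] unfolding coeff_add by (rule dvd_add[rotated])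
    then show False unfolding eq[symmetric] using p by simp
  qed
  moreover have "\<forall>j. \<not> int p dvd coeff h j \<longrightarrow> j < Suc (degree h)"
    using coeff_eq_0 by (metis dvd_0_right less_Suc_eq_le not_le)
  ultimately have "\<exists>j. \<not> int p dvd coeff h j \<and> (\<forall>i. \<not> int p dvd coeff h i \<longrightarrow> i \<le> j)"
    using Lattices_Big.ex_has_greatest_nat[of "\<lambda>j. \<not> int p dvd coeff h j" _ "\<lambda>j. j" "Suc (degree h)"] by blast
  \<comment> \<open>\<open>j\<close> is the degree of \<open>h\<close> modulo \<open>p\<close>. In
    degree \<open>degree \<Phi> + j\<close> the product has, modulo \<open>p\<close>, only the
    product of the leading coefficients.\<close>
  then obtain j where j: "\<not> int p dvd coeff h j" "\<And>i. i > j \<Longrightarrow> int p dvd coeff h i" by (metis not_le)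
  let ?D = "degree \<Phi>"
  have "coeff (\<Phi> * h) (?D + j) = (\<Sum>i\<le>?D + j. coeff \<Phi> i * coeff h (?D + j - i))" by (rule coeff_mult)
  also have "\<dots> = coeff \<Phi> ?D * coeff h j + (\<Sum>i\<in>{..?D + j} - {?D}. coeff \<Phi> i * coeff h (?D + j - i))"
    by (subst sum.remove[of _ ?D]) auto
  finally have c: "coeff (\<Phi> * h) (?D + j) = \<dots>" .
  have "int p dvd (\<Sum>i\<in>{..?D + j} - {?D}. coeff \<Phi> i * coeff h (?D + j - i))"
  proof (rule dvd_sum)
    fix i assume i: "i \<in> {..?D + j} - {?D}"
    show "int p dvd coeff \<Phi> i * coeff h (?D + j - i)"
    proof (cases "i < ?D")
      case True
      then show ?thesis using j(2)[of "?D + j - i"] by simp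
    next
      case False
      then show ?thesis using i by (simp add: coeff_eq_0)
    qed
  qed
  moreover have "coeff (of_nat p * a + \<Phi> * h) (?D + j) = 0"
    unfolding eq[symmetric] using assms(1) by simp
  then have "int p dvd coeff (\<Phi> * h) (?D + j)"
    using ca[of "?D + j"] unfolding coeff_add by (metis dvd_0_right dvd_add_right_iff)
  ultimately have "int p dvd coeff \<Phi> ?D * coeff h j"
    unfolding c by (simp add: dvd_add_left_iff)
  then have "int p dvd coeff h j"
    using assms(2) by (metis dvd_mult_unit_iff' mult.commute dvd_trans dvd_mult_cancel_left mult_unit_dvd_iff')
  then show False using j by simp
qed


locale max_ideal_int_poly = max_ideal I for I :: "int poly set"

text \<open>The class of \<open>x\<close> has order exactly \<open>d\<close>, so its powers give
  \<open>d\<close> different units. They exhaust the units: the iterated Frobenius map fixes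
  \<open>x\<close> and the integers, hence every class, and units are roots of
  \<open>X ^ d - 1\<close>.\<close>

lemma (in max_ideal_int_poly) finite_residue_field_cyclotomic:
  fixes x \<Phi> :: "int poly" and p k :: nat
  defines "x \<equiv> [:0, 1:]" and "d \<equiv> p ^ k - 1"
  assumes p: "prime p" and k: "k > 0" and char: "of_nat p \<simeq> 0"
    and \<Phi>: "\<Phi> dvd x ^ d - 1" "\<And>e. e dvd d \<Longrightarrow> e < d \<Longrightarrow> \<Phi> * (x ^ e - 1) dvd x ^ d - 1"
    and \<Phi>0: "\<And>f. \<Phi> dvd f \<Longrightarrow> f \<simeq> 0"
  shows "finite_residue_field I p (p ^ k) x"
proof -
  define r where "r = p ^ k"
  have p2: "p \<ge> 2" using p by (rule prime_ge_2_nat)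
  have r2: "r \<ge> 2" unfolding r_def using p2 k self_le_power[of p k] by linarith
  have d_def: "d = r - 1" unfolding r_def d_def ..
  have d0: "d > 0" and rd: "r = Suc d" using r2 unfolding d_def by auto
  have x_def: "x = [:0, 1:]" unfolding x_def ..
  have xd: "x ^ d \<simeq> 1" using \<Phi>0[OF \<Phi>(1)] congr_0_iff_diff by blast
  have coprime_p: "\<not> of_nat n \<simeq> 0" if n: "coprime n p" "n > 0" for n
  proof
    assume n0: "of_nat n \<simeq> 0"
    obtain u v where "n * u = p * v + gcd n p" using bezout_nat[of n p] n by auto
    then have "n * u = p * v + 1" using n by simp
    then have "(of_nat n * of_nat u :: int poly) = of_nat p * of_nat v + 1"
      by (metis of_nat_1 of_nat_add of_nat_mult)
    then have "1 = of_nat n * of_nat u - of_nat p * (of_nat v :: int poly)" by simp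
    also have "\<dots> \<simeq> 0 - 0" using n0 char by (intro congr_diff mult_congr_0)
    finally show False by simp
  qed
  have order: "\<not> x ^ j \<simeq> 1" if j: "0 < j" "j < d" for j
  proof
    assume xj: "x ^ j \<simeq> 1"
    define e where "e = gcd j d"
    have e: "e dvd d" "e < d" "e > 0" using j d0 le_less_trans[OF gcd_le1_nat[of j d]] unfolding e_def by auto
    obtain u v where "j * u = d * v + e" using bezout_nat[of j d] j unfolding e_def by auto
    then have "x ^ (j * u) = x ^ (d * v) * x ^ e" by (simp add: power_add)
    then have h: "(x ^ j) ^ u = (x ^ d) ^ v * x ^ e" by (simp add: power_mult)
    have "x ^ e = 1 ^ v * x ^ e" by simp
    also have "\<dots> \<simeq> (x ^ d) ^ v * x ^ e" by (intro congr_mult congr_power congr_refl congr_sym[OF xd])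
    also have "\<dots> = (x ^ j) ^ u" using h by simp
    also have "\<dots> \<simeq> 1 ^ u" by (intro congr_power xj)
    finally have xe: "x ^ e \<simeq> 1" by simp
    obtain m where m: "d = e * m" using e(1) by (elim dvdE)
    have "x ^ d - 1 = (x ^ e - 1) * (\<Sum>i<m. (x ^ e) ^ i)"
      unfolding m power_mult by (rule power_diff_1_eq)
    then have "\<Phi> * (x ^ e - 1) dvd (\<Sum>i<m. (x ^ e) ^ i) * (x ^ e - 1)"
      using \<Phi>(2)[OF e(1,2)] by (simp add: mult.commute)
    moreover have "x ^ e - 1 \<noteq> 0"
    proof
      assume "x ^ e - 1 = 0"
      then have "degree (x ^ e) = 0" by simp
      then show False using e(3) unfolding x_def by (simp add: degree_power_eq)
    qed
    \<comment> \<open>If \<open>x ^ e\<close> is 1 in the field, the quotient of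
      \<open>x ^ d - 1\<close> by \<open>x ^ e - 1\<close> takes the value
      \<open>m = d div e\<close>. It is also divisible by \<open>\<Phi>\<close>, hence 0. But
      \<open>m\<close> divides \<open>p ^ k - 1\<close> and is prime to \<open>p\<close>.\<close>
    ultimately have "\<Phi> dvd (\<Sum>i<m. (x ^ e) ^ i)" by simp
    then have s0: "(\<Sum>i<m. (x ^ e) ^ i) \<simeq> 0" by (rule \<Phi>0)
    have s1: "(\<Sum>i<m. (x ^ e) ^ i) \<simeq> (\<Sum>i<m. 1 ^ i)"
      by (intro congr_sum congr_power xe)
    have "of_nat m \<simeq> 0" using congr_trans[OF congr_sym[OF s1] s0] by simp
    moreover have "coprime m p"
    proof -
      have "coprime d (p ^ k)" unfolding r_def[symmetric] rd by simp
      then have "coprime d p" using k by (simp add: coprime_power_right_iff)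
      then show ?thesis unfolding m by (simp add: coprime_mult_left_iff)
    qed
    ultimately show False using coprime_p[of m] m d0 by auto
  qed
  have inj: "i = j" if "i < d" "j < d" "x ^ i \<simeq> x ^ j" for i j
  proof -
    have *: "i \<ge> j" if "i < d" "j < d" "x ^ i \<simeq> x ^ j" for i j
    proof (rule ccontr)
      assume "\<not> i \<ge> j"
      then have "x ^ j = x ^ (j - i) * x ^ i" by (simp flip: power_add)
      then have "x ^ (j - i) * x ^ i \<simeq> 1 * x ^ i" using congr_sym[OF that(3)] by simp
      moreover have "\<not> x ^ i \<simeq> 0"
      proof
        assume "x ^ i \<simeq> 0"
        then have "x ^ i * x ^ (d - i) \<simeq> 0" by (rule mult_congr_0)
        then have "x ^ d \<simeq> 0" using that(1) by (simp flip: power_add)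
        then have "1 \<simeq> 0" using congr_trans[OF congr_sym[OF xd]] by blast
        then show False by simp
      qed
      ultimately have "x ^ (j - i) \<simeq> 1" by (rule mult_cancel)
      then show False using order[of "j - i"] \<open>\<not> i \<ge> j\<close> that by auto
    qed
    show ?thesis using *[OF that] *[OF that(2,1) congr_sym[OF that(3)]] by simp
  qed
  note frob = frobenius[OF p char, of _ _ k, folded r_def]
  have x_r: "x ^ r \<simeq> x"
    using congr_mult[OF congr_refl[of x] xd] unfolding rd by simp
  have nat_r: "of_nat n ^ r \<simeq> of_nat n" for n
  proof (induction n)
    case (Suc n)
    have "of_nat (Suc n) ^ r = (1 + of_nat n) ^ r" by simp
    also have "\<dots> \<simeq> 1 ^ r + of_nat n ^ r" by (rule frob)
    also have "\<dots> \<simeq> 1 + of_nat n" by (intro congr_add Suc) simp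
    finally show ?case by simp
  qed (use r2 in \<open>simp add: power_0_left\<close>)
  have int_r: "[:c:] ^ r \<simeq> [:c:]" for c :: int
  proof -
    define n where "n = nat (c mod int p)"
    have "int n = c mod int p" unfolding n_def using p2 by simp
    then have "int p dvd c - int n" by (simp only: dvd_minus_mod)
    then obtain e where e: "c - int n = int p * e" by (elim dvdE)
    have "[:c:] - of_nat n = of_nat p * [:e:]" by (simp add: of_nat_poly e)
    then have cn: "[:c:] \<simeq> of_nat n"
      using mult_congr_0(1)[OF char, of "[:e:]"] congr_0_iff_diff[of "[:c:]" "of_nat n"] by simp
    have "[:c:] ^ r \<simeq> of_nat n ^ r" by (rule congr_power[OF cn])
    also have "\<dots> \<simeq> of_nat n" by (rule nat_r)
    also have "\<dots> \<simeq> [:c:]" by (rule congr_sym[OF cn])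
    finally show ?thesis .
  qed
  have all_r: "a ^ r \<simeq> a" for a :: "int poly"
  proof (induction a)
    case (pCons c f)
    have eq: "pCons c f = [:c:] + x * f" unfolding x_def by simp
    have "(pCons c f) ^ r \<simeq> [:c:] ^ r + (x * f) ^ r" unfolding eq by (rule frob)
    also have "\<dots> = [:c:] ^ r + x ^ r * f ^ r" by (simp add: power_mult_distrib)
    also have "\<dots> \<simeq> [:c:] + x * f" by (intro congr_add congr_mult int_r x_r pCons)
    finally show ?case unfolding eq .
  qed (use r2 in \<open>simp add: power_0_left\<close>)
  have gen: "\<exists>i<d. a \<simeq> x ^ i" if a: "\<not> a \<simeq> 0" for a
  proof (rule ccontr)
    assume no: "\<not> (\<exists>i<d. a \<simeq> x ^ i)"
    define f :: "int poly poly" where "f = monom 1 d - 1"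
    have pf: "poly f s = s ^ d - 1" for s unfolding f_def by (simp add: poly_monom)
    have df: "degree f \<le> d" unfolding f_def
      by (rule degree_diff_le) (auto simp: degree_monom_le)
    have a1: "a ^ d \<simeq> 1"
    proof (rule mult_cancel[OF _ a])
      show "a ^ d * a \<simeq> 1 * a" using all_r[of a] unfolding rd by (simp add: mult.commute)
    qed
    have injx: "inj_on (\<lambda>i. x ^ i) {..<d}" by (rule inj_onI) (auto intro!: inj)
    have an: "a \<notin> (\<lambda>i. x ^ i) ` {..<d}" using no by auto
    \<comment> \<open>Together with the powers of \<open>x\<close>, a further unit \<open>a\<close>
      would give \<open>d + 1\<close> roots of \<open>X ^ d - 1\<close>, whose leading coefficient 1
      is not in \<open>I\<close>.\<close>
    have "coeff f d \<simeq> 0"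
    proof (rule coeffs_congr_0_if_many_roots)
      show "finite (insert a ((\<lambda>i. x ^ i) ` {..<d}))" by simp
      show "degree f < card (insert a ((\<lambda>i. x ^ i) ` {..<d}))"
        using df an by (simp add: card_image[OF injx])
    next
      fix s assume "s \<in> insert a ((\<lambda>i. x ^ i) ` {..<d})"
      then consider "s = a" | i where "s = x ^ i" by auto
      then have "s ^ d \<simeq> 1"
      proof cases
        case 2
        have "s ^ d = (x ^ d) ^ i" unfolding 2 by (simp add: mult.commute flip: power_mult)
        also have "\<dots> \<simeq> 1 ^ i" by (rule congr_power[OF xd])
        finally show ?thesis by simp
      qed (use a1 in simp)
      then show "poly f s \<simeq> 0" unfolding pf by (simp flip: congr_0_iff_diff)
    next
      fix s t assume st: "s \<in> insert a ((\<lambda>i. x ^ i) ` {..<d})" "t \<in> insert a ((\<lambda>i. x ^ i) ` {..<d})" "s \<simeq> t"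
      then consider "s = a" "t = a" | j where "s = a" "t = x ^ j" "j < d" | i where "s = x ^ i" "i < d" "t = a"
        | i j where "s = x ^ i" "t = x ^ j" "i < d" "j < d" by blast
      then show "s = t"
      proof cases
        case 2
        then show ?thesis using no st(3) by blast
      next
        case 3
        then show ?thesis using no congr_sym[OF st(3)] by blast
      next
        case 4
        then show ?thesis using inj st(3) by blast
      qed simp
    qed
    moreover have "coeff f d = 1" unfolding f_def using d0 by simp
    ultimately show False by simp
  qed
  show "finite_residue_field I p (p ^ k) x"
    unfolding r_def[symmetric]
    by unfold_locales (use p char r2 xd gen inj in \<open>simp_all add: d_def\<close>)
qed

theorem ex_finite_residue_field:
  assumes p: "prime p" and k: "k > 0"
  shows "\<exists>(I :: int poly set) g. finite_residue_field I p (p ^ k) g"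
proof -
  define r where "r = p ^ k"
  define d where "d = r - 1"
  have p2: "p \<ge> 2" using p by (rule prime_ge_2_nat)
  have r2: "r \<ge> 2" unfolding r_def using p2 k self_le_power[of p k] by linarith
  have d0: "d > 0" and rd: "r = Suc d" using r2 unfolding d_def by auto
  define x :: "int poly" where "x = [:0, 1:]"
  obtain \<Phi> where \<Phi>: "degree \<Phi> > 0" "lead_coeff \<Phi> dvd 1" "\<Phi> dvd x ^ d - 1"
    "\<And>e. e dvd d \<Longrightarrow> e < d \<Longrightarrow> \<Phi> * (x ^ e - 1) dvd x ^ d - 1"
    using ex_cyclotomic_factor[OF d0] unfolding x_def by auto
  define J where "J = {of_nat p * a + \<Phi> * h | a h. True}"
  have J: "of_nat p * a + \<Phi> * h \<in> J" for a h unfolding J_def by blast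
  have "\<exists>I. J \<subseteq> I \<and> max_ideal I"
  proof (rule ex_max_ideal)
    show "0 \<in> J" using J[of 0 0] by simp
    show "1 \<notin> J" using one_not_in_ideal[OF \<Phi>(1,2) p] unfolding J_def by auto
  next
    fix a b assume "a \<in> J" "b \<in> J"
    then obtain a1 h1 a2 h2 where "a = of_nat p * a1 + \<Phi> * h1" "b = of_nat p * a2 + \<Phi> * h2"
      unfolding J_def by auto
    then have "a + b = of_nat p * (a1 + a2) + \<Phi> * (h1 + h2)" by (simp add: algebra_simps)
    then show "a + b \<in> J" using J by metis
  next
    fix a b assume "a \<in> J"
    then obtain a1 h1 where "a = of_nat p * a1 + \<Phi> * h1" unfolding J_def by auto
    then have "a * b = of_nat p * (a1 * b) + \<Phi> * (h1 * b)" by (simp add: algebra_simps)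
    then show "a * b \<in> J" using J by metis
  qed
  then obtain I where I: "J \<subseteq> I" "max_ideal I" by blast
  interpret max_ideal_int_poly I using I(2) by (simp add: max_ideal_int_poly_def)
  have "of_nat p \<in> I" using J[of 1 0] I(1) by auto
  then have char: "congr (of_nat p) 0" by (simp add: congr_def)
  have \<Phi>0: "congr f 0" if fd: "\<Phi> dvd f" for f
  proof -
    obtain h where "f = \<Phi> * h" using fd by (elim dvdE)
    then have "f \<in> I" using J[of 0 h] I(1) by auto
    then show ?thesis by (simp add: congr_def)
  qed
  have "finite_residue_field I p (p ^ k) x"
    unfolding x_def
    by (rule finite_residue_field_cyclotomic[OF p k char, of \<Phi>])
      (use \<Phi>(3,4) \<Phi>0 in \<open>simp_all add: x_def d_def r_def\<close>)
  then show ?thesis by blast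
qed

section \<open>Power sums and roots of unity in finite fields\<close>

lemma card_le_fibres:
  assumes "finite A" "f ` A \<subseteq> B" "finite B" "\<And>b. b \<in> B \<Longrightarrow> card {a\<in>A. f a = b} \<le> k"
  shows "card A \<le> k * card B"
proof -
  have "card A = (\<Sum>a\<in>A. 1)" by simp
  also have "\<dots> = (\<Sum>b\<in>B. \<Sum>a\<in>{a\<in>A. f a = b}. 1)"
    by (rule sum.group[symmetric]) (use assms in auto)
  also have "\<dots> = (\<Sum>b\<in>B. card {a\<in>A. f a = b})" by simp
  also have "\<dots> \<le> (\<Sum>b\<in>B. k)" by (rule sum_mono) (rule assms(4))
  finally show ?thesis by (simp add: mult.commute)
qed

context finite_residue_field
begin

text \<open>A fixed system of representatives. Cardinalities and sums over the field are taken over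
  \<open>R\<close>, and \<open>rep\<close> brings results of ring operations back into it.\<close>

definition R :: "'a set" where
  "R = insert 0 ((\<lambda>i. g ^ i) ` {..<r - 1})"

definition rep :: "'a \<Rightarrow> 'a" where
  "rep a = (SOME x. x \<in> R \<and> a \<simeq> x)"

lemma g_not_0: "\<not> g ^ i \<simeq> 0"
proof
  assume "g ^ i \<simeq> 0"
  then have "g \<simeq> 0" by (simp add: power_congr_0_iff)
  then have "g ^ (r - 1) \<simeq> 0" using r_ge by (simp add: power_congr_0_iff)
  then show False using congr_trans[OF congr_sym[OF g_pow]] one_not_congr_0 by blast
qed

lemma finite_R [simp]: "finite R"
  by (simp add: R_def)

lemma card_R: "card R = r"
proof -
  have "inj_on (\<lambda>i. g ^ i) {..<r - 1}"
  proof (rule inj_onI)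
    fix i j assume "i \<in> {..<r - 1}" "j \<in> {..<r - 1}" "g ^ i = g ^ j"
    then show "i = j" using g_inj[of i j] by simp
  qed
  moreover have "0 \<notin> (\<lambda>i. g ^ i) ` {..<r - 1}"
  proof
    assume "0 \<in> (\<lambda>i. g ^ i) ` {..<r - 1}"
    then obtain i where "0 = g ^ i" by auto
    then show False using g_not_0[of i] by simp
  qed
  ultimately show ?thesis using r_ge by (simp add: R_def card_image)
qed

lemma R_inj: "x \<in> R \<Longrightarrow> y \<in> R \<Longrightarrow> x \<simeq> y \<Longrightarrow> x = y"
proof -
  assume x: "x \<in> R" and y: "y \<in> R" and xy: "x \<simeq> y"
  show "x = y"
  proof (cases "x = 0 \<or> y = 0")
    case True
    then show ?thesis using x y xy congr_sym[OF xy] g_not_0 by (auto simp: R_def)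
  next
    case False
    then obtain i j where "x = g ^ i" "y = g ^ j" "i < r - 1" "j < r - 1" using x y by (auto simp: R_def)
    then show ?thesis using g_inj[of i j] xy by simp
  qed
qed

lemma ex_R: "\<exists>x. x \<in> R \<and> a \<simeq> x"
proof (cases "a \<simeq> 0")
  case True
  then show ?thesis by (intro exI[of _ 0]) (simp add: R_def)
next
  case False
  then obtain i where "i < r - 1" "a \<simeq> g ^ i" using g_gen by blast
  then show ?thesis by (intro exI[of _ "g ^ i"]) (simp add: R_def)
qed

lemma rep_R [simp]: "rep a \<in> R" and congr_rep: "a \<simeq> rep a"
  using someI_ex[OF ex_R[of a]] by (simp_all add: rep_def)

lemma rep_congr: "rep a \<simeq> a"
  by (rule congr_sym[OF congr_rep])

lemma rep_eqI: "x \<in> R \<Longrightarrow> a \<simeq> x \<Longrightarrow> rep a = x"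
  using R_inj[of "rep a" x] congr_trans[OF rep_congr] by simp

lemma rep_eq_iff: "rep a = rep b \<longleftrightarrow> a \<simeq> b"
proof
  assume "rep a = rep b"
  then show "a \<simeq> b" using congr_rep[of a] rep_congr[of b] congr_trans by metis
next
  assume "a \<simeq> b"
  then show "rep a = rep b" using rep_eqI[OF rep_R] congr_trans[OF _ congr_rep] by simp
qed

lemma zero_R: "0 \<in> R" by (simp add: R_def)

lemma g_power_mod: "g ^ i \<simeq> g ^ (i mod (r - 1))"
proof -
  have "g ^ i = g ^ ((r - 1) * (i div (r - 1)) + i mod (r - 1))" by simp
  also have "\<dots> = (g ^ (r - 1)) ^ (i div (r - 1)) * g ^ (i mod (r - 1))"
    by (simp only: power_add power_mult)
  also have "\<dots> \<simeq> 1 ^ (i div (r - 1)) * g ^ (i mod (r - 1))"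
    by (intro congr_mult congr_power g_pow congr_refl)
  finally show ?thesis by simp
qed

lemma g_power_eq_iff: "g ^ i \<simeq> g ^ j \<longleftrightarrow> i mod (r - 1) = j mod (r - 1)"
proof
  assume ij: "g ^ i \<simeq> g ^ j"
  have "g ^ (i mod (r - 1)) \<simeq> g ^ i" by (rule congr_sym[OF g_power_mod])
  also note ij
  also have "g ^ j \<simeq> g ^ (j mod (r - 1))" by (rule g_power_mod)
  finally show "i mod (r - 1) = j mod (r - 1)" using r_ge by (intro g_inj) auto
next
  assume "i mod (r - 1) = j mod (r - 1)"
  then show "g ^ i \<simeq> g ^ j" using congr_trans[OF g_power_mod[of i] congr_sym] g_power_mod[of j] by simp
qed

lemma g_power_eq_1_iff: "g ^ i \<simeq> 1 \<longleftrightarrow> (r - 1) dvd i"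
  using g_power_eq_iff[of i 0] by (simp add: mod_eq_0_iff_dvd)

lemma ex_g_power: "\<not> a \<simeq> 0 \<Longrightarrow> \<exists>i. a \<simeq> g ^ i"
  using g_gen by blast

text \<open>With \<open>t = g ^ s\<close> the condition on \<open>t\<close> forces
  \<open>M dvd s\<close>. The solutions are the powers of \<open>g\<close> whose exponents lie in
  one residue class modulo \<open>(r - 1) div M\<close>.\<close>

lemma card_roots:
  assumes M: "M dvd r - 1" and t: "t ^ ((r - 1) div M) \<simeq> 1"
  shows "card {z\<in>R. z ^ M \<simeq> t} = M"
proof -
  obtain c where c: "r - 1 = M * c" using M by (elim dvdE)
  have pos: "M > 0" "c > 0" using c r_ge by (auto intro!: Nat.gr0I)
  have t0: "\<not> t \<simeq> 0"
  proof
    assume "t \<simeq> 0"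
    then have "t ^ c \<simeq> 0" using pos by (simp add: power_congr_0_iff)
    moreover have "t ^ c \<simeq> 1" using t pos unfolding c by simp
    ultimately show False using congr_trans[OF congr_sym] one_not_congr_0 by blast
  qed
  obtain s where s: "t \<simeq> g ^ s" using ex_g_power[OF t0] by blast
  have "g ^ (s * c) \<simeq> 1"
    using congr_trans[OF congr_power[OF congr_sym[OF s]] t] pos unfolding c by (simp add: power_mult)
  then have "M * c dvd s * c" using c by (simp add: g_power_eq_1_iff)
  then have "M dvd s" using pos by simp
  then obtain s' where s': "s = M * s'" by (elim dvdE)
  define s0 where "s0 = s' mod c"
  have iff: "(g ^ i) ^ M \<simeq> t \<longleftrightarrow> i mod c = s0" for i
  proof -
    have "(g ^ i) ^ M \<simeq> t \<longleftrightarrow> g ^ (M * i) \<simeq> g ^ (M * s')"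
    proof
      assume "(g ^ i) ^ M \<simeq> t"
      then have "(g ^ i) ^ M \<simeq> g ^ s" using s by (rule congr_trans)
      then show "g ^ (M * i) \<simeq> g ^ (M * s')" unfolding s' by (simp add: mult.commute flip: power_mult)
    next
      assume "g ^ (M * i) \<simeq> g ^ (M * s')"
      then have "(g ^ i) ^ M \<simeq> g ^ s" unfolding s' by (simp add: mult.commute flip: power_mult)
      then show "(g ^ i) ^ M \<simeq> t" using congr_sym[OF s] by (rule congr_trans)
    qed
    also have "\<dots> \<longleftrightarrow> M * (i mod c) = M * (s' mod c)"
      unfolding g_power_eq_iff c mult_mod_right ..
    finally show ?thesis using pos by (simp add: s0_def)
  qed
  have "{z\<in>R. z ^ M \<simeq> t} = (\<lambda>j. g ^ (s0 + c * j)) ` {..<M}"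
  proof (intro equalityI subsetI)
    fix z assume z: "z \<in> {z\<in>R. z ^ M \<simeq> t}"
    then have "z \<noteq> 0" using t0 pos congr_sym by (auto simp: power_0_left)
    then obtain i where i: "z = g ^ i" "i < M * c" using z c by (auto simp: R_def)
    then have "i mod c = s0" using z iff by simp
    then have "i = s0 + c * (i div c)" by (metis mod_mult_div_eq)
    moreover have "i div c < M" using i(2) by (simp add: less_mult_imp_div_less)
    ultimately show "z \<in> (\<lambda>j. g ^ (s0 + c * j)) ` {..<M}" using i(1) by (metis imageI lessThan_iff)
  next
    fix z assume "z \<in> (\<lambda>j. g ^ (s0 + c * j)) ` {..<M}"
    then obtain j where j: "z = g ^ (s0 + c * j)" "j < M" by auto
    have "s0 < c" unfolding s0_def using pos by simp
    have "c * Suc j \<le> c * M" using j(2) by (intro mult_le_mono2) simp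
    then have "s0 + c * j < M * c" using \<open>s0 < c\<close> by (simp add: mult.commute)
    then have "z \<in> R" using c j by (auto simp: R_def)
    moreover have "(s0 + c * j) mod c = s0" using \<open>s0 < c\<close> by simp
    ultimately show "z \<in> {z\<in>R. z ^ M \<simeq> t}" using iff j(1) by simp
  qed
  moreover have "inj_on (\<lambda>j. g ^ (s0 + c * j)) {..<M}"
  proof (rule inj_onI)
    fix i j assume ij: "i \<in> {..<M}" "j \<in> {..<M}" "g ^ (s0 + c * i) = g ^ (s0 + c * j)"
    have b: "s0 + c * k < M * c" if "k < M" for k
    proof -
      have "c * Suc k \<le> c * M" using that by (intro mult_le_mono2) simp
      moreover have "s0 < c" unfolding s0_def using pos by simp
      ultimately show ?thesis by (simp add: mult.commute)
    qed
    have "s0 + c * i = s0 + c * j" using ij b c by (intro g_inj) auto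
    then show "i = j" using pos by simp
  qed
  ultimately show ?thesis by (simp add: card_image)
qed

lemma power_r: "a ^ r \<simeq> a"
proof (cases "a \<simeq> 0")
  case True
  then have "a ^ r \<simeq> 0" using r_ge by (simp add: power_congr_0_iff)
  then show ?thesis using congr_trans[OF _ congr_sym[OF True]] by blast
next
  case False
  then obtain i where i: "a \<simeq> g ^ i" using ex_g_power by blast
  have "r = Suc (r - 1)" using r_ge by simp
  then have "a ^ r = a * a ^ (r - 1)" by (metis power_Suc)
  also have "\<dots> \<simeq> a * (g ^ i) ^ (r - 1)" by (intro congr_mult congr_power i congr_refl)
  also have "(g ^ i) ^ (r - 1) = (g ^ (r - 1)) ^ i" by (simp add: mult.commute flip: power_mult)
  also have "a * \<dots> \<simeq> a * 1 ^ i" by (intro congr_mult congr_power g_pow congr_refl)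
  finally show ?thesis by simp
qed

text \<open>The assumptions say that \<open>X ^ s + \<kappa> * X\<close> splits, its nonzero roots
  being the roots of \<open>X ^ (s - 1) = - \<kappa>\<close>. The values 1 and -1 of
  \<open>\<kappa>\<close> belong to the two equations of the curve; -1 also yields the
  subfields.\<close>

lemma card_linear_kernel:
  assumes s: "s \<ge> 2" "s - 1 dvd r - 1" and \<kappa>: "(- \<kappa>) ^ ((r - 1) div (s - 1)) \<simeq> 1"
  shows "card {b\<in>R. b ^ s + \<kappa> * b \<simeq> 0} = s"
proof -
  have "{b\<in>R. b ^ s + \<kappa> * b \<simeq> 0} = insert 0 {b\<in>R. b ^ (s - 1) \<simeq> - \<kappa>}"
  proof -
    have "b ^ s + \<kappa> * b \<simeq> 0 \<longleftrightarrow> b = 0 \<or> b ^ (s - 1) \<simeq> - \<kappa>" if b: "b \<in> R" for b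
    proof -
      have "b ^ s = b * b ^ (s - 1)" using s by (metis One_nat_def Suc_pred' less_le_trans pos2 power_Suc)
      then have "b ^ s + \<kappa> * b = b * (b ^ (s - 1) - (- \<kappa>))" by (simp add: algebra_simps)
      moreover have "b \<simeq> 0 \<longleftrightarrow> b = 0" using R_inj[OF b zero_R] by auto
      ultimately show ?thesis by (simp only: mult_congr_0_iff congr_0_iff_diff[symmetric])
    qed
    then show ?thesis using zero_R by auto
  qed
  moreover have "0 \<notin> {b\<in>R. b ^ (s - 1) \<simeq> - \<kappa>}"
  proof
    assume "0 \<in> {b\<in>R. b ^ (s - 1) \<simeq> - \<kappa>}"
    then have "0 \<simeq> - \<kappa>" using s by (simp add: power_0_left)
    then have "- \<kappa> \<simeq> 0" by (rule congr_sym)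
    moreover have "(r - 1) div (s - 1) > 0"
      using s r_ge by (simp add: div_greater_zero_iff dvd_imp_le)
    ultimately have "(- \<kappa>) ^ ((r - 1) div (s - 1)) \<simeq> 0" by (simp add: power_congr_0_iff)
    then show False using congr_trans[OF congr_sym[OF \<kappa>]] one_not_congr_0 by blast
  qed
  ultimately show ?thesis using card_roots[OF s(2) \<kappa>] s(1) by simp
qed

lemma card_subfield:
  assumes s: "s \<ge> 2" "s - 1 dvd r - 1"
  shows "card {b\<in>R. b ^ s \<simeq> b} = s"
proof -
  have "card {b\<in>R. b ^ s + (- 1) * b \<simeq> 0} = s"
    by (rule card_linear_kernel[OF s]) simp
  moreover have "b ^ s + (- 1) * b \<simeq> 0 \<longleftrightarrow> b ^ s \<simeq> b" for b
    by (simp flip: congr_0_iff_diff)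
  ultimately show ?thesis by simp
qed

lemma sum_R_reindex:
  assumes bij: "bij_betw (\<lambda>x. rep (h x)) A B" and f: "\<And>x. x \<in> A \<Longrightarrow> f (rep (h x)) \<simeq> f (h x)"
  shows "sum f B \<simeq> (\<Sum>x\<in>A. f (h x))"
proof -
  have "sum f B = (\<Sum>x\<in>A. f (rep (h x)))" using sum.reindex_bij_betw[OF bij, of f] by simp
  also have "\<dots> \<simeq> (\<Sum>x\<in>A. f (h x))" by (rule congr_sum) (rule f)
  finally show ?thesis .
qed

lemma frobenius_power: "(a + b) ^ (p ^ k) \<simeq> a ^ (p ^ k) + b ^ (p ^ k)"
  by (rule frobenius[OF prime_p char_p])

lemma uminus_power_p: "(- a) ^ (p ^ k) \<simeq> - (a ^ (p ^ k))"
proof -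
  have "p > 0" using prime_p prime_gt_0_nat by simp
  then have "a ^ (p ^ k) + (- a) ^ (p ^ k) \<simeq> 0"
    using congr_sym[OF frobenius_power[of a "- a" k]] \<open>p > 0\<close> by (simp add: power_0_left)
  then have "(- a) ^ (p ^ k) - (- (a ^ (p ^ k))) \<simeq> 0" by (simp add: add.commute)
  then show ?thesis by (simp only: congr_0_iff_diff[symmetric])
qed

section \<open>Power sums over the solutions of additive equations\<close>

context
  fixes s j :: nat and \<kappa> :: 'a
  assumes s_def: "s = p ^ j" and s: "s \<ge> 2" "s - 1 dvd r - 1"
    and ker: "card {b\<in>R. b ^ s + \<kappa> * b \<simeq> 0} = s"
begin

lemma linear_add: "(a + b) ^ s + \<kappa> * (a + b) \<simeq> (a ^ s + \<kappa> * a) + (b ^ s + \<kappa> * b)"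
proof -
  have "(a + b) ^ s + \<kappa> * (a + b) \<simeq> (a ^ s + b ^ s) + \<kappa> * (a + b)"
    unfolding s_def by (intro congr_add frobenius_power congr_refl)
  also have "\<dots> = (a ^ s + \<kappa> * a) + (b ^ s + \<kappa> * b)" by (simp add: algebra_simps)
  finally show ?thesis .
qed

lemma linear_congr: "a \<simeq> b \<Longrightarrow> a ^ s + \<kappa> * a \<simeq> b ^ s + \<kappa> * b"
  by (intro congr_add congr_mult congr_power congr_refl)

text \<open>The kernel is stable under an element \<open>\<epsilon>\<close> of order
  \<open>s - 1\<close>, which multiplies the power sum by \<open>\<epsilon> ^ k\<close>, and this is
  not 1 for \<open>0 < k < s - 1\<close>. For \<open>k = 0\<close> the sum is \<open>s\<close>, a
  multiple of \<open>p\<close>.\<close>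

lemma power_sum_kernel:
  assumes k: "k < s - 1"
  shows "(\<Sum>b\<in>{b\<in>R. b ^ s + \<kappa> * b \<simeq> 0}. b ^ k) \<simeq> 0"
proof (cases "k = 0")
  case True
  have "p dvd s" unfolding s_def using s s_def by (cases j) auto
  then have "of_nat s \<simeq> 0" by (rule of_nat_congr_0_dvd[OF char_p])
  then show ?thesis using True ker by simp
next
  case False
  let ?B = "{b\<in>R. b ^ s + \<kappa> * b \<simeq> 0}"
  define c where "c = (r - 1) div (s - 1)"
  have c: "r - 1 = (s - 1) * c" unfolding c_def using s by simp
  have cpos: "c > 0" using c r_ge by (auto intro!: Nat.gr0I)
  define \<epsilon> where "\<epsilon> = g ^ c"
  have \<epsilon>s: "\<epsilon> ^ (s - 1) \<simeq> 1"
  proof -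
    have "\<epsilon> ^ (s - 1) = g ^ (r - 1)" unfolding \<epsilon>_def c by (simp add: mult.commute flip: power_mult)
    then show ?thesis using g_pow by simp
  qed
  have \<epsilon>k: "\<not> \<epsilon> ^ k \<simeq> 1"
  proof
    assume "\<epsilon> ^ k \<simeq> 1"
    then have "(s - 1) * c dvd k * c" unfolding \<epsilon>_def c[symmetric] g_power_eq_1_iff[symmetric]
      by (simp add: mult.commute flip: power_mult)
    then have "s - 1 dvd k" using cpos by simp
    then show False using False k by (auto dest: dvd_imp_le)
  qed
  have \<epsilon>0: "\<not> \<epsilon> \<simeq> 0" unfolding \<epsilon>_def by (rule g_not_0)
  have \<epsilon>s': "\<epsilon> ^ s \<simeq> \<epsilon>"
  proof -
    have "\<epsilon> ^ s = \<epsilon> * \<epsilon> ^ (s - 1)" using s by (metis One_nat_def Suc_pred' less_le_trans pos2 power_Suc)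
    also have "\<dots> \<simeq> \<epsilon> * 1" by (intro congr_mult \<epsilon>s congr_refl)
    finally show ?thesis by simp
  qed
  have B\<epsilon>: "rep (\<epsilon> * b) \<in> ?B" if "b \<in> ?B" for b
  proof -
    have "rep (\<epsilon> * b) ^ s + \<kappa> * rep (\<epsilon> * b) \<simeq> (\<epsilon> * b) ^ s + \<kappa> * (\<epsilon> * b)"
      by (rule linear_congr[OF rep_congr])
    also have "\<dots> = \<epsilon> ^ s * b ^ s + \<kappa> * (\<epsilon> * b)" by (simp add: power_mult_distrib)
    also have "\<dots> \<simeq> \<epsilon> * b ^ s + \<kappa> * (\<epsilon> * b)" by (intro congr_add congr_mult \<epsilon>s' congr_refl)
    also have "\<dots> = \<epsilon> * (b ^ s + \<kappa> * b)" by (simp add: algebra_simps)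
    also have "\<dots> \<simeq> 0" using that by (intro mult_congr_0) simp
    finally show ?thesis by simp
  qed
  have inj: "inj_on (\<lambda>b. rep (\<epsilon> * b)) ?B"
  proof (rule inj_onI)
    fix a b assume ab: "a \<in> ?B" "b \<in> ?B" "rep (\<epsilon> * a) = rep (\<epsilon> * b)"
    then have "a * \<epsilon> \<simeq> b * \<epsilon>" by (simp add: rep_eq_iff mult.commute)
    then show "a = b" using mult_cancel[OF _ \<epsilon>0] R_inj ab by blast
  qed
  have bij: "bij_betw (\<lambda>b. rep (\<epsilon> * b)) ?B ?B"
    unfolding bij_betw_def using inj endo_inj_surj[OF _ image_subsetI[OF B\<epsilon>] inj] by simp
  have "(\<Sum>b\<in>?B. b ^ k) \<simeq> (\<Sum>b\<in>?B. (\<epsilon> * b) ^ k)"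
    by (rule sum_R_reindex[OF bij]) (rule congr_power[OF rep_congr])
  also have "\<dots> = \<epsilon> ^ k * (\<Sum>b\<in>?B. b ^ k)" by (simp add: power_mult_distrib sum_distrib_left)
  finally have "(\<epsilon> ^ k - 1) * (\<Sum>b\<in>?B. b ^ k) \<simeq> 0"
    using congr_sym congr_0_iff_diff by (simp add: algebra_simps)
  moreover have "\<not> \<epsilon> ^ k - 1 \<simeq> 0" using \<epsilon>k by (simp flip: congr_0_iff_diff)
  ultimately show ?thesis by (simp add: mult_congr_0_iff)
qed

lemma bij_solutions:
  assumes x0: "x0 ^ s + \<kappa> * x0 \<simeq> c"
  shows "bij_betw (\<lambda>b. rep (x0 + b)) {b\<in>R. b ^ s + \<kappa> * b \<simeq> 0} {x\<in>R. x ^ s + \<kappa> * x \<simeq> c}"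
  unfolding bij_betw_def
proof (intro conjI equalityI subsetI)
  show "inj_on (\<lambda>b. rep (x0 + b)) {b\<in>R. b ^ s + \<kappa> * b \<simeq> 0}"
  proof (rule inj_onI)
    fix a b assume ab: "a \<in> {b\<in>R. b ^ s + \<kappa> * b \<simeq> 0}" "b \<in> {b\<in>R. b ^ s + \<kappa> * b \<simeq> 0}" "rep (x0 + a) = rep (x0 + b)"
    then have "x0 + a \<simeq> x0 + b" by (simp add: rep_eq_iff)
    then have "a \<simeq> b" by (simp add: congr_def)
    then show "a = b" using R_inj ab by blast
  qed
next
  fix x assume "x \<in> (\<lambda>b. rep (x0 + b)) ` {b\<in>R. b ^ s + \<kappa> * b \<simeq> 0}"
  then obtain b where b: "b ^ s + \<kappa> * b \<simeq> 0" "x = rep (x0 + b)" by auto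
  have "x ^ s + \<kappa> * x \<simeq> (x0 + b) ^ s + \<kappa> * (x0 + b)" unfolding b(2) by (rule linear_congr[OF rep_congr])
  also have "\<dots> \<simeq> (x0 ^ s + \<kappa> * x0) + (b ^ s + \<kappa> * b)" by (rule linear_add)
  also have "\<dots> \<simeq> c + 0" by (intro congr_add x0 b(1))
  finally show "x \<in> {x\<in>R. x ^ s + \<kappa> * x \<simeq> c}" using b(2) by simp
next
  fix x assume x: "x \<in> {x\<in>R. x ^ s + \<kappa> * x \<simeq> c}"
  define b where "b = rep (x - x0)"
  have "x ^ s + \<kappa> * x \<simeq> (x0 + b) ^ s + \<kappa> * (x0 + b)"
  proof (rule linear_congr)
    have "x = x0 + (x - x0)" by simp
    also have "\<dots> \<simeq> x0 + b" unfolding b_def by (intro congr_add congr_rep congr_refl)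
    finally show "x \<simeq> x0 + b" .
  qed
  also have "\<dots> \<simeq> (x0 ^ s + \<kappa> * x0) + (b ^ s + \<kappa> * b)" by (rule linear_add)
  also have "\<dots> \<simeq> c + (b ^ s + \<kappa> * b)" by (intro congr_add x0 congr_refl)
  finally have "c \<simeq> c + (b ^ s + \<kappa> * b)" using x congr_trans[OF congr_sym] by blast
  then have "- (b ^ s + \<kappa> * b) \<simeq> 0" by (simp add: congr_def)
  then have "b ^ s + \<kappa> * b \<simeq> 0" using congr_minus[of "- (b ^ s + \<kappa> * b)" 0] by (simp only: minus_minus minus_zero)
  moreover have "x = rep (x0 + b)"
  proof (rule rep_eqI[symmetric])
    show "x \<in> R" using x by simp
    have "x0 + b \<simeq> x0 + (x - x0)" unfolding b_def by (intro congr_add rep_congr congr_refl)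
    then show "x0 + b \<simeq> x" by simp
  qed
  ultimately show "x \<in> (\<lambda>b. rep (x0 + b)) ` {b\<in>R. b ^ s + \<kappa> * b \<simeq> 0}" unfolding b_def by auto
qed

lemma card_solutions:
  assumes x0: "x0 ^ s + \<kappa> * x0 \<simeq> c"
  shows "card {x\<in>R. x ^ s + \<kappa> * x \<simeq> c} = s"
  using bij_betw_same_card[OF bij_solutions[OF x0]] ker by simp

text \<open>The solutions form a coset of the kernel. In the binomial expansion only the power
  \<open>s - 1\<close> survives; it occurs only for \<open>i = s - 1\<close>, with coefficient 1.
  Hence the value is the same for every solvable right-hand side \<open>c\<close>.\<close>

lemma power_sum_solutions:
  assumes x0: "x0 ^ s + \<kappa> * x0 \<simeq> c" and i: "i \<le> s - 1"
  shows "(\<Sum>x\<in>{x\<in>R. x ^ s + \<kappa> * x \<simeq> c}. x ^ i) \<simeq>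
    (if i = s - 1 then (\<Sum>b\<in>{b\<in>R. b ^ s + \<kappa> * b \<simeq> 0}. b ^ (s - 1)) else 0)"
proof -
  let ?B = "{b\<in>R. b ^ s + \<kappa> * b \<simeq> 0}"
  have "(\<Sum>x\<in>{x\<in>R. x ^ s + \<kappa> * x \<simeq> c}. x ^ i) \<simeq> (\<Sum>b\<in>?B. (x0 + b) ^ i)"
    by (rule sum_R_reindex[OF bij_solutions[OF x0]]) (rule congr_power[OF rep_congr])
  also have "\<dots> = (\<Sum>b\<in>?B. \<Sum>k\<le>i. of_nat (i choose k) * b ^ k * x0 ^ (i - k))"
    by (simp only: add.commute[of x0] binomial_ring)
  also have "\<dots> = (\<Sum>k\<le>i. (of_nat (i choose k) * x0 ^ (i - k)) * (\<Sum>b\<in>?B. b ^ k))"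
    by (subst sum.swap) (simp add: sum_distrib_left mult_ac)
  also have "\<dots> \<simeq> (\<Sum>k\<le>i. if k = s - 1 then (\<Sum>b\<in>?B. b ^ (s - 1)) else 0)"
  proof (rule congr_sum)
    fix k assume k: "k \<in> {..i}"
    show "(of_nat (i choose k) * x0 ^ (i - k)) * (\<Sum>b\<in>?B. b ^ k) \<simeq> (if k = s - 1 then (\<Sum>b\<in>?B. b ^ (s - 1)) else 0)"
    proof (cases "k = s - 1")
      case True
      then have "i = k" using k i by simp
      then show ?thesis using True by simp
    next
      case False
      then have "(\<Sum>b\<in>?B. b ^ k) \<simeq> 0" using k i by (intro power_sum_kernel) auto
      then show ?thesis using False by (simp add: mult_congr_0(2))
    qed
  qed
  also have "(\<Sum>k\<le>i. if k = s - 1 then (\<Sum>b\<in>?B. b ^ (s - 1)) else 0) = (if i = s - 1 then (\<Sum>b\<in>?B. b ^ (s - 1)) else 0)"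
    using i by (simp add: sum.delta)
  finally show ?thesis .
qed

end

end

section \<open>Rational points of the curve\<close>

lemma diff_one_dvd_power_diff_one: "(a::nat) - 1 dvd a ^ k - 1"
proof (cases "a = 0")
  case False
  show ?thesis
  proof (induction k)
    case (Suc k)
    have "a ^ k \<ge> 1" using False by simp
    then have "a ^ Suc k - 1 = a * (a ^ k - 1) + (a - 1)" using False by (simp add: diff_mult_distrib2)
    then show ?case using Suc.IH by simp
  qed simp
qed (cases k; simp)

text \<open>Congruence modulo \<open>I\<close> gives the field of order \<open>q ^ (2 * n)\<close>.
  For odd \<open>n\<close> the number \<open>q + 1\<close> divides \<open>q ^ n + 1\<close>, and the
  subfields of orders \<open>q ^ n\<close> and \<open>q ^ 2\<close> meet in the field of order
  \<open>q\<close>.\<close>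

locale ggs_field = finite_residue_field I p r g for I :: "'a::comm_ring_1 set" and p r g +
  fixes q e n m :: nat
  assumes q: "q = p ^ e" "e > 0" and r: "r = q ^ (2 * n)" and n: "odd n" and m: "m * (q + 1) = q ^ n + 1"
begin

lemma q_ge: "q \<ge> 2"
  using prime_ge_2_nat[OF prime_p] self_le_power[of p e] q by linarith

lemma n_pos: "n > 0"
  using n by (auto intro: Nat.gr0I)

lemma power_q_add: "(a + b) ^ (q ^ j) \<simeq> a ^ (q ^ j) + b ^ (q ^ j)"
  unfolding q(1) power_mult[symmetric] by (rule frobenius_power)

lemma power_q_uminus: "(- a) ^ (q ^ j) \<simeq> - (a ^ (q ^ j))"
  unfolding q(1) power_mult[symmetric] by (rule uminus_power_p)

lemma power_q_diff: "(a - b) ^ (q ^ j) \<simeq> a ^ (q ^ j) - b ^ (q ^ j)"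
proof -
  have "(a + (- b)) ^ (q ^ j) \<simeq> a ^ (q ^ j) + (- b) ^ (q ^ j)" by (rule power_q_add)
  also have "\<dots> \<simeq> a ^ (q ^ j) + - (b ^ (q ^ j))" by (intro congr_add power_q_uminus congr_refl)
  finally show ?thesis by simp
qed

lemma r_eq: "r = (q ^ n)\<^sup>2" "r = (q\<^sup>2) ^ n"
  unfolding r by (simp_all add: mult.commute flip: power_mult)

lemma dvd_r_minus_1: "q - 1 dvd r - 1" "q\<^sup>2 - 1 dvd r - 1" "q ^ n - 1 dvd r - 1"
  using diff_one_dvd_power_diff_one[of q "2 * n"] diff_one_dvd_power_diff_one[of "q\<^sup>2" n]
    diff_one_dvd_power_diff_one[of "q ^ n" 2] r_eq r by simp_all

lemma q2_minus_1: "q\<^sup>2 - 1 = (q - 1) * (q + 1)"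
  using q_ge by (simp add: power2_eq_square algebra_simps)

lemma r_minus_1: "r - 1 = (q ^ n - 1) * (q ^ n + 1)"
  unfolding r_eq(1) by (simp add: power2_eq_square algebra_simps)

lemma fixed_power_iterate: "a ^ s \<simeq> a \<Longrightarrow> a ^ (s ^ j) \<simeq> a"
proof (induction j)
  case (Suc j)
  have "a ^ (s ^ Suc j) = (a ^ s) ^ (s ^ j)" by (simp flip: power_mult)
  also have "\<dots> \<simeq> a ^ (s ^ j)" by (rule congr_power[OF Suc.prems])
  also have "\<dots> \<simeq> a" using Suc by simp
  finally show ?case .
qed simp

lemma fixed_power_q:
  assumes "a ^ (q ^ n) \<simeq> a" "a ^ (q\<^sup>2) \<simeq> a"
  shows "a ^ q \<simeq> a"
proof -
  obtain j where j: "n = 2 * j + 1" using n by (elim oddE)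
  have "a ^ q \<simeq> (a ^ ((q\<^sup>2) ^ j)) ^ q"
    by (rule congr_power[OF congr_sym[OF fixed_power_iterate[OF assms(2)]]])
  also have "\<dots> = a ^ (q ^ n)" unfolding j by (simp add: power_add mult.commute flip: power_mult)
  also note assms(1)
  finally show ?thesis .
qed

lemma fixed_inverse:
  assumes "a ^ s \<simeq> a" "a * b \<simeq> 1"
  shows "b ^ s \<simeq> b"
proof (rule mult_cancel)
  show "\<not> a \<simeq> 0"
  proof
    assume "a \<simeq> 0"
    then have "a * b \<simeq> 0" by (rule mult_congr_0)
    then show False using congr_trans[OF congr_sym[OF assms(2)]] one_not_congr_0 by blast
  qed
  have "b ^ s * a \<simeq> b ^ s * a ^ s" by (intro congr_mult congr_refl congr_sym[OF assms(1)])
  also have "\<dots> = (a * b) ^ s" by (simp add: power_mult_distrib mult.commute)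
  also have "\<dots> \<simeq> 1 ^ s" by (rule congr_power[OF assms(2)])
  also have "1 ^ s = (1 :: 'a)" by simp
  also have "\<dots> \<simeq> b * a" using congr_sym[OF assms(2)] by (simp add: mult.commute)
  finally show "b ^ s * a \<simeq> b * a" .
qed

lemma not_congr_0_if_inverse: "a * b \<simeq> 1 \<Longrightarrow> \<not> a \<simeq> 0"
proof
  assume "a * b \<simeq> 1" "a \<simeq> 0"
  then have "1 \<simeq> 0" using congr_trans[OF congr_sym mult_congr_0(1)] by blast
  then show False by simp
qed

text \<open>In characteristic 2 the element -1 equals 1. Otherwise
  \<open>(r - 1) div (q - 1)\<close> is even, as a multiple of \<open>q + 1\<close>.\<close>

lemma card_kernel_x: "card {b\<in>R. b ^ q + 1 * b \<simeq> 0} = q"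
proof (rule card_linear_kernel)
  show "q \<ge> 2" by (rule q_ge)
  show "q - 1 dvd r - 1" by (rule dvd_r_minus_1)
  show "(- 1) ^ ((r - 1) div (q - 1)) \<simeq> 1"
  proof (cases "even q")
    case True
    then have "even p" using q by simp
    then have "p = 2" using prime_p primes_dvd_imp_eq two_is_prime_nat by blast
    then have "- (1 - (- 1)) \<simeq> - 0" using char_p by (intro congr_minus) simp
    then have "(- 1) \<simeq> 1" by (simp add: congr_def)
    from congr_power[OF this, of "(r - 1) div (q - 1)"] show ?thesis by simp
  next
    case False
    obtain c where c: "r - 1 = (q\<^sup>2 - 1) * c" using dvd_r_minus_1(2) by (elim dvdE)
    have "(r - 1) div (q - 1) = (q + 1) * c"
      unfolding c q2_minus_1 mult.assoc using q_ge by (intro nonzero_mult_div_cancel_left) simp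
    then have "even ((r - 1) div (q - 1))" using False by simp
    then show ?thesis by (simp add: minus_one_power_iff)
  qed
qed

lemma q2_ge: "q\<^sup>2 \<ge> 2"
  using q_ge self_le_power[of q 2] by linarith

lemma card_kernel_y: "card {b\<in>R. b ^ (q\<^sup>2) + (- 1) * b \<simeq> 0} = q\<^sup>2"
  by (rule card_linear_kernel[OF q2_ge dvd_r_minus_1(2)]) simp

text \<open>Telescoping: the \<open>q\<close>-th power of each summand cancels the next summand, and
  the two ends remain.\<close>

lemma alternating_frobenius_sum:
  "(\<Sum>i<k. (- 1) ^ i * w ^ (q ^ i)) ^ q + (\<Sum>i<k. (- 1) ^ i * w ^ (q ^ i)) \<simeq> w - (- 1) ^ k * w ^ (q ^ k)"
proof (induction k)
  case 0
  then show ?case using q_ge by (simp add: power_0_left)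
next
  case (Suc k)
  let ?T = "\<Sum>i<k. (- 1) ^ i * w ^ (q ^ i)"
  let ?d = "(- 1) ^ k * w ^ (q ^ k)"
  have pq: "(a + b) ^ q \<simeq> a ^ q + b ^ q" for a b using power_q_add[of a b 1] by simp
  have "(- 1 :: 'a) ^ q \<simeq> - 1" using power_q_uminus[of 1 1] by simp
  then have "((- 1 :: 'a) ^ q) ^ k \<simeq> (- 1) ^ k" by (rule congr_power)
  then have "((- 1 :: 'a) ^ k) ^ q \<simeq> (- 1) ^ k" by (simp add: mult.commute flip: power_mult)
  then have d: "?d ^ q \<simeq> (- 1) ^ k * w ^ (q ^ Suc k)"
    using congr_mult[OF _ congr_refl[of "w ^ (q ^ Suc k)"]]
    by (simp add: power_mult_distrib mult.commute flip: power_mult)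
  have "(?T + ?d) ^ q + (?T + ?d) \<simeq> (?T ^ q + ?d ^ q) + (?T + ?d)"
    by (intro congr_add pq congr_refl)
  also have "\<dots> \<simeq> (?T ^ q + (- 1) ^ k * w ^ (q ^ Suc k)) + (?T + ?d)"
    by (intro congr_add d congr_refl)
  also have "\<dots> = (?T ^ q + ?T) + ((- 1) ^ k * w ^ (q ^ Suc k) + ?d)" by (simp add: algebra_simps)
  also have "\<dots> \<simeq> (w - ?d) + ((- 1) ^ k * w ^ (q ^ Suc k) + ?d)"
    by (intro congr_add Suc congr_refl)
  also have "\<dots> = w - (- 1) ^ Suc k * w ^ (q ^ Suc k)" by simp
  finally show ?case by simp
qed

text \<open>
  For \<open>\<delta> + \<delta> ^ (q ^ n) = 1\<close> and \<open>w = \<delta> * c\<close>, the alternating sum of the conjugates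
  \<open>w ^ (q ^ i)\<close>, \<open>i < n\<close>, is a solution.
\<close>

lemma ex_solution_x:
  assumes c: "c ^ (q ^ n) \<simeq> c"
  shows "\<exists>x. x ^ q + 1 * x \<simeq> c"
proof -
  let ?Q = "q ^ n"
  have Q: "?Q \<ge> 2" using self_le_power[of q n] q_ge n_pos by linarith
  \<comment> \<open>Some trace to the field of order \<open>q ^ n\<close> is nonzero. Otherwise
    \<open>\<delta> = 1\<close> shows that 2 vanishes, so the generator satisfies
    \<open>g ^ (q ^ n) = g\<close> and its order is too small.\<close>
  have "\<exists>\<delta>. \<not> \<delta> ^ ?Q + \<delta> \<simeq> 0"
  proof (rule ccontr)
    assume "\<not> (\<exists>\<delta>. \<not> \<delta> ^ ?Q + \<delta> \<simeq> 0)"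
    then have all: "\<delta> ^ ?Q + \<delta> \<simeq> 0" for \<delta> by blast
    have two: "(1 + 1) * g \<simeq> 0" using all[of 1] by (intro mult_congr_0) simp
    have "g ^ ?Q \<simeq> g"
      using congr_diff[OF all[of g] two] by (simp add: congr_def algebra_simps)
    moreover have "g ^ (?Q - 1) * g = g ^ ?Q" using Q by (intro power_minus_mult) linarith
    ultimately have "g ^ (?Q - 1) * g \<simeq> 1 * g" by simp
    then have "g ^ (?Q - 1) \<simeq> 1" by (rule mult_cancel) (use g_not_0[of 1] in simp)
    then have "r - 1 dvd ?Q - 1" by (simp add: g_power_eq_1_iff)
    then have le: "r - 1 \<le> ?Q - 1" using Q by (auto dest: dvd_imp_le)
    have lt: "(?Q - 1) * 1 < (?Q - 1) * (?Q + 1)" using Q by (intro mult_strict_left_mono) linarith+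
    show False using leD[OF le[unfolded r_minus_1]] lt[unfolded mult_1_right] by blast
  qed
  then obtain \<delta>0 where \<delta>0: "\<not> \<delta>0 ^ ?Q + \<delta>0 \<simeq> 0" by blast
  define \<kappa> where "\<kappa> = \<delta>0 ^ ?Q + \<delta>0"
  obtain \<mu> where \<mu>: "\<kappa> * \<mu> \<simeq> 1" using ex_inverse[OF \<delta>0] unfolding \<kappa>_def by blast
  have "\<kappa> ^ ?Q \<simeq> (\<delta>0 ^ ?Q) ^ ?Q + \<delta>0 ^ ?Q" unfolding \<kappa>_def by (rule power_q_add)
  also have "(\<delta>0 ^ ?Q) ^ ?Q = \<delta>0 ^ r" unfolding r_eq(1) by (simp add: power2_eq_square flip: power_mult)
  also have "\<delta>0 ^ r + \<delta>0 ^ ?Q \<simeq> \<delta>0 + \<delta>0 ^ ?Q" by (intro congr_add power_r congr_refl)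
  also have "\<dots> = \<kappa>" unfolding \<kappa>_def by simp
  finally have "\<kappa> ^ ?Q \<simeq> \<kappa>" .
  then have \<mu>Q: "\<mu> ^ ?Q \<simeq> \<mu>" using fixed_inverse \<mu> by blast
  \<comment> \<open>The trace \<open>\<kappa>\<close> of \<open>\<delta>0\<close> lies in the field
    of order \<open>q ^ n\<close>, so dividing \<open>\<delta>0\<close> by it normalises the trace
    to 1.\<close>
  define \<delta> where "\<delta> = \<delta>0 * \<mu>"
  have "\<delta> + \<delta> ^ ?Q = \<delta>0 * \<mu> + \<delta>0 ^ ?Q * \<mu> ^ ?Q" unfolding \<delta>_def by (simp add: power_mult_distrib)
  also have "\<dots> \<simeq> \<delta>0 * \<mu> + \<delta>0 ^ ?Q * \<mu>" by (intro congr_add congr_mult \<mu>Q congr_refl)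
  also have "\<dots> = \<kappa> * \<mu>" unfolding \<kappa>_def by (simp add: algebra_simps)
  also note \<mu>
  finally have \<delta>: "\<delta> + \<delta> ^ ?Q \<simeq> 1" .
  define x where "x = (\<Sum>i<n. (- 1) ^ i * (\<delta> * c) ^ (q ^ i))"
  have "x ^ q + 1 * x \<simeq> \<delta> * c - (- 1) ^ n * (\<delta> * c) ^ ?Q"
    using alternating_frobenius_sum[where k = n and w = "\<delta> * c"] unfolding x_def by simp
  also have "\<dots> = \<delta> * c + \<delta> ^ ?Q * c ^ ?Q" using n by (simp add: power_mult_distrib)
  also have "\<dots> \<simeq> \<delta> * c + \<delta> ^ ?Q * c" by (intro congr_add congr_mult c congr_refl)
  also have "\<dots> = (\<delta> + \<delta> ^ ?Q) * c" by (simp add: algebra_simps)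
  also have "\<dots> \<simeq> 1 * c" by (intro congr_mult \<delta> congr_refl)
  finally show ?thesis by (intro exI[of _ x]) simp
qed

lemma norm_fixed: "a ^ (q\<^sup>2) \<simeq> a \<Longrightarrow> (a ^ (q + 1)) ^ q \<simeq> a ^ (q + 1)"
proof -
  assume a: "a ^ (q\<^sup>2) \<simeq> a"
  have "(a ^ (q + 1)) ^ q = a ^ (q\<^sup>2) * a ^ q"
    by (simp add: power2_eq_square power_add algebra_simps flip: power_mult)
  also have "\<dots> \<simeq> a * a ^ q" by (intro congr_mult a congr_refl)
  finally show ?thesis by simp
qed

text \<open>The values of \<open>z\<close> below at least one rational point. The lemmas on
  \<open>fibre_y\<close> and \<open>fibre_x\<close> show that the fibre over such a value has the
  full size \<open>q ^ 3\<close>.\<close>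

definition base_points :: "'a set" where
  "base_points = {z\<in>R. \<exists>x y. x ^ q + 1 * x \<simeq> y ^ (q + 1) \<and> y ^ (q\<^sup>2) + (- 1) * y \<simeq> z ^ m}"

definition fibre_y :: "'a \<Rightarrow> 'a set" where
  "fibre_y z = {y\<in>R. y ^ (q\<^sup>2) + (- 1) * y \<simeq> z ^ m}"

definition fibre_x :: "'a \<Rightarrow> 'a set" where
  "fibre_x y = {x\<in>R. x ^ q + 1 * x \<simeq> y ^ (q + 1)}"

lemma fibre_y_solution: "z \<in> base_points \<Longrightarrow> \<exists>y. y ^ (q\<^sup>2) + (- 1) * y \<simeq> z ^ m"
  unfolding base_points_def by blast

text \<open>
  The curve has the automorphisms \<open>(x, y) \<mapsto> (x + a ^ q * y + b, y + a)\<close> with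
  \<open>a ^ q\<^sup>2 = a\<close> and \<open>b ^ q + b = a ^ (q + 1)\<close>.
\<close>

lemma fibre_x_solution:
  assumes z: "z \<in> base_points" and y: "y \<in> fibre_y z"
  shows "\<exists>x. x ^ q + 1 * x \<simeq> y ^ (q + 1)"
proof -
  obtain x0 y0 where xy0: "x0 ^ q + 1 * x0 \<simeq> y0 ^ (q + 1)" "y0 ^ (q\<^sup>2) + (- 1) * y0 \<simeq> z ^ m"
    using z unfolding base_points_def by blast
  have y': "y ^ (q\<^sup>2) + (- 1) * y \<simeq> z ^ m" using y unfolding fibre_y_def by simp
  define a where "a = y - y0"
  have "a ^ (q\<^sup>2) \<simeq> y ^ (q\<^sup>2) - y0 ^ (q\<^sup>2)" unfolding a_def by (rule power_q_diff)
  also have "\<dots> = (y ^ (q\<^sup>2) + (- 1) * y) - (y0 ^ (q\<^sup>2) + (- 1) * y0) + a" unfolding a_def by simp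
  also have "\<dots> \<simeq> z ^ m - z ^ m + a" by (intro congr_add congr_diff y' xy0 congr_refl)
  finally have a: "a ^ (q\<^sup>2) \<simeq> a" by simp
  \<comment> \<open>The norm of \<open>a\<close> lies in the field of order \<open>q\<close>, hence
    in that of order \<open>q ^ n\<close>, which makes the equation for \<open>b\<close>
    solvable.\<close>
  have "(a ^ (q + 1)) ^ (q ^ n) \<simeq> a ^ (q + 1)"
    by (rule fixed_power_iterate[OF norm_fixed[OF a]])
  then obtain b where b: "b ^ q + 1 * b \<simeq> a ^ (q + 1)" using ex_solution_x by blast
  have pq: "(a + b) ^ q \<simeq> a ^ q + b ^ q" for a b using power_q_add[of a b 1] by simp
  define x where "x = x0 + (a ^ q * y0 + b)"
  have "x ^ q \<simeq> x0 ^ q + (a ^ q * y0 + b) ^ q" unfolding x_def by (rule pq)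
  also have "\<dots> \<simeq> x0 ^ q + ((a ^ q * y0) ^ q + b ^ q)" by (intro congr_add pq congr_refl)
  also have "(a ^ q * y0) ^ q = a ^ (q\<^sup>2) * y0 ^ q"
    by (simp add: power_mult_distrib power2_eq_square flip: power_mult)
  also have "x0 ^ q + (a ^ (q\<^sup>2) * y0 ^ q + b ^ q) \<simeq> x0 ^ q + (a * y0 ^ q + b ^ q)"
    by (intro congr_add congr_mult a congr_refl)
  finally have xq: "x ^ q \<simeq> x0 ^ q + (a * y0 ^ q + b ^ q)" .
  have "x ^ q + 1 * x \<simeq> (x0 ^ q + (a * y0 ^ q + b ^ q)) + 1 * x" by (intro congr_add xq congr_refl)
  also have "\<dots> = (x0 ^ q + 1 * x0) + (b ^ q + 1 * b) + (a * y0 ^ q + a ^ q * y0)"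
    unfolding x_def by (simp add: algebra_simps)
  also have "\<dots> \<simeq> y0 ^ (q + 1) + a ^ (q + 1) + (a * y0 ^ q + a ^ q * y0)"
    by (intro congr_add xy0 b congr_refl)
  also have "\<dots> = (y0 ^ q + a ^ q) * (y0 + a)" by (simp add: algebra_simps)
  also have "\<dots> \<simeq> (y0 + a) ^ q * (y0 + a)" by (intro congr_mult congr_sym[OF pq] congr_refl)
  also have "\<dots> = y ^ (q + 1)" unfolding a_def by simp
  finally show ?thesis by blast
qed

lemma q2_def: "q\<^sup>2 = p ^ (e * 2)"
  unfolding q(1) by (simp only: power_mult)

lemma card_fibre_y:
  assumes "z \<in> base_points"
  shows "card (fibre_y z) = q\<^sup>2"
proof -
  obtain y where y: "y ^ (q\<^sup>2) + (- 1) * y \<simeq> z ^ m" using fibre_y_solution[OF assms] by blast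
  show ?thesis unfolding fibre_y_def
    by (rule card_solutions[OF q2_def q2_ge dvd_r_minus_1(2) card_kernel_y y])
qed

lemma card_fibre_x: "z \<in> base_points \<Longrightarrow> y \<in> fibre_y z \<Longrightarrow> card (fibre_x y) = q"
proof -
  assume "z \<in> base_points" "y \<in> fibre_y z"
  then obtain x where x: "x ^ q + 1 * x \<simeq> y ^ (q + 1)" using fibre_x_solution by blast
  show ?thesis unfolding fibre_x_def
    by (rule card_solutions[OF q(1) q_ge dvd_r_minus_1(1) card_kernel_x x])
qed

end

section \<open>Counting the rational fibres\<close>

context ggs_field
begin

lemma zero_base_point: "0 \<in> base_points"
proof -
  have "m \<noteq> 0" using m by (metis add_is_0 mult_is_0 zero_neq_one)
  then have "(0::'a) ^ q + 1 * 0 \<simeq> 0 ^ (q + 1) \<and> (0::'a) ^ (q\<^sup>2) + (- 1) * 0 \<simeq> 0 ^ m"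
    using q_ge by (simp add: power_0_left)
  then show ?thesis unfolding base_points_def using zero_R by blast
qed

text \<open>
  Points with \<open>z ^ m = a * u\<close>, where \<open>a\<close> lies in the field of order \<open>q\<^sup>2\<close> and
  \<open>u = y ^ q\<^sup>2 - y\<close> with \<open>y\<close> in the field of order \<open>q ^ n\<close>; the exponent \<open>q\<^sup>2 - 1\<close> eliminates
  \<open>a\<close>.
\<close>

lemma base_pointI:
  assumes z: "z \<in> R" and y: "y ^ (q ^ n) \<simeq> y" and u: "u \<simeq> y ^ (q\<^sup>2) - y" "\<not> u \<simeq> 0"
    and zu: "(z ^ m) ^ (q\<^sup>2 - 1) \<simeq> u ^ (q\<^sup>2 - 1)"
  shows "z \<in> base_points"
proof -
  obtain w where w: "u * w \<simeq> 1" using ex_inverse[OF u(2)] by blast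
  \<comment> \<open>The quotient of \<open>z ^ m\<close> and \<open>u\<close>. It lies in the field
    of order \<open>q ^ 2\<close>, over which \<open>y ^ q\<^sup>2 - y\<close> is linear in
    \<open>y\<close>, so \<open>a * y\<close> solves the equation with right-hand side
    \<open>z ^ m\<close>.\<close>
  define a where "a = z ^ m * w"
  have "a ^ (q\<^sup>2 - 1) = (z ^ m) ^ (q\<^sup>2 - 1) * w ^ (q\<^sup>2 - 1)" unfolding a_def by (rule power_mult_distrib)
  also have "\<dots> \<simeq> u ^ (q\<^sup>2 - 1) * w ^ (q\<^sup>2 - 1)" by (intro congr_mult zu congr_refl)
  also have "\<dots> = (u * w) ^ (q\<^sup>2 - 1)" by (rule power_mult_distrib[symmetric])
  also have "\<dots> \<simeq> 1 ^ (q\<^sup>2 - 1)" by (rule congr_power[OF w])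
  finally have a1: "a ^ (q\<^sup>2 - 1) \<simeq> 1" by simp
  have "a ^ (q\<^sup>2) = a ^ (q\<^sup>2 - 1) * a" using q2_ge by (intro power_minus_mult[symmetric]) linarith
  also have "\<dots> \<simeq> 1 * a" by (intro congr_mult a1 congr_refl)
  finally have a: "a ^ (q\<^sup>2) \<simeq> a" by simp
  have "a * u = z ^ m * (u * w)" unfolding a_def by (simp add: mult_ac)
  also have "\<dots> \<simeq> z ^ m * 1" by (intro congr_mult w congr_refl)
  finally have au: "a * u \<simeq> z ^ m" by simp
  have "(a * y) ^ (q\<^sup>2) + (- 1) * (a * y) = a ^ (q\<^sup>2) * y ^ (q\<^sup>2) + (- 1) * (a * y)"
    by (simp only: power_mult_distrib)
  also have "\<dots> \<simeq> a * y ^ (q\<^sup>2) + (- 1) * (a * y)" by (intro congr_add congr_mult a congr_refl)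
  also have "\<dots> = a * (y ^ (q\<^sup>2) - y)" by (simp add: algebra_simps)
  also have "\<dots> \<simeq> a * u" by (intro congr_mult congr_sym[OF u(1)] congr_refl)
  also note au
  finally have 1: "(a * y) ^ (q\<^sup>2) + (- 1) * (a * y) \<simeq> z ^ m" .
  \<comment> \<open>Both the norm of \<open>a\<close> and \<open>y\<close> lie in the field of order
    \<open>q ^ n\<close>, so the equation for \<open>x\<close> can be solved.\<close>
  have "((a * y) ^ (q + 1)) ^ (q ^ n) = (a ^ (q + 1)) ^ (q ^ n) * (y ^ (q ^ n)) ^ (q + 1)"
    by (simp only: power_mult_distrib power_mult[symmetric] mult.commute)
  also have "\<dots> \<simeq> a ^ (q + 1) * y ^ (q + 1)"
    by (intro congr_mult congr_power[OF y] fixed_power_iterate[OF norm_fixed[OF a]])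
  also have "\<dots> = (a * y) ^ (q + 1)" by (simp only: power_mult_distrib)
  finally obtain x where "x ^ q + 1 * x \<simeq> (a * y) ^ (q + 1)" using ex_solution_x by blast
  then show ?thesis unfolding base_points_def using z 1 by blast
qed

text \<open>\<open>A\<close> consists of the \<open>q ^ n - q\<close> elements of the field of order
  \<open>q ^ n\<close> outside that of order \<open>q\<close>. Each value of \<open>\<tau>\<close>
  is taken by at most \<open>(q - 1) * q\<close> of them and is the \<open>M\<close>-th power of
  \<open>M = (q ^ n + 1) * (q - 1)\<close> elements \<open>z\<close>. The last summand 1 is the
  point \<open>z = 0\<close>.\<close>

lemma card_base_points: "card base_points \<ge> (q ^ n + 1) * (q ^ (n - 1) - 1) + 1"
proof -
  let ?K = "{y\<in>R. y ^ (q ^ n) \<simeq> y}"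
  let ?F = "{c\<in>R. c ^ q \<simeq> c}"
  define A where "A = {y\<in>?K. \<not> y ^ (q\<^sup>2) - y \<simeq> 0}"
  define u where "u = (\<lambda>y::'a. y ^ (q\<^sup>2) - y)"
  define \<tau> where "\<tau> = (\<lambda>y. rep (u y ^ (q\<^sup>2 - 1)))"
  define V where "V = \<tau> ` A"
  define M where "M = (q ^ n + 1) * (q - 1)"
  have qn: "q ^ n \<ge> 2" using self_le_power[of q n] q_ge n_pos by linarith
  have cK: "card ?K = q ^ n" by (rule card_subfield[OF qn dvd_r_minus_1(3)])
  have cF: "card ?F = q" by (rule card_subfield[OF q_ge dvd_r_minus_1(1)])
  have fin: "finite ?K" "finite ?F" "finite A" "finite V" unfolding A_def V_def by auto
  have FK: "?K = A \<union> ?F"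
  proof (intro equalityI subsetI)
    fix y assume y: "y \<in> ?K"
    show "y \<in> A \<union> ?F"
    proof (cases "y ^ (q\<^sup>2) - y \<simeq> 0")
      case True
      then have "y ^ (q\<^sup>2) \<simeq> y" by (simp only: congr_0_iff_diff[symmetric])
      then show ?thesis using fixed_power_q[of y] y by simp
    qed (use y in \<open>simp add: A_def\<close>)
  next
    fix y assume "y \<in> A \<union> ?F"
    then show "y \<in> ?K" using fixed_power_iterate[of y q n] by (auto simp: A_def)
  qed
  have "A \<inter> ?F = {}"
  proof -
    have "y ^ (q\<^sup>2) - y \<simeq> 0" if "y \<in> ?F" for y
      using fixed_power_iterate[of y q 2] that by (simp flip: congr_0_iff_diff)
    then show ?thesis unfolding A_def by blast
  qed
  then have cA: "card A + q = q ^ n"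
    using card_Un_disjoint[OF fin(3,2)] FK cK cF by simp
  have uK: "u y ^ (q ^ n) \<simeq> u y" if "y ^ (q ^ n) \<simeq> y" for y
  proof -
    have "u y ^ (q ^ n) \<simeq> (y ^ (q\<^sup>2)) ^ (q ^ n) - y ^ (q ^ n)" unfolding u_def by (rule power_q_diff)
    also have "(y ^ (q\<^sup>2)) ^ (q ^ n) = (y ^ (q ^ n)) ^ (q\<^sup>2)" by (simp only: power_mult[symmetric] mult.commute)
    also have "(y ^ (q ^ n)) ^ (q\<^sup>2) - y ^ (q ^ n) \<simeq> y ^ (q\<^sup>2) - y" by (intro congr_diff congr_power that)
    finally show ?thesis unfolding u_def .
  qed
  \<comment> \<open>Elements with equal \<open>\<tau>\<close> are related by an affine map over the
    field of order \<open>q\<close>: the quotient \<open>c\<close> of \<open>u y\<close> and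
    \<open>u y0\<close> lies in both subfields, and so does \<open>f = y - c * y0\<close>, which is
    annihilated by \<open>u\<close>.\<close>
  have fib: "card {y\<in>A. \<tau> y = b} \<le> (q - 1) * q" if b: "b \<in> V" for b
  proof -
    obtain y0 where y0: "y0 \<in> A" "b = \<tau> y0" using b unfolding V_def by auto
    have y0': "y0 ^ (q ^ n) \<simeq> y0" "\<not> u y0 \<simeq> 0" using y0 unfolding A_def u_def by auto
    obtain w where w: "u y0 * w \<simeq> 1" using ex_inverse[OF y0'(2)] by blast
    have wK: "w ^ (q ^ n) \<simeq> w" by (rule fixed_inverse[OF uK[OF y0'(1)] w])
    have "{y\<in>A. \<tau> y = b} \<subseteq> (\<lambda>(c, f). rep (c * y0 + f)) ` ((?F - {0}) \<times> ?F)"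
    proof
      fix y assume "y \<in> {y\<in>A. \<tau> y = b}"
      then have y: "y \<in> R" "y ^ (q ^ n) \<simeq> y" "\<not> u y \<simeq> 0" "u y ^ (q\<^sup>2 - 1) \<simeq> u y0 ^ (q\<^sup>2 - 1)"
        using y0(2) unfolding A_def u_def \<tau>_def by (auto simp: rep_eq_iff)
      define c where "c = u y * w"
      define f where "f = y - c * y0"
      have "c ^ (q\<^sup>2 - 1) = u y ^ (q\<^sup>2 - 1) * w ^ (q\<^sup>2 - 1)" unfolding c_def by (rule power_mult_distrib)
      also have "\<dots> \<simeq> u y0 ^ (q\<^sup>2 - 1) * w ^ (q\<^sup>2 - 1)" by (intro congr_mult y congr_refl)
      also have "\<dots> = (u y0 * w) ^ (q\<^sup>2 - 1)" by (rule power_mult_distrib[symmetric])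
      also have "\<dots> \<simeq> 1 ^ (q\<^sup>2 - 1)" by (rule congr_power[OF w])
      finally have c1: "c ^ (q\<^sup>2 - 1) \<simeq> 1" by simp
      have "c ^ (q\<^sup>2) = c ^ (q\<^sup>2 - 1) * c" using q2_ge by (intro power_minus_mult[symmetric]) linarith
      also have "\<dots> \<simeq> 1 * c" by (intro congr_mult c1 congr_refl)
      finally have c2: "c ^ (q\<^sup>2) \<simeq> c" by simp
      have "c ^ (q ^ n) = u y ^ (q ^ n) * w ^ (q ^ n)" unfolding c_def by (rule power_mult_distrib)
      also have "\<dots> \<simeq> c" unfolding c_def by (intro congr_mult uK y(2) wK)
      finally have cn: "c ^ (q ^ n) \<simeq> c" .
      have cq: "c ^ q \<simeq> c" by (rule fixed_power_q[OF cn c2])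
      have c0: "\<not> c \<simeq> 0"
      proof -
        have "\<not> w \<simeq> 0" using not_congr_0_if_inverse[of w "u y0"] w by (simp add: mult.commute)
        then show ?thesis unfolding c_def using y(3) by (simp add: mult_congr_0_iff)
      qed
      have "c * u y0 = u y * (u y0 * w)" unfolding c_def by (simp add: mult_ac)
      also have "\<dots> \<simeq> u y * 1" by (intro congr_mult w congr_refl)
      finally have cu: "c * u y0 \<simeq> u y" by simp
      have "f ^ (q\<^sup>2) \<simeq> y ^ (q\<^sup>2) - (c * y0) ^ (q\<^sup>2)" unfolding f_def by (rule power_q_diff)
      also have "\<dots> = y ^ (q\<^sup>2) - c ^ (q\<^sup>2) * y0 ^ (q\<^sup>2)" by (simp only: power_mult_distrib)
      also have "\<dots> \<simeq> y ^ (q\<^sup>2) - c * y0 ^ (q\<^sup>2)" by (intro congr_diff congr_mult c2 congr_refl)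
      also have "\<dots> = u y - c * u y0 + f" unfolding u_def f_def by (simp add: algebra_simps)
      also have "\<dots> \<simeq> u y - u y + f" by (intro congr_add congr_diff cu congr_refl)
      finally have f2: "f ^ (q\<^sup>2) \<simeq> f" by simp
      have "f ^ (q ^ n) \<simeq> y ^ (q ^ n) - (c * y0) ^ (q ^ n)" unfolding f_def by (rule power_q_diff)
      also have "\<dots> = y ^ (q ^ n) - c ^ (q ^ n) * y0 ^ (q ^ n)" by (simp only: power_mult_distrib)
      also have "\<dots> \<simeq> f" unfolding f_def by (intro congr_diff congr_mult cn y y0')
      finally have fq: "f ^ q \<simeq> f" using fixed_power_q f2 by blast
      have repF: "rep a \<in> ?F" if "a ^ q \<simeq> a" for a
      proof -
        have "rep a ^ q \<simeq> a ^ q" by (rule congr_power[OF rep_congr])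
        also note that
        also note congr_rep
        finally show ?thesis by simp
      qed
      have "rep c \<noteq> 0" using c0 congr_rep[of c] by auto
      then have mem: "(rep c, rep f) \<in> (?F - {0}) \<times> ?F" using repF cq fq by simp
      have yeq: "y = rep (rep c * y0 + rep f)"
      proof (rule rep_eqI[symmetric])
        show "y \<in> R" by (rule y)
        have "rep c * y0 + rep f \<simeq> c * y0 + f" by (intro congr_add congr_mult rep_congr congr_refl)
        then show "rep c * y0 + rep f \<simeq> y" unfolding f_def by simp
      qed
      show "y \<in> (\<lambda>(c, f). rep (c * y0 + f)) ` ((?F - {0}) \<times> ?F)"
        by (rule image_eqI[OF _ mem]) (simp only: prod.case, rule yeq)
    qed
    then have "card {y\<in>A. \<tau> y = b} \<le> card ((?F - {0}) \<times> ?F)"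
      using fin by (intro surj_card_le) auto
    also have "\<dots> = (q - 1) * q"
    proof -
      have "0 \<in> ?F" using zero_R q_ge by (simp add: power_0_left)
      then show ?thesis using cF by (simp only: card_cartesian_product card_Diff_singleton)
    qed
    finally show ?thesis .
  qed
  have "card A \<le> ((q - 1) * q) * card V"
    by (rule card_le_fibres[OF fin(3) _ fin(4) fib]) (auto simp: V_def)
  then have "q ^ n \<le> q * ((q - 1) * card V) + q" using cA by (simp add: mult_ac)
  moreover have "q ^ n = q * q ^ (n - 1)" using n_pos by (metis Suc_pred' power_Suc)
  ultimately have "q * q ^ (n - 1) \<le> q * ((q - 1) * card V + 1)" by simp
  then have "q ^ (n - 1) \<le> (q - 1) * card V + 1"
    using q_ge by (simp only: nat_mult_le_cancel1[OF less_le_trans[OF pos2 q_ge]])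
  then have cV: "q ^ (n - 1) - 1 \<le> (q - 1) * card V" by linarith
  have M: "M dvd r - 1" "(r - 1) div M = (q ^ n - 1) div (q - 1)"
  proof -
    obtain c where c: "q ^ n - 1 = (q - 1) * c" using diff_one_dvd_power_diff_one[of q n] by (elim dvdE)
    have rM: "r - 1 = M * c" unfolding r_minus_1 M_def c by (simp only: mult_ac)
    show "M dvd r - 1" unfolding rM by simp
    show "(r - 1) div M = (q ^ n - 1) div (q - 1)" unfolding rM c using q_ge unfolding M_def by simp
  qed
  \<comment> \<open>This identity turns \<open>z ^ M = t\<close> into the condition of
    \<open>base_pointI\<close>.\<close>
  have Mm: "M = m * (q\<^sup>2 - 1)" unfolding M_def q2_minus_1 m[symmetric] by (simp only: mult_ac)
  have tV: "card {z\<in>R. z ^ M \<simeq> t} = M \<and> {z\<in>R. z ^ M \<simeq> t} \<subseteq> base_points - {0}" if t: "t \<in> V" for t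
  proof -
    obtain y where y: "y \<in> A" "t = \<tau> y" using t unfolding V_def by auto
    have y': "y ^ (q ^ n) \<simeq> y" "\<not> u y \<simeq> 0" using y unfolding A_def u_def by auto
    have tu: "t \<simeq> u y ^ (q\<^sup>2 - 1)" unfolding y(2) \<tau>_def by (rule rep_congr)
    have "u y ^ (q ^ n - 1) * u y = u y ^ (q ^ n)" using qn by (intro power_minus_mult) linarith
    then have "u y ^ (q ^ n - 1) * u y \<simeq> 1 * u y" using uK[OF y'(1)] by simp
    then have u1: "u y ^ (q ^ n - 1) \<simeq> 1" by (rule mult_cancel[OF _ y'(2)])
    obtain c where c: "q ^ n - 1 = (q - 1) * c" using diff_one_dvd_power_diff_one[of q n] by (elim dvdE)
    have dc: "(r - 1) div M = c" unfolding M(2) c using q_ge by simp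
    \<comment> \<open>Solvability of \<open>z ^ M = t\<close>: since \<open>u y\<close> is a unit of
      the field of order \<open>q ^ n\<close>, its power with exponent \<open>q ^ n - 1\<close> is
      1.\<close>
    have "t ^ c \<simeq> (u y ^ (q\<^sup>2 - 1)) ^ c" by (rule congr_power[OF tu])
    also have "\<dots> = (u y ^ (q ^ n - 1)) ^ (q + 1)"
      unfolding q2_minus_1 c by (simp only: power_mult[symmetric] mult_ac)
    also have "\<dots> \<simeq> 1 ^ (q + 1)" by (rule congr_power[OF u1])
    finally have "t ^ ((r - 1) div M) \<simeq> 1" unfolding dc by simp
    then have 1: "card {z\<in>R. z ^ M \<simeq> t} = M" by (rule card_roots[OF M(1)])
    have "z \<in> base_points - {0}" if "z \<in> R" "z ^ M \<simeq> t" for z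
    proof -
      have zu: "(z ^ m) ^ (q\<^sup>2 - 1) \<simeq> u y ^ (q\<^sup>2 - 1)"
        using congr_trans[OF that(2) tu] unfolding Mm by (simp only: power_mult)
      have "z \<in> base_points"
        by (rule base_pointI[OF that(1) y'(1) _ y'(2) zu]) (simp add: u_def)
      moreover have "z \<noteq> 0"
      proof
        assume "z = 0"
        then have "(0::'a) \<simeq> u y ^ (q\<^sup>2 - 1)"
          using zu q2_ge m by (cases m) (auto simp: power_0_left split: if_splits)
        then have "u y ^ (q\<^sup>2 - 1) \<simeq> 0" by (rule congr_sym)
        then show False using y'(2) by (simp add: power_congr_0_iff)
      qed
      ultimately show ?thesis by simp
    qed
    then show ?thesis using 1 by blast
  qed
  let ?U = "\<Union>t\<in>V. {z\<in>R. z ^ M \<simeq> t}"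
  have VR: "V \<subseteq> R" unfolding V_def \<tau>_def by auto
  have "card ?U = (\<Sum>t\<in>V. card {z\<in>R. z ^ M \<simeq> t})"
  proof (rule card_UN_disjoint[OF fin(4)])
    show "\<forall>t\<in>V. finite {z\<in>R. z ^ M \<simeq> t}" by simp
    show "\<forall>t\<in>V. \<forall>t'\<in>V. t \<noteq> t' \<longrightarrow> {z\<in>R. z ^ M \<simeq> t} \<inter> {z\<in>R. z ^ M \<simeq> t'} = {}"
    proof (intro ballI impI, rule ccontr)
      fix t t' assume t: "t \<in> V" "t' \<in> V" "t \<noteq> t'" "{z\<in>R. z ^ M \<simeq> t} \<inter> {z\<in>R. z ^ M \<simeq> t'} \<noteq> {}"
      then obtain z where z: "z ^ M \<simeq> t" "z ^ M \<simeq> t'" by blast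
      have "t \<simeq> t'" by (rule congr_trans[OF congr_sym[OF z(1)] z(2)])
      then show False using R_inj t VR by blast
    qed
  qed
  also have "\<dots> = M * card V" using tV by simp
  finally have cU: "card ?U = M * card V" .
  have finb: "finite base_points" unfolding base_points_def by simp
  have "?U \<subseteq> base_points - {0}" using tV by blast
  then have "card ?U \<le> card (base_points - {0})" using finb by (intro card_mono) auto
  also have "\<dots> = card base_points - 1" using zero_base_point by (simp add: card_Diff_singleton)
  finally have "M * card V + 1 \<le> card base_points"
    using cU zero_base_point finb card_gt_0_iff[of base_points] by auto
  moreover have "(q ^ n + 1) * (q ^ (n - 1) - 1) \<le> M * card V"
    unfolding M_def mult.assoc by (rule mult_le_mono2[OF cV])
  ultimately show ?thesis by linarith
qed

end

section \<open>The semigroup of pole orders\<close>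

text \<open>
  \<open>wt i j k\<close> is the pole order of \<open>x ^ i * y ^ j * z ^ k\<close> at infinity, and \<open>conductor\<close> is twice
  the genus. The semigroup \<open>S\<close> is symmetric: \<open>s\<close> is a gap only if \<open>conductor - 1 - s\<close> is none.
\<close>

locale weights =
  fixes q m :: nat
  assumes q_ge2: "q \<ge> 2" and m_pos: "m > 0" and coprime_m: "coprime m q"
begin

definition wt :: "nat \<Rightarrow> nat \<Rightarrow> nat \<Rightarrow> nat" where
  "wt i j k = (i * (q + 1) + j * q) * m + k * q ^ 3"

text \<open>The bounds on \<open>i\<close> and \<open>j\<close> describe normal forms with respect
  to the curve equations. The weights with \<open>k = 0\<close> are the Apery set for
  \<open>q ^ 3\<close>, one element in each residue class.\<close>

definition S :: "nat set" where
  "S = {s. \<exists>i j k. i < q \<and> j < q\<^sup>2 \<and> s = wt i j k}"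

text \<open>The largest Apery element is \<open>wt (q - 1) (q\<^sup>2 - 1) 0\<close>. Less
  \<open>q ^ 3\<close> it is the largest gap, and the conductor is one more.\<close>

definition conductor :: nat where
  "conductor = (q\<^sup>2 - 1) * (q + 1) * m + 1 - q ^ 3"

text \<open>After cancelling \<open>m\<close>, the residue modulo \<open>q\<close> reveals
  \<open>i\<close>; after division by \<open>q\<close>, the residue modulo \<open>q ^ 2\<close>
  reveals \<open>j\<close>.\<close>

lemma wt_cong_inj:
  assumes "i < q" "i' < q" "j < q\<^sup>2" "j' < q\<^sup>2" "[wt i j 0 = wt i' j' 0] (mod q ^ 3)"
  shows "i = i' \<and> j = j'"
proof -
  have "coprime m (q ^ 3)" using coprime_m by simp
  then have *: "[i * (q + 1) + j * q = i' * (q + 1) + j' * q] (mod q ^ 3)"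
    using assms(5) unfolding wt_def by (simp add: cong_mult_rcancel_nat del: mult_Suc_right)
  have q3: "q ^ 3 = q * q\<^sup>2" by (simp add: power3_eq_cube power2_eq_square)
  have "[i * (q + 1) + j * q = i' * (q + 1) + j' * q] (mod q)"
    using * unfolding q3 by (rule cong_modulus_mult_nat)
  then have "(i + q * (i + j)) mod q = (i' + q * (i' + j')) mod q"
    unfolding cong_def by (simp add: algebra_simps)
  then have i: "i = i'" using assms(1,2) by simp
  have "[j * q = j' * q] (mod q ^ 3)"
    using * unfolding i by (simp add: cong_add_lcancel_nat)
  then have "(q * j) mod (q * q\<^sup>2) = (q * j') mod (q * q\<^sup>2)"
    unfolding q3 cong_def by (simp add: mult.commute)
  then have "q * (j mod q\<^sup>2) = q * (j' mod q\<^sup>2)" by (simp only: mult_mod_right)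
  then have "j = j'" using assms(3,4) q_ge2 by simp
  then show ?thesis using i by simp
qed

lemma wt_unique:
  assumes "i < q" "i' < q" "j < q\<^sup>2" "j' < q\<^sup>2" "wt i j k = wt i' j' k'"
  shows "i = i' \<and> j = j' \<and> k = k'"
proof -
  have "[wt i j 0 = wt i' j' 0] (mod q ^ 3)"
  proof -
    have "wt i j k mod q ^ 3 = wt i j 0 mod q ^ 3" for i j k unfolding wt_def by simp
    then show ?thesis unfolding cong_def using assms(5) by metis
  qed
  then have ij: "i = i' \<and> j = j'" using wt_cong_inj assms by blast
  then have "k * q ^ 3 = k' * q ^ 3" using assms(5) unfolding wt_def by simp
  then show ?thesis using ij q_ge2 by simp
qed

lemma ex_residue: "\<exists>i j. i < q \<and> j < q\<^sup>2 \<and> [wt i j 0 = s] (mod q ^ 3)"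
proof -
  let ?f = "\<lambda>(i, j). wt i j 0 mod q ^ 3"
  have inj: "inj_on ?f ({..<q} \<times> {..<q\<^sup>2})"
  proof (rule inj_onI)
    fix a b assume ab: "a \<in> {..<q} \<times> {..<q\<^sup>2}" "b \<in> {..<q} \<times> {..<q\<^sup>2}" "?f a = ?f b"
    obtain i j i' j' where "a = (i, j)" "b = (i', j')" by (metis surj_pair)
    then show "a = b" using wt_cong_inj[of i i' j j'] ab by (simp add: cong_def)
  qed
  have "card (?f ` ({..<q} \<times> {..<q\<^sup>2})) = q ^ 3"
    using card_image[OF inj] by (simp add: card_cartesian_product power3_eq_cube power2_eq_square)
  moreover have "?f ` ({..<q} \<times> {..<q\<^sup>2}) \<subseteq> {..<q ^ 3}" using q_ge2 by auto
  ultimately have "?f ` ({..<q} \<times> {..<q\<^sup>2}) = {..<q ^ 3}" by (intro card_subset_eq) auto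
  moreover have "s mod q ^ 3 \<in> {..<q ^ 3}" using q_ge2 by simp
  ultimately have "s mod q ^ 3 \<in> ?f ` ({..<q} \<times> {..<q\<^sup>2})" by simp
  then obtain i j where "i < q" "j < q\<^sup>2" "s mod q ^ 3 = wt i j 0 mod q ^ 3" by auto
  then show ?thesis unfolding cong_def by metis
qed

text \<open>A gap is an Apery element minus a positive multiple of \<open>q ^ 3\<close>. Replacing
  \<open>i\<close> by \<open>q - 1 - i\<close> and \<open>j\<close> by
  \<open>q\<^sup>2 - 1 - j\<close> reverses the Apery set and turns the difference into a
  sum.\<close>

lemma gap_symmetric:
  assumes "s \<notin> S"
  shows "s < conductor \<and> conductor - 1 - s \<in> S"
proof -
  obtain i j where ij: "i < q" "j < q\<^sup>2" "[wt i j 0 = s] (mod q ^ 3)" using ex_residue by blast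
  have "s < wt i j 0"
  proof (rule ccontr)
    assume "\<not> s < wt i j 0"
    then have le: "wt i j 0 \<le> s" by simp
    then have "q ^ 3 dvd s - wt i j 0" using ij(3) by (simp add: cong_altdef_nat cong_sym_eq)
    then obtain k where "s - wt i j 0 = q ^ 3 * k" by (elim dvdE)
    then have "s = wt i j k" using le unfolding wt_def by (simp add: mult.commute)
    then show False using assms ij unfolding S_def by blast
  qed
  then have "q ^ 3 dvd wt i j 0 - s" using ij(3) by (simp add: cong_altdef_nat)
  then obtain k where k: "wt i j 0 - s = q ^ 3 * k" by (elim dvdE)
  have "k \<noteq> 0" using k \<open>s < wt i j 0\<close> by (intro notI) simp
  then obtain k' where k': "k = Suc k'" by (cases k) auto
  have w: "wt i j 0 = s + q ^ 3 + k' * q ^ 3" using k k' \<open>s < wt i j 0\<close> by (simp add: algebra_simps)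
  define i' j' where "i' = q - 1 - i" and "j' = q\<^sup>2 - 1 - j"
  have ij': "i' < q" "j' < q\<^sup>2" "i + i' = q - 1" "j + j' = q\<^sup>2 - 1"
    using ij unfolding i'_def j'_def by auto
  have "wt i j 0 + wt i' j' 0 = ((i + i') * (q + 1) + (j + j') * q) * m"
    unfolding wt_def by (simp add: algebra_simps)
  also have "\<dots> = (q\<^sup>2 - 1) * (q + 1) * m"
  proof -
    have "(q - 1) * (q + 1) = q\<^sup>2 - 1" using q_ge2 by (simp add: power2_eq_square algebra_simps)
    then have "(q - 1) * (q + 1) + (q\<^sup>2 - 1) * q = (q\<^sup>2 - 1) * (q + 1)" by simp
    then show ?thesis using ij' by simp
  qed
  finally have "conductor = s + (wt i' j' 0 + k' * q ^ 3) + 1" unfolding conductor_def w by simp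
  then have "s < conductor" "conductor - 1 - s = wt i' j' k'" by (simp_all add: wt_def)
  then show ?thesis using ij' unfolding S_def by blast
qed

text \<open>Reflection injects the gaps into the non-gaps below the conductor.\<close>

lemma gaps_finite: "finite (- S)" and two_card_gaps: "2 * card (- S) \<le> conductor"
proof -
  have sub: "- S \<subseteq> {..<conductor}" using gap_symmetric by auto
  then show fin: "finite (- S)" using finite_subset by blast
  have inj: "inj_on (\<lambda>s. conductor - 1 - s) (- S)"
  proof (rule inj_onI)
    fix a b assume ab: "a \<in> - S" "b \<in> - S" "conductor - 1 - a = conductor - 1 - b"
    have "a < conductor" "b < conductor" using ab gap_symmetric by simp_all
    then show "a = b" using ab(3) by linarith
  qed
  have "(\<lambda>s. conductor - 1 - s) ` (- S) \<subseteq> {..<conductor} - (- S)"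
  proof
    fix x assume "x \<in> (\<lambda>s. conductor - 1 - s) ` (- S)"
    then obtain s where s: "s \<notin> S" "x = conductor - 1 - s" by auto
    have "s < conductor \<and> conductor - 1 - s \<in> S" by (rule gap_symmetric[OF s(1)])
    then show "x \<in> {..<conductor} - (- S)" unfolding s(2) by auto
  qed
  then have "card (- S) \<le> card ({..<conductor} - (- S))"
    using card_mono[of "{..<conductor} - (- S)"] card_image[OF inj] by (metis finite_Diff finite_lessThan)
  also have "\<dots> = conductor - card (- S)" using card_Diff_subset[OF fin sub] by simp
  finally show "2 * card (- S) \<le> conductor" using card_mono[OF _ sub] by simp
qed

lemma card_S_below: "card (S \<inter> {..<M}) + card (- S \<inter> {..<M}) = M"
proof -
  have "{..<M} = (S \<inter> {..<M}) \<union> (- S \<inter> {..<M})" by auto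
  moreover have "card ((S \<inter> {..<M}) \<union> (- S \<inter> {..<M})) = card (S \<inter> {..<M}) + card (- S \<inter> {..<M})"
    by (rule card_Un_disjoint) auto
  ultimately show ?thesis by simp
qed

lemma card_gaps_below: "card (- S \<inter> {..<M}) \<le> card (- S)"
  by (rule card_mono[OF gaps_finite]) auto

text \<open>The first \<open>l\<close> pole orders are encoded by a threshold \<open>M\<close>,
  which counts them together with the gaps below it.\<close>

lemma ex_card_S_below: "\<exists>M. card (S \<inter> {..<M}) = l \<and> M \<le> l + card (- S)"
proof -
  have "\<exists>M. card (S \<inter> {..<M}) = l"
  proof (induction l)
    case 0
    show ?case by (intro exI[of _ 0]) simp
  next
    case (Suc l)
    then obtain M where M: "card (S \<inter> {..<M}) = l" by blast
    have "infinite S" using gaps_finite by (metis finite_compl infinite_UNIV_nat)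
    then have ex: "\<exists>s\<ge>M. s \<in> S" by (metis infinite_nat_iff_unbounded_le)
    define s where "s = (LEAST s. s \<ge> M \<and> s \<in> S)"
    have s: "s \<ge> M" "s \<in> S" using LeastI_ex[OF ex] unfolding s_def by auto
    have "S \<inter> {..<Suc s} = insert s (S \<inter> {..<M})"
    proof (intro equalityI subsetI)
      fix x assume x: "x \<in> S \<inter> {..<Suc s}"
      show "x \<in> insert s (S \<inter> {..<M})"
      proof (cases "x \<ge> M")
        case True
        then have "s \<le> x" using x unfolding s_def by (intro Least_le) auto
        then show ?thesis using x by simp
      qed (use x in auto)
    qed (use s in auto)
    then have "card (S \<inter> {..<Suc s}) = Suc l" using M s by simp
    then show ?case by blast
  qed
  then obtain M where M: "card (S \<inter> {..<M}) = l" by blast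
  then show ?thesis using card_S_below[of M] card_gaps_below[of M] by (intro exI[of _ M]) linarith
qed

text \<open>Of the \<open>w + 1\<close> numbers up to \<open>w\<close>, one is lost only if it or
  its complement is a gap, which costs at most twice the gaps below \<open>w\<close>. As
  \<open>w\<close> counts the semigroup elements and the gaps below it, one copy of the gaps
  cancels.\<close>

lemma card_summands:
  assumes "w \<in> S" "l \<le> card (S \<inter> {..<w})"
  shows "l + 1 \<le> card {a\<in>S. a \<le> w \<and> w - a \<in> S} + card (- S)"
proof -
  let ?A = "{a\<in>S. a \<le> w \<and> w - a \<in> S}"
  let ?G = "- S \<inter> {..<w}"
  have finA: "finite ?A" by (rule finite_subset[of _ "{..w}"]) auto
  have finG: "finite ?G" by simp
  have "{..w} \<subseteq> ?A \<union> (?G \<union> (\<lambda>a. w - a) ` ?G)"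
  proof
    fix a assume a: "a \<in> {..w}"
    show "a \<in> ?A \<union> (?G \<union> (\<lambda>a. w - a) ` ?G)"
    proof (cases "a \<in> S")
      case aS: True
      show ?thesis
      proof (cases "w - a \<in> S")
        case False
        then have "a \<noteq> 0" using assms(1) by (intro notI) simp
        then have "w - a \<in> ?G" "a = w - (w - a)" using False a by auto
        then show ?thesis by blast
      qed (use a aS in auto)
    next
      case False
      then have "a \<noteq> w" using assms(1) by blast
      then show ?thesis using a False by auto
    qed
  qed
  then have "card {..w} \<le> card (?A \<union> (?G \<union> (\<lambda>a. w - a) ` ?G))"
    using finA finG by (intro card_mono) auto
  also have "\<dots> \<le> card ?A + card (?G \<union> (\<lambda>a. w - a) ` ?G)" by (rule card_Un_le)
  also have "\<dots> \<le> card ?A + (card ?G + card ((\<lambda>a. w - a) ` ?G))" by (intro add_left_mono card_Un_le)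
  also have "\<dots> \<le> card ?A + (card ?G + card ?G)" by (intro add_left_mono card_image_le finG)
  finally have "w + 1 \<le> card ?A + (card ?G + card ?G)" by simp
  then show ?thesis using card_S_below[of w] card_gaps_below[of w] assms(2) by linarith
qed

end

section \<open>Evaluation codes\<close>

text \<open>Row rank equals column rank: if the positions in \<open>T\<close> satisfy no nontrivial
  linear relation on the generators \<open>A s\<close>, then their combinations take arbitrary
  values on \<open>T\<close>.\<close>

lemma (in max_ideal) full_rank_surjective:
  assumes fin: "finite T" "finite J"
    and inj: "\<And>c. (\<And>s. s \<in> J \<Longrightarrow> (\<Sum>P\<in>T. c P * A s P) \<simeq> 0) \<Longrightarrow> (\<And>P. P \<in> T \<Longrightarrow> c P \<simeq> 0)"
  shows "\<exists>\<mu>. \<forall>P\<in>T. (\<Sum>s\<in>J. \<mu> s * A s P) \<simeq> b P"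
  using fin(1) inj
proof (induction T arbitrary: b rule: finite_induct)
  case (insert i T)
  let ?v = "\<lambda>\<mu> P. \<Sum>s\<in>J. \<mu> s * A s P"
  have lin: "?v (\<lambda>s. a * \<mu> s + \<nu> s) P = a * ?v \<mu> P + ?v \<nu> P" for a \<mu> \<nu> P
    by (simp add: algebra_simps sum.distrib sum_distrib_left)
  have IH: "\<exists>\<mu>. \<forall>P\<in>T. ?v \<mu> P \<simeq> b P" for b
  proof (rule insert.IH)
    fix c P assume c: "\<And>s. s \<in> J \<Longrightarrow> (\<Sum>P\<in>T. c P * A s P) \<simeq> 0" and P: "P \<in> T"
    define c' where "c' = (\<lambda>P. if P = i then 0 else c P)"
    have eq: "(\<Sum>P\<in>insert i T. c' P * A s P) = (\<Sum>P\<in>T. c P * A s P)" for s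
    proof -
      have "(\<Sum>P\<in>T. c' P * A s P) = (\<Sum>P\<in>T. c P * A s P)"
        using insert.hyps by (intro sum.cong) (auto simp: c'_def)
      then show ?thesis using insert.hyps by (simp add: c'_def)
    qed
    have "c' P \<simeq> 0"
    proof (rule insert.prems)
      show "(\<Sum>P\<in>insert i T. c' P * A s P) \<simeq> 0" if "s \<in> J" for s
        unfolding eq by (rule c[OF that])
      show "P \<in> insert i T" using P by simp
    qed
    moreover have "P \<noteq> i" using P insert.hyps by blast
    ultimately show "c P \<simeq> 0" by (simp add: c'_def)
  qed
  have "\<forall>j\<in>T. \<exists>\<mu>. \<forall>P\<in>T. ?v \<mu> P \<simeq> (if P = j then 1 else 0)" by (intro ballI IH)
  from bchoice[OF this] obtain \<mu> where \<mu>: "\<forall>j\<in>T. \<forall>P\<in>T. ?v (\<mu> j) P \<simeq> (if P = j then 1 else 0)" ..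
  have "\<exists>\<nu>. (\<forall>P\<in>T. ?v \<nu> P \<simeq> 0) \<and> \<not> ?v \<nu> i \<simeq> 0"
  proof (rule ccontr)
    assume "\<not> (\<exists>\<nu>. (\<forall>P\<in>T. ?v \<nu> P \<simeq> 0) \<and> \<not> ?v \<nu> i \<simeq> 0)"
    note no = this
    have all: "?v \<nu> i \<simeq> 0" if "\<And>P. P \<in> T \<Longrightarrow> ?v \<nu> P \<simeq> 0" for \<nu>
    proof (rule ccontr)
      assume "\<not> ?v \<nu> i \<simeq> 0"
      then have "\<exists>\<nu>. (\<forall>P\<in>T. ?v \<nu> P \<simeq> 0) \<and> \<not> ?v \<nu> i \<simeq> 0"
        by (intro exI[of _ \<nu>] conjI ballI that)
      with no show False ..
    qed
    \<comment> \<open>If all vectors vanishing on \<open>T\<close> vanished at \<open>i\<close>, the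
      value at \<open>i\<close> would be a fixed combination of the values on \<open>T\<close>;
      \<open>c\<close> is this excluded relation.\<close>
    define c where "c = (\<lambda>P. if P = i then - 1 else ?v (\<mu> P) i)"
    have "c i \<simeq> 0"
    proof (rule insert.prems)
      fix s assume s: "s \<in> J"
      \<comment> \<open>The generator \<open>s\<close> minus its interpolation from
        \<open>T\<close>, which vanishes on \<open>T\<close>.\<close>
      define \<nu> where "\<nu> = (\<lambda>s'. (if s' = s then 1 else 0) - (\<Sum>j\<in>T. A s j * \<mu> j s'))"
      have v\<nu>: "?v \<nu> P = A s P - (\<Sum>j\<in>T. A s j * ?v (\<mu> j) P)" for P
      proof -
        have "?v \<nu> P = (\<Sum>s'\<in>J. (if s' = s then A s P else 0) - (\<Sum>j\<in>T. A s j * (\<mu> j s' * A s' P)))"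
          unfolding \<nu>_def by (intro sum.cong) (auto simp: algebra_simps sum_distrib_left sum_distrib_right)
        also have "\<dots> = A s P - (\<Sum>s'\<in>J. \<Sum>j\<in>T. A s j * (\<mu> j s' * A s' P))"
          using s fin(2) by (simp add: sum_subtractf)
        also have "(\<Sum>s'\<in>J. \<Sum>j\<in>T. A s j * (\<mu> j s' * A s' P)) = (\<Sum>j\<in>T. A s j * ?v (\<mu> j) P)"
          by (subst sum.swap) (simp add: sum_distrib_left)
        finally show ?thesis .
      qed
      have "?v \<nu> i \<simeq> 0"
      proof (rule all)
        fix P assume P: "P \<in> T"
        have "(\<Sum>j\<in>T. A s j * ?v (\<mu> j) P) \<simeq> (\<Sum>j\<in>T. A s j * (if P = j then 1 else 0))"
          by (intro congr_sum congr_mult congr_refl \<mu>[rule_format] P)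
        also have "\<dots> = (\<Sum>j\<in>T. if P = j then A s P else 0)" by (intro sum.cong) auto
        also have "\<dots> = A s P" using P insert.hyps by simp
        finally have "A s P - (\<Sum>j\<in>T. A s j * ?v (\<mu> j) P) \<simeq> A s P - A s P" by (rule congr_diff[OF congr_refl])
        then show "?v \<nu> P \<simeq> 0" unfolding v\<nu> by simp
      qed
      then have "- ?v \<nu> i \<simeq> - 0" by (rule congr_minus)
      moreover have "(\<Sum>P\<in>insert i T. c P * A s P) = - ?v \<nu> i"
      proof -
        have "(\<Sum>P\<in>T. c P * A s P) = (\<Sum>j\<in>T. A s j * ?v (\<mu> j) i)"
          using insert.hyps by (intro sum.cong) (auto simp: c_def mult.commute)
        then show ?thesis unfolding v\<nu> using insert.hyps by (simp add: c_def)
      qed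
      ultimately show "(\<Sum>P\<in>insert i T. c P * A s P) \<simeq> 0" by simp
    qed simp
    then have "- c i \<simeq> - 0" by (rule congr_minus)
    then show False by (simp add: c_def)
  qed
  then obtain \<nu> where \<nu>': "(\<forall>P\<in>T. ?v \<nu> P \<simeq> 0) \<and> \<not> ?v \<nu> i \<simeq> 0" ..
  note \<nu> = \<nu>'[THEN conjunct1, rule_format] \<nu>'[THEN conjunct2]
  obtain d where d: "?v \<nu> i * d \<simeq> 1" using ex_inverse[OF \<nu>(2)] by blast
  obtain \<mu>' where "\<forall>P\<in>T. ?v \<mu>' P \<simeq> b P" using IH[of b] ..
  note \<mu>' = this[rule_format]
  define a where "a = (b i - ?v \<mu>' i) * d"
  have fin: "?v (\<lambda>s. a * \<nu> s + \<mu>' s) P \<simeq> b P" if "P \<in> insert i T" for P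
  proof (cases "P = i")
    case True
    have "a * ?v \<nu> i + ?v \<mu>' i = (b i - ?v \<mu>' i) * (?v \<nu> i * d) + ?v \<mu>' i"
      unfolding a_def by (simp add: mult_ac)
    also have "\<dots> \<simeq> (b i - ?v \<mu>' i) * 1 + ?v \<mu>' i" by (intro congr_add congr_mult d congr_refl)
    finally show ?thesis unfolding lin True by simp
  next
    case False
    then have P: "P \<in> T" using that by simp
    have "a * ?v \<nu> P + ?v \<mu>' P \<simeq> 0 + b P" by (intro congr_add mult_congr_0(2) \<nu>(1) \<mu>' P)
    then show ?thesis unfolding lin by simp
  qed
  show ?case by (intro exI[of _ "\<lambda>s. a * \<nu> s + \<mu>' s"] ballI fin)
qed simp

sublocale ggs_field \<subseteq> weights q m
proof
  show "q \<ge> 2" by (rule q_ge)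
  show "m > 0" using m by (cases m) auto
  have "coprime (q ^ n + 1) (q ^ n)" by (simp only: coprime_Suc_left_nat Suc_eq_plus1[symmetric])
  then have "coprime (q ^ n + 1) q" using n_pos by (simp only: coprime_power_right_iff) simp
  then show "coprime m q" unfolding m[symmetric] by (simp only: coprime_mult_left_iff)
qed

lemma (in weights) conductor_eq: "conductor + q ^ 3 = (q\<^sup>2 - 1) * (q + 1) * m + 1"
proof -
  have "q ^ 3 \<le> (q\<^sup>2 - 1) * (q + 1) * 1"
  proof -
    have "(q\<^sup>2 - 1) * (q + 1) = q ^ 3 + q\<^sup>2 - (q + 1)"
      by (simp add: power2_eq_square power3_eq_cube algebra_simps)
    moreover have "q + 1 \<le> q\<^sup>2"
    proof -
      have "q * 2 \<le> q * q" using q_ge2 by (intro mult_le_mono2)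
      then show ?thesis using q_ge2 unfolding power2_eq_square by linarith
    qed
    ultimately show ?thesis by linarith
  qed
  also have "\<dots> \<le> (q\<^sup>2 - 1) * (q + 1) * m" using m_pos by (intro mult_le_mono2) simp
  finally show ?thesis unfolding conductor_def by simp
qed

text \<open>Complete fibres over a chosen set \<open>Zs\<close> are used, so that the length can be
  prescribed; \<open>pt\<close> numbers the points as code positions.\<close>

locale ggs_code = ggs_field I p r g q e n m for I :: "'a::comm_ring_1 set" and p r g q e n m +
  fixes Zs :: "'a set" and N :: nat and pt :: "nat \<Rightarrow> 'a \<times> 'a \<times> 'a"
  assumes Zs: "Zs \<subseteq> base_points" "Zs \<noteq> {}"
    and pt: "bij_betw pt {..<N} (SIGMA z:Zs. SIGMA y:fibre_y z. fibre_x y)"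
begin

definition cz :: "nat \<Rightarrow> 'a" where "cz P = fst (pt P)"
definition cy :: "nat \<Rightarrow> 'a" where "cy P = fst (snd (pt P))"
definition cx :: "nat \<Rightarrow> 'a" where "cx P = snd (snd (pt P))"

definition monomial :: "nat \<Rightarrow> nat \<Rightarrow> nat \<Rightarrow> nat \<Rightarrow> 'a" where
  "monomial i j k P = cx P ^ i * cy P ^ j * cz P ^ k"

definition pairing :: "(nat \<Rightarrow> 'a) \<Rightarrow> (nat \<Rightarrow> 'a) \<Rightarrow> 'a" where
  "pairing c f = (\<Sum>P<N. c P * f P)"

lemma finite_Zs: "finite Zs"
  using Zs(1) finite_subset[of Zs R] by (auto simp: base_points_def)

lemma finite_fibres: "finite (fibre_y z)" "finite (fibre_x y)"
  by (simp_all add: fibre_y_def fibre_x_def)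

lemma N_eq: "N = card Zs * q ^ 3"
proof -
  have "N = card (SIGMA z:Zs. SIGMA y:fibre_y z. fibre_x y)"
    using bij_betw_same_card[OF pt] by simp
  also have "\<dots> = (\<Sum>z\<in>Zs. \<Sum>y\<in>fibre_y z. card (fibre_x y))"
    using finite_Zs finite_fibres by (simp add: card_SigmaI)
  also have "\<dots> = (\<Sum>z\<in>Zs. \<Sum>y\<in>fibre_y z. q)"
    using Zs card_fibre_x by (intro sum.cong refl) auto
  also have "\<dots> = (\<Sum>z\<in>Zs. q\<^sup>2 * q)" using Zs card_fibre_y by (intro sum.cong refl) auto
  finally show ?thesis by (simp add: power3_eq_cube power2_eq_square)
qed

lemma pt_mem:
  assumes "P < N"
  shows "cz P \<in> Zs" "cy P \<in> fibre_y (cz P)" "cx P \<in> fibre_x (cy P)"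
proof -
  have "pt P \<in> (SIGMA z:Zs. SIGMA y:fibre_y z. fibre_x y)"
    using bij_betwE[OF pt] assms by simp
  then show "cz P \<in> Zs" "cy P \<in> fibre_y (cz P)" "cx P \<in> fibre_x (cy P)"
    unfolding cz_def cy_def cx_def by auto
qed

lemma pt_mem_R:
  assumes "P < N"
  shows "cz P \<in> R" "cy P \<in> R" "cx P \<in> R"
  using pt_mem[OF assms] Zs(1) by (auto simp: base_points_def fibre_y_def fibre_x_def)

lemma curve_x: "P < N \<Longrightarrow> cx P ^ q \<simeq> cy P ^ (q + 1) - cx P"
  using pt_mem(3)[of P] by (simp add: fibre_x_def congr_def algebra_simps)

lemma curve_y: "P < N \<Longrightarrow> cy P ^ (q\<^sup>2) \<simeq> cz P ^ m + cy P"
  using pt_mem(2)[of P] by (simp add: fibre_y_def congr_def algebra_simps)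

lemma pt_inj:
  assumes "P < N" "P' < N" "cx P = cx P'" "cy P = cy P'" "cz P = cz P'"
  shows "P = P'"
proof -
  have "pt P = pt P'" using assms unfolding cz_def cy_def cx_def by (simp add: prod_eq_iff)
  then show ?thesis using bij_betw_imp_inj_on[OF pt] assms by (auto dest: inj_onD)
qed

lemma pairing_congr: "(\<And>P. P < N \<Longrightarrow> f P \<simeq> h P) \<Longrightarrow> pairing c f \<simeq> pairing c h"
  unfolding pairing_def by (intro congr_sum congr_mult congr_refl) simp

lemma pairing_add: "pairing c (\<lambda>P. f P + h P) = pairing c f + pairing c h"
  unfolding pairing_def by (simp add: algebra_simps sum.distrib)

lemma pairing_diff: "pairing c (\<lambda>P. f P - h P) = pairing c f - pairing c h"
  unfolding pairing_def by (simp add: algebra_simps sum_subtractf)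

lemma reduce_x: "pairing c (monomial (i + q) j k) \<simeq> pairing c (monomial i (j + q + 1) k) - pairing c (monomial (i + 1) j k)"
proof -
  have "pairing c (monomial (i + q) j k) \<simeq> pairing c (\<lambda>P. monomial i (j + q + 1) k P - monomial (i + 1) j k P)"
  proof (rule pairing_congr)
    fix P assume P: "P < N"
    have "monomial (i + q) j k P = cx P ^ i * cy P ^ j * cz P ^ k * cx P ^ q"
      by (simp add: monomial_def power_add mult_ac)
    also have "\<dots> \<simeq> cx P ^ i * cy P ^ j * cz P ^ k * (cy P ^ (q + 1) - cx P)"
      by (intro congr_mult congr_refl curve_x P)
    also have "\<dots> = monomial i (j + q + 1) k P - monomial (i + 1) j k P"
      by (simp add: monomial_def power_add algebra_simps)
    finally show "monomial (i + q) j k P \<simeq> monomial i (j + q + 1) k P - monomial (i + 1) j k P" .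
  qed
  then show ?thesis by (simp only: pairing_diff)
qed

lemma reduce_y: "pairing c (monomial i (j + q\<^sup>2) k) \<simeq> pairing c (monomial i j (k + m)) + pairing c (monomial i (j + 1) k)"
proof -
  have "pairing c (monomial i (j + q\<^sup>2) k) \<simeq> pairing c (\<lambda>P. monomial i j (k + m) P + monomial i (j + 1) k P)"
  proof (rule pairing_congr)
    fix P assume P: "P < N"
    have "monomial i (j + q\<^sup>2) k P = cx P ^ i * cy P ^ j * cz P ^ k * cy P ^ (q\<^sup>2)"
      by (simp add: monomial_def power_add mult_ac)
    also have "\<dots> \<simeq> cx P ^ i * cy P ^ j * cz P ^ k * (cz P ^ m + cy P)"
      by (intro congr_mult congr_refl curve_y P)
    also have "\<dots> = monomial i j (k + m) P + monomial i (j + 1) k P"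
      by (simp add: monomial_def power_add algebra_simps)
    finally show "monomial i (j + q\<^sup>2) k P \<simeq> monomial i j (k + m) P + monomial i (j + 1) k P" .
  qed
  then show ?thesis by (simp only: pairing_add)
qed

lemma one_less_q_squared: "Suc 0 < q * q"
  using q2_ge by (simp add: power2_eq_square)

lemma wt_reduce_x: "wt (i + q) j k = wt i (j + q + 1) k" "wt (i + 1) j k < wt (i + q) j k"
  using q_ge m_pos one_less_q_squared by (simp_all add: wt_def algebra_simps)

lemma wt_reduce_y: "wt i (j + q\<^sup>2) k = wt i j (k + m)" "wt i (j + 1) k < wt i (j + q\<^sup>2) k"
  using q_ge m_pos one_less_q_squared by (simp_all add: wt_def algebra_simps power2_eq_square power3_eq_cube)

text \<open>Replacing \<open>x ^ q\<close> and \<open>y ^ q\<^sup>2\<close> by the curve equations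
  gives one term of the same weight and one of smaller weight, which pairs to 0. Each replacement
  lowers \<open>i\<close> by \<open>q\<close> or, once \<open>i < q\<close>, lowers \<open>j\<close>
  by \<open>q\<^sup>2\<close>.\<close>

lemma reduce:
  assumes V: "\<And>i j k. wt i j k < w \<Longrightarrow> pairing c (monomial i j k) \<simeq> 0" and w: "wt i j k = w"
  shows "\<exists>i' j' k'. i' < q \<and> j' < q\<^sup>2 \<and> wt i' j' k' = w \<and> pairing c (monomial i j k) \<simeq> pairing c (monomial i' j' k')"
  using w
proof (induction i arbitrary: j k rule: less_induct)
  case (less i)
  show ?case
  proof (cases "i < q")
    case False
    then obtain i0 where i0: "i = i0 + q" using that[of "i - q"] by simp
    have w0: "wt i0 (j + q + 1) k = w" using less.prems wt_reduce_x(1) i0 by simp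
    have "i0 < i" using i0 q_ge by simp
    then obtain i' j' k' where ijk: "i' < q" "j' < q\<^sup>2" "wt i' j' k' = w"
      "pairing c (monomial i0 (j + q + 1) k) \<simeq> pairing c (monomial i' j' k')"
      using less.IH w0 by blast
    have "pairing c (monomial (i0 + 1) j k) \<simeq> 0"
      using wt_reduce_x(2)[of i0 j k] less.prems i0 by (intro V) simp
    have "pairing c (monomial i j k) \<simeq> pairing c (monomial i0 (j + q + 1) k) - pairing c (monomial (i0 + 1) j k)"
      unfolding i0 by (rule reduce_x)
    also have "\<dots> \<simeq> pairing c (monomial i' j' k') - 0" by (intro congr_diff) fact+
    finally show ?thesis using ijk by auto
  next
    case True
    show ?thesis using less.prems
    proof (induction j arbitrary: k rule: less_induct)
      case (less j)
      show ?case
      proof (cases "j < q\<^sup>2")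
        case jj: True
        then show ?thesis using True less.prems by (intro exI[of _ i] exI[of _ j] exI[of _ k]) simp
      next
        case False
        then obtain j0 where j0: "j = j0 + q\<^sup>2" using that[of "j - q\<^sup>2"] by simp
        have w0: "wt i j0 (k + m) = w" using less.prems wt_reduce_y(1) j0 by simp
        have "j0 < j" using j0 q_ge by simp
        then obtain i' j' k' where ijk: "i' < q" "j' < q\<^sup>2" "wt i' j' k' = w"
          "pairing c (monomial i j0 (k + m)) \<simeq> pairing c (monomial i' j' k')"
          using less.IH w0 by blast
        have "pairing c (monomial i (j0 + 1) k) \<simeq> 0"
          using wt_reduce_y(2)[of i j0 k] less.prems j0 by (intro V) simp
        have "pairing c (monomial i j k) \<simeq> pairing c (monomial i j0 (k + m)) + pairing c (monomial i (j0 + 1) k)"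
          unfolding j0 by (rule reduce_y)
        also have "\<dots> \<simeq> pairing c (monomial i' j' k') + 0" by (intro congr_add) fact+
        finally show ?thesis using ijk by auto
      qed
    qed
  qed
qed

definition red :: "nat \<Rightarrow> nat \<Rightarrow> 'a" where
  "red s = (SOME f. \<exists>i j k. i < q \<and> j < q\<^sup>2 \<and> wt i j k = s \<and> f = monomial i j k)"

lemma red_eq:
  assumes "i < q" "j < q\<^sup>2"
  shows "red (wt i j k) = monomial i j k"
  unfolding red_def
proof (rule some_equality)
  show "\<exists>i' j' k'. i' < q \<and> j' < q\<^sup>2 \<and> wt i' j' k' = wt i j k \<and> monomial i j k = monomial i' j' k'"
    using assms by blast
next
  fix f assume "\<exists>i' j' k'. i' < q \<and> j' < q\<^sup>2 \<and> wt i' j' k' = wt i j k \<and> f = monomial i' j' k'"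
  then obtain i' j' k' where *: "i' < q" "j' < q\<^sup>2" "wt i' j' k' = wt i j k" and f: "f = monomial i' j' k'" by blast
  have "i' = i \<and> j' = j \<and> k' = k" by (rule wt_unique[OF *(1) assms(1) *(2) assms(2) *(3)])
  then show "f = monomial i j k" unfolding f by simp
qed

lemma red_mono: "s \<in> S \<Longrightarrow> \<exists>i j k. wt i j k = s \<and> red s = monomial i j k"
  unfolding S_def using red_eq by blast

lemma reduce_red:
  assumes "\<And>i j k. wt i j k < w \<Longrightarrow> pairing c (monomial i j k) \<simeq> 0" and "wt i j k = w"
  shows "w \<in> S \<and> pairing c (monomial i j k) \<simeq> pairing c (red w)"
proof -
  have "\<exists>i' j' k'. i' < q \<and> j' < q\<^sup>2 \<and> wt i' j' k' = w \<and> pairing c (monomial i j k) \<simeq> pairing c (monomial i' j' k')"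
    by (rule reduce[OF assms])
  then obtain i' j' k' where *: "i' < q" "j' < q\<^sup>2" "wt i' j' k' = w"
    "pairing c (monomial i j k) \<simeq> pairing c (monomial i' j' k')" by blast
  then have "red w = monomial i' j' k'" using red_eq by blast
  then show ?thesis using * unfolding S_def by auto
qed

lemma pairing_mono_0:
  assumes "\<And>s. s \<in> S \<Longrightarrow> s < M \<Longrightarrow> pairing c (red s) \<simeq> 0" and "wt i j k < M"
  shows "pairing c (monomial i j k) \<simeq> 0"
  using assms(2)
proof (induction "wt i j k" arbitrary: i j k rule: less_induct)
  case less
  have "wt i j k \<in> S \<and> pairing c (monomial i j k) \<simeq> pairing c (red (wt i j k))"
    by (rule reduce_red) (use less in \<open>simp_all\<close>)
  then show ?case using assms(1)[of "wt i j k"] less.prems congr_trans by blast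
qed

lemma mono_mult: "monomial i j k P * monomial i' j' k' P = monomial (i + i') (j + j') (k + k') P"
  unfolding monomial_def by (simp add: power_add mult_ac)

lemma wt_add: "wt i j k + wt i' j' k' = wt (i + i') (j + j') (k + k')"
  unfolding wt_def by (simp add: algebra_simps)

lemma red_mult:
  assumes "s \<in> S" "s' \<in> S"
  shows "\<exists>i j k. wt i j k = s + s' \<and> (\<forall>P. red s P * red s' P = monomial i j k P)"
proof -
  obtain i j k i' j' k' where "wt i j k = s" "red s = monomial i j k" "wt i' j' k' = s'" "red s' = monomial i' j' k'"
    using red_mono assms by metis
  then show ?thesis using mono_mult wt_add by metis
qed

end

section \<open>Separation of points, the Feng--Rao bound and residues\<close>

context ggs_code
begin

text \<open>
  Linear combinations of evaluations of monomials separate the points: the function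
  \<open>(1 - (cx - a) ^ (r - 1)) * (1 - (cy - b) ^ (r - 1)) * (1 - (cz - c) ^ (r - 1))\<close> is the indicator
  of \<open>(a, b, c)\<close>.
\<close>

definition annihilates :: "(nat \<Rightarrow> 'a) \<Rightarrow> (nat \<Rightarrow> 'a) \<Rightarrow> bool" where
  "annihilates c f \<longleftrightarrow> (\<forall>i j k. pairing c (\<lambda>P. f P * monomial i j k P) \<simeq> 0)"

lemma annihilates_diff: "annihilates c f \<Longrightarrow> annihilates c h \<Longrightarrow> annihilates c (\<lambda>P. f P - h P)"
  unfolding annihilates_def left_diff_distrib pairing_diff using congr_diff[of _ 0 _ 0] by simp

lemma annihilates_scale: "annihilates c f \<Longrightarrow> annihilates c (\<lambda>P. a * f P)"
proof -
  assume f: "annihilates c f"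
  have "pairing c (\<lambda>P. a * f P * monomial i j k P) = a * pairing c (\<lambda>P. f P * monomial i j k P)" for i j k
    unfolding pairing_def by (simp add: sum_distrib_left mult_ac)
  then show ?thesis using f unfolding annihilates_def by (simp add: mult_congr_0(2))
qed

lemma annihilates_coordinate:
  assumes "annihilates c f"
  shows "annihilates c (\<lambda>P. cx P * f P)" "annihilates c (\<lambda>P. cy P * f P)" "annihilates c (\<lambda>P. cz P * f P)"
proof -
  have "cx P * f P * monomial i j k P = f P * monomial (Suc i) j k P"
    "cy P * f P * monomial i j k P = f P * monomial i (Suc j) k P"
    "cz P * f P * monomial i j k P = f P * monomial i j (Suc k) P" for i j k P
    unfolding monomial_def by (simp_all add: mult_ac)
  then show "annihilates c (\<lambda>P. cx P * f P)" "annihilates c (\<lambda>P. cy P * f P)" "annihilates c (\<lambda>P. cz P * f P)"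
    using assms unfolding annihilates_def by simp_all
qed

lemma annihilates_indicator:
  assumes h: "\<And>f. annihilates c f \<Longrightarrow> annihilates c (\<lambda>P. h P * f P)" and f: "annihilates c f"
  shows "annihilates c (\<lambda>P. (1 - (h P - a) ^ t) * f P)"
proof -
  have "annihilates c (\<lambda>P. (h P - a) ^ t * f P)" for t
  proof (induction t)
    case (Suc t)
    have "annihilates c (\<lambda>P. h P * ((h P - a) ^ t * f P) - a * ((h P - a) ^ t * f P))"
      by (intro annihilates_diff annihilates_scale h Suc)
    then show ?case by (simp add: algebra_simps)
  qed (use f in simp)
  then have "annihilates c (\<lambda>P. f P - (h P - a) ^ t * f P)" by (intro annihilates_diff f)
  then show ?thesis by (simp add: algebra_simps)
qed

lemma indicator_congr:
  assumes "a \<in> R" "b \<in> R"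
  shows "1 - (a - b) ^ (r - 1) \<simeq> (if a = b then 1 else 0)"
proof (cases "a = b")
  case False
  then have "\<not> a - b \<simeq> 0" using R_inj[OF assms] congr_0_iff_diff by blast
  have "(a - b) ^ (r - 1) * (a - b) = (a - b) ^ r" using r_ge by (intro power_minus_mult) simp
  then have "(a - b) ^ (r - 1) * (a - b) \<simeq> 1 * (a - b)" using power_r[of "a - b"] by simp
  then have "(a - b) ^ (r - 1) \<simeq> 1" using \<open>\<not> a - b \<simeq> 0\<close> by (rule mult_cancel)
  then have "1 - (a - b) ^ (r - 1) \<simeq> 1 - 1" by (intro congr_diff congr_refl)
  then show ?thesis using False by simp
qed (use r_ge in \<open>simp add: power_0_left\<close>)

lemma separation:
  assumes all: "\<And>i j k. pairing c (monomial i j k) \<simeq> 0" and P: "P < N"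
  shows "c P \<simeq> 0"
proof -
  let ?d = "\<lambda>h P'. 1 - (h P' - h P) ^ (r - 1)"
  define f where "f = (\<lambda>P'. ?d cx P' * (?d cy P' * (?d cz P' * 1)))"
  have "annihilates c (\<lambda>_. 1)" unfolding annihilates_def using all by simp
  then have "annihilates c f"
    unfolding f_def by (intro annihilates_indicator annihilates_coordinate)
  then have "pairing c (\<lambda>P'. f P' * monomial 0 0 0 P') \<simeq> 0" unfolding annihilates_def by blast
  then have "pairing c f \<simeq> 0" unfolding monomial_def by simp
  have fP: "f P' \<simeq> (if P' = P then 1 else 0)" if P': "P' < N" for P'
  proof -
    have "f P' \<simeq> (if cx P' = cx P then 1 else 0) * ((if cy P' = cy P then 1 else 0) * ((if cz P' = cz P then 1 else 0) * 1))"
      unfolding f_def by (intro congr_mult indicator_congr pt_mem_R P P' congr_refl)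
    also have "\<dots> = (if P' = P then 1 else 0)" using pt_inj[OF P' P] by auto
    finally show ?thesis .
  qed
  have "pairing c f \<simeq> pairing c (\<lambda>P'. if P' = P then 1 else 0)" by (rule pairing_congr) (rule fP)
  also have "\<dots> = (\<Sum>P'<N. if P' = P then c P else 0)" unfolding pairing_def by (intro sum.cong) auto
  also have "\<dots> = c P" using P by simp
  finally have "c P \<simeq> pairing c f" by (rule congr_sym)
  also have "\<dots> \<simeq> 0" by fact
  finally show ?thesis .
qed

text \<open>
  The Feng--Rao bound: if \<open>w\<close> is the smallest weight of a monomial that does not annihilate \<open>c\<close>,
  then the matrix with entries \<open>\<Sum>P. c P * red a P * red b P\<close> is triangular with respect to
  \<open>a + b = w\<close>, while its rank is at most the Hamming weight of \<open>c\<close>.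
\<close>

lemma feng_rao:
  assumes orth: "\<And>s. s \<in> S \<Longrightarrow> s < M \<Longrightarrow> pairing c (red s) \<simeq> 0"
    and M: "l \<le> card (S \<inter> {..<M})"
    and supp: "T \<subseteq> {..<N}" "\<And>P. P < N \<Longrightarrow> P \<notin> T \<Longrightarrow> c P \<simeq> 0" "card T + card (- S) \<le> l"
    and P: "P < N"
  shows "c P \<simeq> 0"
proof (rule ccontr)
  assume "\<not> c P \<simeq> 0"
  then obtain i0 j0 k0 where "\<not> pairing c (monomial i0 j0 k0) \<simeq> 0" using separation[OF _ P] by blast
  then have ex: "\<exists>w. \<exists>i j k. wt i j k = w \<and> \<not> pairing c (monomial i j k) \<simeq> 0" by blast
  define w where "w = (LEAST w. \<exists>i j k. wt i j k = w \<and> \<not> pairing c (monomial i j k) \<simeq> 0)"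
  obtain i j k where ijk: "wt i j k = w" "\<not> pairing c (monomial i j k) \<simeq> 0"
    using LeastI_ex[OF ex] unfolding w_def by blast
  have below: "pairing c (monomial i j k) \<simeq> 0" if "wt i j k < w" for i j k
    using not_less_Least[of "wt i j k" "\<lambda>w. \<exists>i j k. wt i j k = w \<and> \<not> pairing c (monomial i j k) \<simeq> 0"] that
    unfolding w_def by blast
  have wS: "w \<in> S" and wred: "\<not> pairing c (red w) \<simeq> 0"
    using reduce_red[OF below ijk(1)] ijk(2) congr_trans by blast+
  have at_w: "\<not> pairing c (monomial i j k) \<simeq> 0" if "wt i j k = w" for i j k
    using reduce_red[OF below that] wred congr_trans congr_sym by blast
  \<comment> \<open>Orthogonality to the first pole orders pushes \<open>w\<close> beyond
    \<open>M\<close>, so at least \<open>l\<close> pole orders lie below \<open>w\<close>, and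
    \<open>\<Lambda>\<close> will be larger than \<open>T\<close>.\<close>
  have "M \<le> w"
  proof (rule ccontr)
    assume "\<not> M \<le> w"
    then show False using pairing_mono_0[of M c, OF orth] ijk by simp
  qed
  then have "S \<inter> {..<M} \<subseteq> S \<inter> {..<w}" by auto
  then have "card (S \<inter> {..<M}) \<le> card (S \<inter> {..<w})" by (intro card_mono) auto
  then have "l \<le> card (S \<inter> {..<w})" using M by simp
  define \<Lambda> where "\<Lambda> = {a\<in>S. a \<le> w \<and> w - a \<in> S}"
  have "l + 1 \<le> card \<Lambda> + card (- S)" unfolding \<Lambda>_def by (rule card_summands) fact+
  then have cT: "card T < card \<Lambda>" using supp(3) by simp
  have fin: "finite T" "finite \<Lambda>"
    using supp(1) finite_subset[of \<Lambda> "{..w}"] finite_subset[of T "{..<N}"] unfolding \<Lambda>_def by auto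
  have prime: "a \<in> I \<or> b \<in> I" if "a * b \<in> I" for a b
    using that by (simp only: mem_iff mult_congr_0_iff)
  \<comment> \<open>There are more functions \<open>red a\<close> than positions in
    \<open>T\<close>, so a combination that is nonzero modulo \<open>I\<close> vanishes throughout
    \<open>T\<close>.\<close>
  obtain x where x: "\<exists>a\<in>\<Lambda>. x a \<notin> I" "\<forall>P\<in>T. (\<Sum>a\<in>\<Lambda>. x a * red a P) \<in> I"
    using underdetermined_system[of I, OF zero_mem add_mem mult_mem prime one_mem fin cT, of red] by blast
  define A where "A = {a\<in>\<Lambda>. \<not> x a \<simeq> 0}"
  define a where "a = Max A"
  have A: "finite A" "A \<noteq> {}" using x(1) fin unfolding A_def by (auto simp: mem_iff)
  have a: "a \<in> \<Lambda>" "\<not> x a \<simeq> 0" using Max_in[OF A] unfolding a_def A_def by auto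
  have above: "x a' \<simeq> 0" if "a' \<in> \<Lambda>" "a' > a" for a'
  proof (rule ccontr)
    assume "\<not> x a' \<simeq> 0"
    then have "a' \<in> A" using that(1) unfolding A_def by simp
    then have "a' \<le> a" unfolding a_def by (rule Max_ge[OF A(1)])
    then show False using that(2) by simp
  qed
  \<comment> \<open>The partner of the largest index with a nonzero coefficient. After
    multiplication by \<open>red b\<close> the terms with smaller index have weight below
    \<open>w\<close> and pair to 0; only the term of \<open>a\<close> is left.\<close>
  define b where "b = w - a"
  have ab: "a \<in> S" "b \<in> S" "a + b = w" using a(1) unfolding b_def \<Lambda>_def by auto
  have "pairing c (\<lambda>P. (\<Sum>a\<in>\<Lambda>. x a * red a P) * red b P) \<simeq> 0"
    unfolding pairing_def
  proof (rule sum_congr_0)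
    fix P assume "P \<in> {..<N}"
    then consider "P \<in> T" | "c P \<simeq> 0" using supp(2) by auto
    then show "c P * ((\<Sum>a\<in>\<Lambda>. x a * red a P) * red b P) \<simeq> 0"
    proof cases
      case 1
      then have "(\<Sum>a\<in>\<Lambda>. x a * red a P) \<simeq> 0" using x(2) by (simp add: mem_iff)
      then show ?thesis by (intro mult_congr_0(2) mult_congr_0(1))
    qed (rule mult_congr_0(1))
  qed
  moreover have "pairing c (\<lambda>P. (\<Sum>a\<in>\<Lambda>. x a * red a P) * red b P)
      = (\<Sum>a'\<in>\<Lambda>. x a' * pairing c (\<lambda>P. red a' P * red b P))"
    unfolding pairing_def sum_distrib_left sum_distrib_right by (subst sum.swap) (simp add: mult_ac)
  moreover have "(\<Sum>a'\<in>\<Lambda>. x a' * pairing c (\<lambda>P. red a' P * red b P))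
      = x a * pairing c (\<lambda>P. red a P * red b P) + (\<Sum>a'\<in>\<Lambda> - {a}. x a' * pairing c (\<lambda>P. red a' P * red b P))"
    using fin(2) a(1) by (rule sum.remove)
  moreover have "(\<Sum>a'\<in>\<Lambda> - {a}. x a' * pairing c (\<lambda>P. red a' P * red b P)) \<simeq> 0"
  proof (rule sum_congr_0)
    fix a' assume a': "a' \<in> \<Lambda> - {a}"
    show "x a' * pairing c (\<lambda>P. red a' P * red b P) \<simeq> 0"
    proof (cases "a' > a")
      case True
      then show ?thesis using above a' by (intro mult_congr_0(1)) simp
    next
      case False
      then have "a' + b < w" using a' ab(3) by simp
      moreover have "a' \<in> S" using a' unfolding \<Lambda>_def by simp
      then obtain i j k where "wt i j k = a' + b" "\<forall>P. red a' P * red b P = monomial i j k P"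
        using red_mult[OF _ ab(2)] by blast
      ultimately have "pairing c (\<lambda>P. red a' P * red b P) \<simeq> 0" using below[of i j k] by simp
      then show ?thesis by (rule mult_congr_0(2))
    qed
  qed
  ultimately have "x a * pairing c (\<lambda>P. red a P * red b P) \<simeq> 0"
    using congr_diff[of "x a * pairing c (\<lambda>P. red a P * red b P) + (\<Sum>a'\<in>\<Lambda> - {a}. x a' * pairing c (\<lambda>P. red a' P * red b P))" 0
      "\<Sum>a'\<in>\<Lambda> - {a}. x a' * pairing c (\<lambda>P. red a' P * red b P)" 0] by simp
  moreover obtain i j k where "wt i j k = w" "\<forall>P. red a P * red b P = monomial i j k P"
    using red_mult[OF ab(1,2)] ab(3) by auto
  then have "\<not> pairing c (\<lambda>P. red a P * red b P) \<simeq> 0" using at_w[of i j k] by simp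
  ultimately show False using a(2) by (simp add: mult_congr_0_iff)
qed

text \<open>There are \<open>card Zs - 1\<close> equations in \<open>card Zs\<close> unknowns. If
  \<open>v z1\<close> were 0, testing against the polynomial of degree \<open>card Zs - 2\<close>
  that vanishes on the rest of \<open>Zs\<close> except \<open>z0\<close> would give
  \<open>v z0 = 0\<close>.\<close>

lemma ex_weights_Zs:
  "\<exists>v. (\<forall>z\<in>Zs. \<not> v z \<simeq> 0) \<and> (\<forall>k. k + 1 < card Zs \<longrightarrow> (\<Sum>z\<in>Zs. v z * z ^ k) \<simeq> 0)"
proof -
  have prime: "a \<in> I \<or> b \<in> I" if "a * b \<in> I" for a b
    using that by (simp only: mem_iff mult_congr_0_iff)
  have "card {..<card Zs - 1} < card Zs" using Zs(2) finite_Zs by (simp add: card_gt_0_iff)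
  then obtain v where v: "\<exists>z\<in>Zs. v z \<notin> I" "\<forall>k\<in>{..<card Zs - 1}. (\<Sum>z\<in>Zs. v z * z ^ k) \<in> I"
    using underdetermined_system[of I, OF zero_mem add_mem mult_mem prime one_mem finite_lessThan finite_Zs, of "card Zs - 1" "\<lambda>z k. z ^ k"]
    by blast
  obtain z0 where z0: "z0 \<in> Zs" "\<not> v z0 \<simeq> 0" using v(1) by (auto simp: mem_iff)
  have v2: "(\<Sum>z\<in>Zs. v z * z ^ k) \<simeq> 0" if "k + 1 < card Zs" for k
    using v(2) that by (simp add: mem_iff)
  have prods: "(\<Sum>z\<in>Zs. v z * (\<Prod>t\<in>T. z - t) * z ^ k) \<simeq> 0" if "finite T" "card T + k + 1 < card Zs" for T k
    using that
  proof (induction T arbitrary: k rule: finite_induct)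
    case (insert t T)
    have "(\<Sum>z\<in>Zs. v z * (\<Prod>t\<in>insert t T. z - t) * z ^ k) =
        (\<Sum>z\<in>Zs. v z * (\<Prod>t\<in>T. z - t) * z ^ Suc k) - t * (\<Sum>z\<in>Zs. v z * (\<Prod>t\<in>T. z - t) * z ^ k)"
      using insert.hyps by (simp add: algebra_simps sum_subtractf sum_distrib_left)
    also have "\<dots> \<simeq> 0 - 0"
      using insert by (intro congr_diff mult_congr_0(2) insert.IH) simp_all
    finally show ?case by simp
  qed (use v2 in simp)
  have "\<not> v z1 \<simeq> 0" if z1: "z1 \<in> Zs" for z1
  proof
    assume v1: "v z1 \<simeq> 0"
    then have ne: "z1 \<noteq> z0" using z0 by blast
    define T where "T = Zs - {z0, z1}"
    have T: "finite T" "Zs = insert z0 (insert z1 T)" "z0 \<notin> insert z1 T" "z1 \<notin> T"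
      using finite_Zs z0 z1 ne unfolding T_def by auto
    have "card Zs = card T + 2" using T by simp
    then have s0: "(\<Sum>z\<in>Zs. v z * (\<Prod>t\<in>T. z - t) * z ^ 0) \<simeq> 0" using T by (intro prods) auto
    have "(\<Sum>z\<in>T. v z * (\<Prod>t\<in>T. z - t)) = (\<Sum>z\<in>T. 0)"
    proof (rule sum.cong[OF refl])
      fix z assume "z \<in> T"
      then have "(\<Prod>t\<in>T. z - t) = 0"
        using T(1) by (simp add: prod.remove[of T z])
      then show "v z * (\<Prod>t\<in>T. z - t) = 0" by simp
    qed
    then have "(\<Sum>z\<in>Zs. v z * (\<Prod>t\<in>T. z - t) * z ^ 0) = v z0 * (\<Prod>t\<in>T. z0 - t) + v z1 * (\<Prod>t\<in>T. z1 - t)"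
      unfolding T(2) using T by simp
    then have "v z0 * (\<Prod>t\<in>T. z0 - t) + v z1 * (\<Prod>t\<in>T. z1 - t) \<simeq> 0" using s0 by simp
    from congr_diff[OF this mult_congr_0(1)[OF v1, of "\<Prod>t\<in>T. z1 - t"]]
    have "v z0 * (\<Prod>t\<in>T. z0 - t) \<simeq> 0" by simp
    then have "(\<Prod>t\<in>T. z0 - t) \<simeq> 0" using z0(2) by (simp add: mult_congr_0_iff)
    then obtain t where t: "t \<in> T" "z0 - t \<simeq> 0" using prod_congr_0_iff[OF T(1)] by blast
    have "z0 \<in> R" "t \<in> R" using z0(1) t(1) Zs(1) unfolding T_def base_points_def by auto
    then have "z0 = t" using R_inj t(2) congr_0_iff_diff by blast
    then show False using T(3) t(1) by blast
  qed
  then show ?thesis using v2 by blast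
qed

lemma sum_points: "(\<Sum>P<N. f (cz P) (cy P) (cx P)) = (\<Sum>z\<in>Zs. \<Sum>y\<in>fibre_y z. \<Sum>x\<in>fibre_x y. f z y x)"
proof -
  have "(\<Sum>P<N. f (cz P) (cy P) (cx P)) = (\<Sum>P<N. (\<lambda>(z, y, x). f z y x) (pt P))"
    unfolding cz_def cy_def cx_def by (simp add: split_def)
  also have "\<dots> = (\<Sum>(z, y, x)\<in>(SIGMA z:Zs. SIGMA y:fibre_y z. fibre_x y). f z y x)"
    by (rule sum.reindex_bij_betw[OF pt])
  also have "\<dots> = (\<Sum>z\<in>Zs. \<Sum>(y, x)\<in>(SIGMA y:fibre_y z. fibre_x y). f z y x)"
    using finite_Zs finite_fibres by (subst sum.Sigma) (auto simp: split_def)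
  also have "\<dots> = (\<Sum>z\<in>Zs. \<Sum>y\<in>fibre_y z. \<Sum>x\<in>fibre_x y. f z y x)"
    using finite_fibres by (intro sum.cong refl) (subst sum.Sigma, auto)
  finally show ?thesis .
qed

text \<open>
  The weights \<open>v\<close> are the residues of the differential \<open>dz / h(z)\<close>, where \<open>h\<close> vanishes on
  \<open>Zs\<close>; summing over the fibres of \<open>z\<close> amounts to taking traces.
\<close>

lemma weighted_sum_reduced:
  assumes v: "\<And>k. k + 1 < card Zs \<Longrightarrow> (\<Sum>z\<in>Zs. v z * z ^ k) \<simeq> 0"
    and ij: "i < q" "j < q\<^sup>2" and k: "i = q - 1 \<Longrightarrow> j = q\<^sup>2 - 1 \<Longrightarrow> k + 1 < card Zs"
  shows "pairing (\<lambda>P. v (cz P)) (monomial i j k) \<simeq> 0"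
proof -
  \<comment> \<open>The traces of \<open>x ^ i\<close> and \<open>y ^ j\<close> along the two steps
    of the tower: constant over all fibres, and 0 unless the exponent is maximal.\<close>
  define Cx where "Cx = (if i = q - 1 then (\<Sum>b\<in>{b\<in>R. b ^ q + 1 * b \<simeq> 0}. b ^ (q - 1)) else 0)"
  define Cy where "Cy = (if j = q\<^sup>2 - 1 then (\<Sum>b\<in>{b\<in>R. b ^ (q\<^sup>2) + (- 1) * b \<simeq> 0}. b ^ (q\<^sup>2 - 1)) else 0)"
  have sx: "(\<Sum>x\<in>fibre_x y. x ^ i) \<simeq> Cx" if zy: "z \<in> Zs" "y \<in> fibre_y z" for z y
  proof -
    have "z \<in> base_points" using Zs(1) zy(1) by blast
    then obtain x where x: "x ^ q + 1 * x \<simeq> y ^ (q + 1)" using fibre_x_solution zy(2) by blast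
    have "i \<le> q - 1" using ij by simp
    then show ?thesis unfolding fibre_x_def Cx_def
      by (rule power_sum_solutions[OF q(1) q_ge dvd_r_minus_1(1) card_kernel_x x])
  qed
  have sy: "(\<Sum>y\<in>fibre_y z. y ^ j) \<simeq> Cy" if "z \<in> Zs" for z
  proof -
    have "z \<in> base_points" using Zs(1) that(1) by blast
    then obtain y where y: "y ^ (q\<^sup>2) + (- 1) * y \<simeq> z ^ m" using fibre_y_solution by blast
    have "j \<le> q\<^sup>2 - 1" using ij by simp
    then show ?thesis unfolding fibre_y_def Cy_def
      by (rule power_sum_solutions[OF q2_def q2_ge dvd_r_minus_1(2) card_kernel_y y])
  qed
  have "pairing (\<lambda>P. v (cz P)) (monomial i j k) = (\<Sum>P<N. v (cz P) * (cx P ^ i * cy P ^ j * cz P ^ k))"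
    unfolding pairing_def monomial_def ..
  also have "\<dots> = (\<Sum>z\<in>Zs. \<Sum>y\<in>fibre_y z. \<Sum>x\<in>fibre_x y. v z * (x ^ i * y ^ j * z ^ k))"
    by (rule sum_points)
  also have "\<dots> = (\<Sum>z\<in>Zs. v z * z ^ k * (\<Sum>y\<in>fibre_y z. y ^ j * (\<Sum>x\<in>fibre_x y. x ^ i)))"
    by (simp add: sum_distrib_left mult_ac)
  also have "\<dots> \<simeq> (\<Sum>z\<in>Zs. v z * z ^ k * (\<Sum>y\<in>fibre_y z. y ^ j * Cx))"
    by (intro congr_sum congr_mult congr_refl sx)
  also have "\<dots> = (\<Sum>z\<in>Zs. v z * z ^ k * ((\<Sum>y\<in>fibre_y z. y ^ j) * Cx))"
    by (simp add: sum_distrib_right)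
  also have "\<dots> \<simeq> (\<Sum>z\<in>Zs. v z * z ^ k * (Cy * Cx))"
    by (intro congr_sum congr_mult congr_refl sy)
  also have "\<dots> = (Cy * Cx) * (\<Sum>z\<in>Zs. v z * z ^ k)"
    by (simp add: sum_distrib_left mult_ac)
  also have "\<dots> \<simeq> 0"
  proof (cases "i = q - 1 \<and> j = q\<^sup>2 - 1")
    case True
    then show ?thesis using v k by (intro mult_congr_0(2)) blast
  next
    case False
    then have "Cy * Cx = 0" unfolding Cx_def Cy_def by auto
    then show ?thesis by simp
  qed
  finally show ?thesis .
qed

text \<open>Only normal forms with both exponents maximal can contribute, and for them
  \<open>k\<close> has to reach \<open>card Zs - 1\<close>. The smallest such weight is
  \<open>N + conductor - 1\<close>.\<close>

lemma weighted_sum_0: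
  assumes v: "\<And>k. k + 1 < card Zs \<Longrightarrow> (\<Sum>z\<in>Zs. v z * z ^ k) \<simeq> 0"
    and w: "wt i j k + 1 < N + conductor"
  shows "pairing (\<lambda>P. v (cz P)) (monomial i j k) \<simeq> 0"
proof (rule pairing_mono_0)
  show "wt i j k < N + conductor - 1" using w by simp
  fix s assume s: "s \<in> S" "s < N + conductor - 1"
  obtain i' j' k' where ijk: "i' < q" "j' < q\<^sup>2" "s = wt i' j' k'" using s(1) unfolding S_def by blast
  have "k' + 1 < card Zs" if "i' = q - 1" "j' = q\<^sup>2 - 1"
  proof -
    have "(q - 1) * (q + 1) = q\<^sup>2 - 1" using q_ge by (simp add: power2_eq_square algebra_simps)
    then have "(q - 1) * (q + 1) + (q\<^sup>2 - 1) * q = (q\<^sup>2 - 1) * (q + 1)" by simp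
    then have "s = (q\<^sup>2 - 1) * (q + 1) * m + k' * q ^ 3"
      unfolding ijk(3) that wt_def by (simp only:)
    then have "k' * q ^ 3 + q ^ 3 < card Zs * q ^ 3" using s(2) conductor_eq unfolding N_eq by linarith
    then have "(k' + 1) * q ^ 3 < card Zs * q ^ 3" by (simp add: algebra_simps)
    then show ?thesis by (simp only: mult_less_cancel2)
  qed
  then show "pairing (\<lambda>P. v (cz P)) (red s) \<simeq> 0"
    unfolding ijk(3) red_eq[OF ijk(1,2)] by (intro weighted_sum_reduced v ijk) auto
qed

end

section \<open>Field elements as letters of the alphabet\<close>

context finite_residue_field
begin

definition dec :: "nat \<Rightarrow> 'a" where
  "dec = (SOME f. bij_betw f {..<r} R)"

definition enc :: "'a \<Rightarrow> nat" where
  "enc a = inv_into {..<r} dec (rep a)"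

lemma bij_dec: "bij_betw dec {..<r} R"
proof -
  have "\<exists>f. bij_betw f {..<r} R"
    using ex_bij_betw_nat_finite[OF finite_R] by (simp add: card_R atLeast0LessThan)
  then show ?thesis unfolding dec_def by (rule someI_ex)
qed

lemma enc_less: "enc a < r"
  using inv_into_into[of "rep a" dec "{..<r}"] bij_dec rep_R[of a] unfolding enc_def bij_betw_def by simp

lemma dec_enc: "dec (enc a) \<simeq> a"
proof -
  have "dec (enc a) = rep a"
    unfolding enc_def using bij_dec rep_R[of a] by (intro f_inv_into_f) (simp add: bij_betw_def)
  then show ?thesis using rep_congr by simp
qed

lemma dec_inj:
  assumes "i < r" "j < r" "dec i \<simeq> dec j"
  shows "i = j"
proof -
  have "dec i = dec j" using R_inj assms bij_betwE[OF bij_dec] by simp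
  then show ?thesis using bij_betw_imp_inj_on[OF bij_dec] assms by (simp add: inj_on_def)
qed

definition encode :: "nat \<Rightarrow> (nat \<Rightarrow> 'a) \<Rightarrow> nat \<Rightarrow> nat" where
  "encode N f = restrict (\<lambda>P. enc (f P)) {..<N}"

lemma encode_words: "encode N f \<in> words r N"
  unfolding encode_def words_def using enc_less by auto

lemma dec_encode: "P < N \<Longrightarrow> dec (encode N f P) \<simeq> f P"
  unfolding encode_def using dec_enc by simp

lemma words_congr_eq:
  assumes "u \<in> words r N" "w \<in> words r N" "\<And>P. P < N \<Longrightarrow> dec (u P) \<simeq> dec (w P)"
  shows "u = w"
proof (rule words_eqI[OF assms(1,2)])
  fix P assume "P < N"
  then show "u P = w P" using dec_inj assms words_less by blast
qed

end

section \<open>The quantum code of the curve\<close>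

context ggs_code
begin

lemma pairing_congr_left: "(\<And>P. P < N \<Longrightarrow> c P \<simeq> d P) \<Longrightarrow> pairing c f \<simeq> pairing d f"
  unfolding pairing_def by (intro congr_sum congr_mult congr_refl) simp

lemma pairing_add_left: "pairing (\<lambda>P. c P + d P) f = pairing c f + pairing d f"
  unfolding pairing_def by (simp add: algebra_simps sum.distrib)

lemma pairing_diff_left: "pairing (\<lambda>P. c P - d P) f = pairing c f - pairing d f"
  unfolding pairing_def by (simp add: algebra_simps sum_subtractf)

text \<open>\<open>E\<close> is the dual of \<open>C\<close>, and the blocks are the cosets of
  \<open>v * C\<close> in \<open>E\<close>. A block has at most \<open>r ^ l\<close> words and
  \<open>E\<close> has at least \<open>r ^ (N - l)\<close>, which leaves at least
  \<open>r ^ (N - 2 * l)\<close> blocks.\<close>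

theorem ex_quantum_code:
  assumes l: "card (- S) \<le> l" "2 * l \<le> N"
  shows "\<exists>Q D. quantum_code r N (N - 2 * l) D Q \<and> D > l - card (- S)"
proof -
  obtain M where M: "card (S \<inter> {..<M}) = l" "M \<le> l + card (- S)" using ex_card_S_below by blast
  define J where "J = S \<inter> {..<M}"
  have J: "finite J" "card J = l" unfolding J_def using M(1) by simp_all
  obtain v where v: "\<And>z. z \<in> Zs \<Longrightarrow> \<not> v z \<simeq> 0"
    "\<And>k. k + 1 < card Zs \<Longrightarrow> (\<Sum>z\<in>Zs. v z * z ^ k) \<simeq> 0"
    using ex_weights_Zs by blast
  define E where "E = {w\<in>words r N. \<forall>s\<in>J. pairing (\<lambda>P. dec (w P)) (red s) \<simeq> 0}"
  \<comment> \<open>The word of \<open>v * C\<close> with coefficients \<open>\<mu>\<close>;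
    \<open>tr\<close> below is translation by it.\<close>
  define cw where "cw = (\<lambda>\<mu> P. \<Sum>s\<in>J. \<mu> s * (v (cz P) * red s P))"
  define tr where "tr = (\<lambda>u w \<mu>. \<forall>P<N. dec (w P) \<simeq> dec (u P) + cw \<mu> P)"
  define rel where "rel = {(u, w). u \<in> E \<and> w \<in> E \<and> (\<exists>\<mu>. tr u w \<mu>)}"
  have EW: "E \<subseteq> words r N" unfolding E_def by blast
  have finE: "finite E" using finite_subset[OF EW] by simp
  have cw_lin: "cw (\<lambda>s. \<mu> s + \<nu> s) P = cw \<mu> P + cw \<nu> P" "cw (\<lambda>s. - \<mu> s) P = - cw \<mu> P" "cw (\<lambda>_. 0) P = 0" for \<mu> \<nu> P
    unfolding cw_def by (simp_all add: algebra_simps sum.distrib sum_negf)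
  have cw_orth: "pairing (cw \<mu>) (red s') \<simeq> 0" if s': "s' \<in> J" for \<mu> s'
  proof -
    have "pairing (cw \<mu>) (red s') = (\<Sum>s\<in>J. \<mu> s * pairing (\<lambda>P. v (cz P)) (\<lambda>P. red s P * red s' P))"
      unfolding pairing_def cw_def sum_distrib_left sum_distrib_right by (subst sum.swap) (simp add: mult_ac)
    also have "\<dots> \<simeq> 0"
    proof (rule sum_congr_0, rule mult_congr_0(2))
      fix s assume s: "s \<in> J"
      obtain i j k where ijk: "wt i j k = s + s'" "\<forall>P. red s P * red s' P = monomial i j k P"
        using red_mult[of s s'] s s' unfolding J_def by blast
      have "s < M" "s' < M" using s s' unfolding J_def by auto
      \<comment> \<open>Both pole orders are at most \<open>M - 1\<close>, so the left-hand side is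
        at most \<open>2 * l + 2 * card (- S) - 1\<close>. Here \<open>2 * l \<le> N\<close>, and
        twice the number of gaps is at most the conductor.\<close>
      then have less: "wt i j k + 1 < N + conductor"
        using ijk(1) M(2) l(2) two_card_gaps by linarith
      have "pairing (\<lambda>P. v (cz P)) (monomial i j k) \<simeq> 0"
        by (rule weighted_sum_0[OF _ less]) (rule v(2))
      then show "pairing (\<lambda>P. v (cz P)) (\<lambda>P. red s P * red s' P) \<simeq> 0" using ijk(2) by simp
    qed
    finally show ?thesis .
  qed
  have E_tr: "w \<in> E" if u: "u \<in> E" and w: "w \<in> words r N" and t: "tr u w \<mu>" for u w \<mu>
  proof -
    have "pairing (\<lambda>P. dec (w P)) (red s) \<simeq> 0" if s: "s \<in> J" for s
    proof -
      have "pairing (\<lambda>P. dec (w P)) (red s) \<simeq> pairing (\<lambda>P. dec (u P) + cw \<mu> P) (red s)"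
        using t unfolding tr_def by (intro pairing_congr_left) blast
      also have "\<dots> = pairing (\<lambda>P. dec (u P)) (red s) + pairing (cw \<mu>) (red s)"
        by (rule pairing_add_left)
      also have "\<dots> \<simeq> 0 + 0" using u s unfolding E_def by (intro congr_add cw_orth) simp_all
      finally show ?thesis by simp
    qed
    then show ?thesis using w unfolding E_def by simp
  qed
  have E_dist: "u = w"
    if uw: "u \<in> E" "w \<in> E" and T: "T \<subseteq> {..<N}" "card T \<le> l - card (- S)"
      and agree: "\<And>P. P < N \<Longrightarrow> P \<notin> T \<Longrightarrow> u P = w P" for u w T
  proof (rule words_congr_eq)
    show "u \<in> words r N" "w \<in> words r N" using uw EW by auto
    fix P assume P: "P < N"
    have "dec (u P) - dec (w P) \<simeq> 0"
    proof (rule feng_rao[of M "\<lambda>P. dec (u P) - dec (w P)" l T, OF _ _ T(1) _ _ P])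
      fix s assume "s \<in> S" "s < M"
      then have "s \<in> J" unfolding J_def by simp
      then have "pairing (\<lambda>P. dec (u P)) (red s) - pairing (\<lambda>P. dec (w P)) (red s) \<simeq> 0 - 0"
        using uw unfolding E_def by (intro congr_diff) simp_all
      then show "pairing (\<lambda>P. dec (u P) - dec (w P)) (red s) \<simeq> 0" unfolding pairing_diff_left by simp
    next
      show "l \<le> card (S \<inter> {..<M})" using M(1) by simp
      show "card T + card (- S) \<le> l" using T(2) l(1) by linarith
      show "dec (u P) - dec (w P) \<simeq> 0" if "P < N" "P \<notin> T" for P using agree[OF that] by simp
    qed
    then show "dec (u P) \<simeq> dec (w P)" by (simp only: congr_0_iff_diff[symmetric])
  qed
  have surj: "\<exists>\<mu>. \<forall>P\<in>T. cw \<mu> P \<simeq> b P" if T: "T \<subseteq> {..<N}" "card T \<le> l - card (- S)" for T b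
    unfolding cw_def
  proof (rule full_rank_surjective)
    show "finite T" using T(1) finite_subset by blast
    show "finite J" by (rule J)
    fix c P assume c: "\<And>s. s \<in> J \<Longrightarrow> (\<Sum>P\<in>T. c P * (v (cz P) * red s P)) \<simeq> 0" and P: "P \<in> T"
    \<comment> \<open>A relation on \<open>T\<close> for \<open>v * C\<close>, multiplied by
      \<open>v\<close> and extended by 0, is orthogonal to \<open>C\<close>, and its support is too
      small for a nonzero word. As \<open>v\<close> vanishes nowhere, the relation is
      trivial.\<close>
    define d where "d = (\<lambda>P. if P \<in> T then c P * v (cz P) else 0)"
    have PN: "P < N" using P T(1) by blast
    have "d P \<simeq> 0"
    proof (rule feng_rao[of M d l T, OF _ _ T(1) _ _ PN])
      fix s assume "s \<in> S" "s < M"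
      then have s: "s \<in> J" unfolding J_def by simp
      have "pairing d (red s) = (\<Sum>P\<in>T. d P * red s P)"
        unfolding pairing_def by (rule sum.mono_neutral_right) (use T(1) in \<open>auto simp: d_def\<close>)
      also have "\<dots> = (\<Sum>P\<in>T. c P * (v (cz P) * red s P))"
        by (intro sum.cong) (simp_all add: d_def mult_ac)
      also have "\<dots> \<simeq> 0" by (rule c[OF s])
      finally show "pairing d (red s) \<simeq> 0" .
    next
      show "l \<le> card (S \<inter> {..<M})" using M(1) by simp
      show "card T + card (- S) \<le> l" using T(2) l(1) by linarith
      show "d P \<simeq> 0" if "P < N" "P \<notin> T" for P using that unfolding d_def by simp
    qed
    then have "c P * v (cz P) \<simeq> 0" using P unfolding d_def by simp
    then show "c P \<simeq> 0" using v(1)[OF pt_mem(1)[OF PN]] by (simp add: mult_congr_0_iff)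
  qed
  have tr_refl: "tr u u (\<lambda>_. 0)" for u unfolding tr_def cw_lin by simp
  have tr_sym: "tr w u (\<lambda>s. - \<mu> s)" if t: "tr u w \<mu>" for u w \<mu>
    unfolding tr_def cw_lin
  proof (intro allI impI)
    fix P assume "P < N"
    then have "dec (w P) + - cw \<mu> P \<simeq> (dec (u P) + cw \<mu> P) + - cw \<mu> P"
      using t unfolding tr_def by (intro congr_add congr_refl) blast
    then show "dec (u P) \<simeq> dec (w P) + - cw \<mu> P" using congr_sym by simp
  qed
  have tr_trans: "tr u x (\<lambda>s. \<mu> s + \<nu> s)" if t: "tr u w \<mu>" "tr w x \<nu>" for u w x \<mu> \<nu>
    unfolding tr_def cw_lin
  proof (intro allI impI)
    fix P assume P: "P < N"
    have "dec (x P) \<simeq> dec (w P) + cw \<nu> P" using t P unfolding tr_def by blast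
    also have "\<dots> \<simeq> (dec (u P) + cw \<mu> P) + cw \<nu> P"
      using t P unfolding tr_def by (intro congr_add congr_refl) blast
    finally show "dec (x P) \<simeq> dec (u P) + (cw \<mu> P + cw \<nu> P)" by (simp only: add.assoc)
  qed
  have equiv: "equiv E rel"
  proof (rule equivI)
    show "rel \<subseteq> E \<times> E" unfolding rel_def by auto
    show "refl_on E rel" using tr_refl unfolding rel_def refl_on_def by blast
    show "sym rel" using tr_sym unfolding rel_def sym_def by blast
    show "trans rel"
    proof (rule transI)
      fix u w x assume "(u, w) \<in> rel" "(w, x) \<in> rel"
      then obtain \<mu> \<nu> where "u \<in> E" "x \<in> E" "tr u w \<mu>" "tr w x \<nu>" unfolding rel_def by blast
      then show "(u, x) \<in> rel" using tr_trans unfolding rel_def by blast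
    qed
  qed
  define \<B> where "\<B> = E // rel"
  have UB: "\<Union>\<B> = E" unfolding \<B>_def by (rule Union_quotient[OF equiv])
  have card_block: "card B \<le> r ^ l" if "B \<in> \<B>" for B
  proof -
    obtain u where u: "u \<in> E" "B = rel `` {u}" using \<open>B \<in> \<B>\<close> unfolding \<B>_def by (rule quotientE)
    let ?f = "\<lambda>\<mu>. encode N (\<lambda>P. dec (u P) + cw \<mu> P)"
    have "B \<subseteq> ?f ` (J \<rightarrow>\<^sub>E R)"
    proof
      fix w assume "w \<in> B"
      then obtain \<mu> where w: "w \<in> E" "tr u w \<mu>" unfolding u(2) rel_def by blast
      define \<mu>' where "\<mu>' = restrict (\<lambda>s. rep (\<mu> s)) J"
      have "cw \<mu> P \<simeq> cw \<mu>' P" for P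
        unfolding cw_def \<mu>'_def by (intro congr_sum congr_mult congr_refl) (simp add: congr_rep)
      note cw\<mu> = this
      have "w = ?f \<mu>'"
      proof (rule words_congr_eq[OF _ encode_words])
        show "w \<in> words r N" using w(1) EW by blast
        fix P assume P: "P < N"
        have "dec (w P) \<simeq> dec (u P) + cw \<mu> P" using w(2) P unfolding tr_def by blast
        also have "\<dots> \<simeq> dec (u P) + cw \<mu>' P" by (intro congr_add cw\<mu> congr_refl)
        also have "\<dots> \<simeq> dec (?f \<mu>' P)" by (rule congr_sym[OF dec_encode[OF P]])
        finally show "dec (w P) \<simeq> dec (?f \<mu>' P)" .
      qed
      moreover have "\<mu>' \<in> J \<rightarrow>\<^sub>E R" unfolding \<mu>'_def by auto
      ultimately show "w \<in> ?f ` (J \<rightarrow>\<^sub>E R)" by blast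
    qed
    moreover have "finite (J \<rightarrow>\<^sub>E R)" using J by (intro finite_PiE) auto
    ultimately have "card B \<le> card (J \<rightarrow>\<^sub>E R)" by (intro surj_card_le)
    then show ?thesis using J by (simp add: card_PiE card_R)
  qed
  have "card E \<le> r ^ l * card \<B>"
  proof (rule card_le_fibres[where f = "\<lambda>u. rel `` {u}"])
    show "finite E" by (rule finE)
    show "(\<lambda>u. rel `` {u}) ` E \<subseteq> \<B>" unfolding \<B>_def by (auto intro: quotientI)
    show "finite \<B>" unfolding \<B>_def using finE equiv by (intro finite_quotient) (auto simp: rel_def)
    fix B assume B: "B \<in> \<B>"
    have "{u\<in>E. rel `` {u} = B} \<subseteq> B" using equiv_class_self[OF equiv] by auto
    moreover have "finite B" using Union_upper[OF B] unfolding UB by (rule finite_subset[OF _ finE])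
    ultimately have "card {u\<in>E. rel `` {u} = B} \<le> card B" by (intro card_mono)
    also have "\<dots> \<le> r ^ l" by (rule card_block[OF B])
    finally show "card {u\<in>E. rel `` {u} = B} \<le> r ^ l" .
  qed
  \<comment> \<open>There are at most \<open>r ^ l\<close> syndromes, and words with the same
    syndrome differ by elements of \<open>E\<close>.\<close>
  moreover have "r ^ N \<le> card E * r ^ l"
  proof -
    let ?syn = "\<lambda>w. restrict (\<lambda>s. rep (pairing (\<lambda>P. dec (w P)) (red s))) J"
    have "card (words r N) \<le> card E * card (J \<rightarrow>\<^sub>E R)"
    proof (rule card_le_fibres[where f = ?syn])
      show "?syn ` words r N \<subseteq> J \<rightarrow>\<^sub>E R" by auto
      show "finite (J \<rightarrow>\<^sub>E R)" using J by (intro finite_PiE) auto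
      fix \<sigma>
      show "card {w\<in>words r N. ?syn w = \<sigma>} \<le> card E"
      proof (cases "{w\<in>words r N. ?syn w = \<sigma>} = {}")
        case False
        then obtain w0 where w0: "w0 \<in> words r N" "?syn w0 = \<sigma>" by blast
        let ?f = "\<lambda>w. encode N (\<lambda>P. dec (w P) - dec (w0 P))"
        show ?thesis
        proof (rule card_inj_on_le[OF _ _ finE])
          show "inj_on ?f {w\<in>words r N. ?syn w = \<sigma>}"
          proof (rule inj_onI)
            fix a b assume ab: "a \<in> {w\<in>words r N. ?syn w = \<sigma>}" "b \<in> {w\<in>words r N. ?syn w = \<sigma>}" "?f a = ?f b"
            show "a = b"
            proof (rule words_congr_eq)
              show "a \<in> words r N" "b \<in> words r N" using ab by auto
              fix P assume P: "P < N"
              have "dec (a P) - dec (w0 P) \<simeq> dec (?f a P)" by (rule congr_sym[OF dec_encode[OF P]])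
              also have "dec (?f a P) = dec (?f b P)" using ab(3) by simp
              also have "\<dots> \<simeq> dec (b P) - dec (w0 P)" by (rule dec_encode[OF P])
              finally show "dec (a P) \<simeq> dec (b P)" by (simp add: congr_def)
            qed
          qed
          show "?f ` {w\<in>words r N. ?syn w = \<sigma>} \<subseteq> E"
          proof
            fix x assume "x \<in> ?f ` {w\<in>words r N. ?syn w = \<sigma>}"
            then obtain w where w: "w \<in> words r N" "?syn w = \<sigma>" "x = ?f w" by blast
            have "pairing (\<lambda>P. dec (x P)) (red s) \<simeq> 0" if s: "s \<in> J" for s
            proof -
              have "rep (pairing (\<lambda>P. dec (w P)) (red s)) = rep (pairing (\<lambda>P. dec (w0 P)) (red s))"
                using fun_cong[OF trans[OF w(2) w0(2)[symmetric]], of s] s by (simp only: restrict_apply')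
              then have e: "pairing (\<lambda>P. dec (w P)) (red s) \<simeq> pairing (\<lambda>P. dec (w0 P)) (red s)"
                by (simp only: rep_eq_iff)
              have "pairing (\<lambda>P. dec (x P)) (red s) \<simeq> pairing (\<lambda>P. dec (w P) - dec (w0 P)) (red s)"
                unfolding w(3) by (intro pairing_congr_left dec_encode)
              also have "\<dots> = pairing (\<lambda>P. dec (w P)) (red s) - pairing (\<lambda>P. dec (w0 P)) (red s)"
                by (rule pairing_diff_left)
              also have "\<dots> \<simeq> 0" using e by (simp only: congr_0_iff_diff[symmetric])
              finally show ?thesis .
            qed
            then show "x \<in> E" unfolding E_def using w(3) encode_words by simp
          qed
        qed
      next
        case True
        then show ?thesis by (simp only: card.empty)
      qed
    qed simp
    then show ?thesis using J by (simp add: card_PiE card_R)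
  qed
  ultimately have "r ^ N \<le> (r ^ l * card \<B>) * r ^ l" by (meson le_trans mult_le_mono1)
  moreover have "r ^ N = (r ^ l * r ^ (N - 2 * l)) * r ^ l"
    using l(2) by (simp flip: power_add)
  ultimately have cB: "r ^ (N - 2 * l) \<le> card \<B>"
    using r_ge by (simp add: mult_le_cancel1 mult_le_cancel2)
  have "\<exists>Q D. quantum_code r N (N - 2 * l) D Q \<and> D > l - card (- S)"
  proof (rule css_code[OF _ _ _ cB])
    fix B assume B: "B \<in> \<B>"
    show "B \<subseteq> words r N" using Union_upper[OF B] unfolding UB by (rule subset_trans[OF _ EW])
    show "B \<noteq> {}" using B unfolding \<B>_def by (rule in_quotient_imp_non_empty[OF equiv])
  next
    show "pairwise disjnt \<B>"
      unfolding pairwise_def disjnt_def \<B>_def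
    proof (intro ballI impI)
      fix X Y assume "X \<in> E // rel" "Y \<in> E // rel" "X \<noteq> Y"
      then show "X \<inter> Y = {}" using quotient_disj[OF equiv, of X Y] by simp
    qed
  next
    fix u w T assume "u \<in> \<Union>\<B>" "w \<in> \<Union>\<B>" "T \<subseteq> {..<N}" "card T \<le> l - card (- S)"
      "\<And>P. P < N \<Longrightarrow> P \<notin> T \<Longrightarrow> u P = w P"
    then show "u = w" unfolding UB by (intro E_dist)
  next
    fix B T \<sigma> \<tau>
    assume B: "B \<in> \<B>" and T: "T \<subseteq> {..<N}" "card T \<le> l - card (- S)"
      and \<sigma>: "\<sigma> \<in> T \<rightarrow>\<^sub>E {..<r}" and \<tau>: "\<tau> \<in> T \<rightarrow>\<^sub>E {..<r}"
    have BE: "B \<subseteq> E" using Union_upper[OF B] unfolding UB .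
    \<comment> \<open>Adding a word of \<open>v * C\<close> with the values
      \<open>\<tau> - \<sigma>\<close> on \<open>T\<close> stays in the coset and carries the
      pattern \<open>\<sigma>\<close> injectively to \<open>\<tau>\<close>.\<close>
    have le: "card {u\<in>B. restrict u T = \<sigma>} \<le> card {u\<in>B. restrict u T = \<tau>}"
      if \<sigma>: "\<sigma> \<in> T \<rightarrow>\<^sub>E {..<r}" and \<tau>: "\<tau> \<in> T \<rightarrow>\<^sub>E {..<r}" for \<sigma> \<tau>
    proof -
      obtain \<mu> where \<mu>: "\<forall>P\<in>T. cw \<mu> P \<simeq> dec (\<tau> P) - dec (\<sigma> P)" using surj[OF T, of "\<lambda>P. dec (\<tau> P) - dec (\<sigma> P)"] ..
      let ?f = "\<lambda>u. encode N (\<lambda>P. dec (u P) + cw \<mu> P)"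
      have trf: "tr u (?f u) \<mu>" for u unfolding tr_def using dec_encode by blast
      show ?thesis
      proof (rule card_inj_on_le)
        show "finite {u\<in>B. restrict u T = \<tau>}" using finite_subset[OF BE finE] by simp
        show "inj_on ?f {u\<in>B. restrict u T = \<sigma>}"
        proof (rule inj_onI)
          fix a b assume ab: "a \<in> {u\<in>B. restrict u T = \<sigma>}" "b \<in> {u\<in>B. restrict u T = \<sigma>}" "?f a = ?f b"
          show "a = b"
          proof (rule words_congr_eq)
            show "a \<in> words r N" "b \<in> words r N" using ab BE EW by auto
            fix P assume P: "P < N"
            have "dec (a P) + cw \<mu> P \<simeq> dec (?f a P)" by (rule congr_sym[OF dec_encode[OF P]])
            also have "dec (?f a P) = dec (?f b P)" using ab(3) by simp
            also have "\<dots> \<simeq> dec (b P) + cw \<mu> P" by (rule dec_encode[OF P])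
            finally show "dec (a P) \<simeq> dec (b P)" by (simp add: congr_def)
          qed
        qed
        show "?f ` {u\<in>B. restrict u T = \<sigma>} \<subseteq> {u\<in>B. restrict u T = \<tau>}"
        proof
          fix x assume "x \<in> ?f ` {u\<in>B. restrict u T = \<sigma>}"
          then obtain u where u: "u \<in> B" "restrict u T = \<sigma>" "x = ?f u" by blast
          have uE: "u \<in> E" using u(1) BE by blast
          have xE: "x \<in> E" unfolding u(3) by (rule E_tr[OF uE encode_words trf])
          have "(u, x) \<in> rel" unfolding rel_def using uE xE trf[of u] u(3) by blast
          then have "x \<in> B" by (rule in_quotient_imp_closed[OF equiv B[unfolded \<B>_def] u(1)])
          moreover have "restrict x T = \<tau>"
          proof (rule PiE_ext[OF _ \<tau>])
            show "restrict x T \<in> T \<rightarrow>\<^sub>E {..<r}"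
              using xE EW T(1) words_less[of x r N] by (auto simp: subset_iff)
            fix P assume P: "P \<in> T"
            then have PN: "P < N" using T(1) by blast
            have uP: "u P = \<sigma> P" using u(2) P by (metis restrict_apply')
            have "dec (x P) \<simeq> dec (u P) + cw \<mu> P" unfolding u(3) by (rule dec_encode[OF PN])
            also have "\<dots> \<simeq> dec (\<sigma> P) + (dec (\<tau> P) - dec (\<sigma> P))"
              unfolding uP using \<mu> P by (intro congr_add congr_refl) blast
            also have "\<dots> = dec (\<tau> P)" by simp
            finally have "dec (x P) \<simeq> dec (\<tau> P)" .
            moreover have "x P < r" using xE EW PN words_less by blast
            moreover have "\<tau> P < r" using \<tau> P by auto
            ultimately have "x P = \<tau> P" using dec_inj by blast
            then show "restrict x T P = \<tau> P" using P by simp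
          qed
          ultimately show "x \<in> {u\<in>B. restrict u T = \<tau>}" by simp
        qed
      qed
    qed
    show "card {u\<in>B. restrict u T = \<sigma>} = card {u\<in>B. restrict u T = \<tau>}"
      by (rule antisym[OF le[OF \<sigma> \<tau>] le[OF \<tau> \<sigma>]])
  next
    show "r \<ge> 2" by (rule r_ge)
    show "N \<ge> 1" using N_eq Zs(2) finite_Zs q_ge by (simp add: card_gt_0_iff Suc_le_eq)
  qed
  then show ?thesis .
qed

end

section \<open>Parameters of the codes\<close>

lemma (in ggs_field) conductor_genus: "int conductor = (int q - 1) * (int q ^ (n + 1) + int q ^ n - int q ^ 2)"
proof -
  have mq: "(q + 1) * m = q ^ n + 1" using m by (simp only: mult.commute)
  have "conductor + q ^ 3 = (q\<^sup>2 - 1) * (q ^ n + 1) + 1"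
    unfolding conductor_eq by (simp only: mult.assoc mq)
  then have "int (conductor + q ^ 3) = int ((q\<^sup>2 - 1) * (q ^ n + 1) + 1)" by (rule arg_cong)
  moreover have "int (q\<^sup>2 - 1) = int q ^ 2 - 1" using q2_ge by (simp add: of_nat_diff)
  ultimately have "int conductor + int q ^ 3 = (int q ^ 2 - 1) * (int q ^ n + 1) + 1"
    by (simp only: of_nat_add of_nat_mult of_nat_power of_nat_1)
  then show ?thesis by (simp add: algebra_simps power2_eq_square power3_eq_cube)
qed

lemma genus_param_double:
  assumes "n > 0"
  shows "2 * genus_param q n = (int q - 1) * (int q ^ (n + 1) + int q ^ n - int q ^ 2)"
proof -
  have "even ((int q - 1) * (int q ^ (n + 1) + int q ^ n - int q ^ 2))" using assms by simp
  then show ?thesis unfolding genus_param_def by simp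
qed

lemma genus_param_pos:
  assumes "q \<ge> 2" "n > 0"
  shows "genus_param q n > 0"
proof -
  have "int q ^ 2 \<le> int q ^ (n + 1)" using assms by (intro power_increasing) auto
  moreover have "int q ^ n > 0" using assms by simp
  ultimately have "(int q - 1) * (int q ^ (n + 1) + int q ^ n - int q ^ 2) > 0"
    using assms by (intro mult_pos_pos) linarith+
  then show ?thesis using genus_param_double[OF assms(2), of q] by linarith
qed

text \<open>With \<open>length_param_lower\<close> this bounds the defect by
  \<open>q ^ (n + 2) / q ^ (2 * n + 1)\<close>, which decays geometrically in
  \<open>n\<close>.\<close>

lemma genus_param_upper:
  assumes "q \<ge> 2" "n > 0"
  shows "2 * genus_param q n \<le> int q ^ (n + 2)"
proof -
  have "2 * genus_param q n = int q ^ (n + 2) - int q ^ n - int q ^ 2 * (int q - 1)"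
    unfolding genus_param_double[OF assms(2)] by (simp add: algebra_simps power2_eq_square)
  moreover have "int q ^ 2 * (int q - 1) \<ge> 0" using assms by simp
  moreover have "int q ^ n \<ge> 0" by simp
  ultimately show ?thesis by linarith
qed

lemma length_param_lower:
  assumes "q \<ge> 2" "n \<ge> 2"
  shows "int q ^ (2 * n + 1) \<le> length_param q n"
proof -
  have "int q ^ (n + 3) \<le> int q ^ (2 * n + 1)" using assms by (intro power_increasing) auto
  moreover have "2 * int q ^ (2 * n + 1) \<le> int q * int q ^ (2 * n + 1)" using assms by (intro mult_right_mono) auto
  then have "2 * int q ^ (2 * n + 1) \<le> int q ^ (2 * n + 2)" by simp
  moreover have "int q ^ (n + 2) \<ge> 0" by simp
  ultimately show ?thesis unfolding length_param_def by linarith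
qed

lemma length_param_pos: "q \<ge> 2 \<Longrightarrow> n \<ge> 2 \<Longrightarrow> length_param q n > 0"
  using length_param_lower[of q n] zero_less_power[of "int q" "2 * n + 1"] by linarith

lemma ex_ggs_quantum_code:
  assumes q: "primepow q" and n: "odd n"
    and N: "int N = length_param q n" and l: "genus_param q n \<le> int l" "2 * l \<le> N"
  shows "\<exists>Q D. quantum_code (q ^ (2 * n)) N (N - 2 * l) D Q \<and> int D \<ge> int l + 1 - genus_param q n"
proof -
  obtain p e where p: "prime p" "e > 0" "q = p ^ e" using q unfolding primepow_def by blast
  have n0: "n > 0" using n by (intro Nat.gr0I) auto
  have r: "q ^ (2 * n) = p ^ (e * (2 * n))" unfolding p(3) by (simp only: power_mult)
  obtain I :: "int poly set" and g where "finite_residue_field I p (p ^ (e * (2 * n))) g"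
    using ex_finite_residue_field[OF p(1), of "e * (2 * n)"] p(2) n0 by auto
  then interpret finite_residue_field I p "q ^ (2 * n)" g unfolding r .
  have "q + 1 dvd q ^ n + 1"
  proof -
    have "int q - (- 1) dvd int q ^ n - (- 1) ^ n" unfolding power_diff_sumr2 by (rule dvd_triv_left)
    then have "int (q + 1) dvd int (q ^ n + 1)" using n by (simp add: add.commute)
    then show ?thesis by (simp only: of_nat_dvd_iff)
  qed
  then obtain m where m: "q ^ n + 1 = (q + 1) * m" by (elim dvdE)
  interpret ggs_field I p "q ^ (2 * n)" g q e n m
    by unfold_locales (use p n m in \<open>simp_all add: mult.commute\<close>)
  \<comment> \<open>The length parameter is \<open>q ^ 3 * b\<close>. At least \<open>b\<close>
    fibres are rational, and exactly \<open>b\<close> of them are kept.\<close>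
  define b where "b = (q ^ n + 1) * (q ^ (n - 1) - 1) + 1"
  obtain Zs where base: "Zs \<subseteq> base_points" "card Zs = b"
    using obtain_subset_with_card_n[OF card_base_points] unfolding b_def by blast
  have Zs_ne: "Zs \<noteq> {}" using base(2) unfolding b_def by auto
  have finZ: "finite Zs" using base(2) unfolding b_def by (intro card_ge_0_finite) simp
  define Pts where "Pts = (SIGMA z:Zs. SIGMA y:fibre_y z. fibre_x y)"
  have "finite Pts" unfolding Pts_def using finZ by (auto simp: fibre_y_def fibre_x_def)
  then obtain pt where pt: "bij_betw pt {0..<card Pts} Pts" using ex_bij_betw_nat_finite by blast
  interpret ggs_code I p "q ^ (2 * n)" g q e n m Zs "card Pts" pt
    by unfold_locales (use base(1) Zs_ne pt in \<open>simp_all add: Pts_def atLeast0LessThan\<close>)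
  have "int (card Pts) = length_param q n"
  proof -
    have q1: "q ^ n = q * q ^ (n - 1)" using n0 by (metis Suc_pred' power_Suc)
    have "q ^ (n - 1) \<ge> 1" using q_ge by simp
    then have q2: "int (q ^ (n - 1) - 1) = int q ^ (n - 1) - 1" by (simp only: of_nat_diff of_nat_power of_nat_1)
    have "int (card Pts) = ((int q * int q ^ (n - 1) + 1) * (int q ^ (n - 1) - 1) + 1) * int q ^ 3"
      unfolding N_eq base(2) b_def q1
      by (simp only: of_nat_add of_nat_mult of_nat_power of_nat_1 q2)
    also have "\<dots> = int q ^ 4 * (int q ^ (n - 1))\<^sup>2 - int q ^ 4 * int q ^ (n - 1) + int q ^ 3 * int q ^ (n - 1)"
      by (simp add: algebra_simps power2_eq_square power3_eq_cube power4_eq_xxxx)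
    also have "\<dots> = length_param q n"
    proof -
      have "2 * n + 2 = 4 + (n - 1) * 2" "n + 3 = 4 + (n - 1)" "n + 2 = 3 + (n - 1)" using n0 by simp_all
      then show ?thesis unfolding length_param_def by (simp only: power_add power_mult)
    qed
    finally show ?thesis .
  qed
  then have NP: "card Pts = N" using N by simp
  have "2 * int (card (- S)) \<le> 2 * genus_param q n"
    unfolding genus_param_double[OF n0] conductor_genus[symmetric] using two_card_gaps by linarith
  then have gaps: "int (card (- S)) \<le> genus_param q n" by simp
  obtain Q D where "quantum_code (q ^ (2 * n)) N (N - 2 * l) D Q" "D > l - card (- S)"
    using ex_quantum_code[of l] gaps l unfolding NP by auto
  then show ?thesis using gaps l by (intro exI[of _ Q] exI[of _ D]) linarith
qed

lemma rel_singleton_defect_le: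
  assumes "N > 0" "int s = int N - 2 * l" "int D \<ge> l + 1 - g"
  shows "rel_singleton_defect N s D \<le> 2 * real_of_int g / real N"
proof -
  have "int N - int s - 2 * int D + 2 \<le> 2 * g" using assms by linarith
  then have "real_of_int (int N - int s - 2 * int D + 2) \<le> real_of_int (2 * g)" by (simp only: of_int_le_iff)
  then have "real N - real s - 2 * real D + 2 \<le> 2 * real_of_int g" by simp
  then show ?thesis unfolding rel_singleton_defect_def by (intro divide_right_mono) auto
qed

theorem corollary6p5:
  fixes q :: nat
  assumes "primepow q"
  shows
    "(\<forall>(n::nat) (l::int) (s::nat).
        n \<ge> 5 \<and> odd n \<and>
        3 * genus_param q n - 1 \<le> l \<and> l \<le> length_param q n - genus_param q n \<and>
        int s = length_param q n - 2 * l \<longrightarrow>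
        (\<exists>Q D. quantum_code (q ^ (2 * n)) (nat (length_param q n)) s D Q \<and>
               int D \<ge> l + 1 - genus_param q n \<and>
               rel_singleton_defect (nat (length_param q n)) s D
                 \<le> 2 * real_of_int (genus_param q n) / real_of_int (length_param q n)) \<and>
        2 * real_of_int (genus_param q n) / real_of_int (length_param q n)
          = (real q - 1) * (real q ^ (n + 1) + real q ^ n - real q ^ 2)
            / (real q ^ (2 * n + 2) - real q ^ (n + 3) + real q ^ (n + 2)))
     \<and>
     (\<forall>(l :: nat \<Rightarrow> int) (s :: nat \<Rightarrow> nat) (D :: nat \<Rightarrow> nat) (Q :: nat \<Rightarrow> qvec set).
        (\<forall>n. n \<ge> 5 \<and> odd n \<longrightarrow>
           3 * genus_param q n - 1 \<le> l n \<and> l n \<le> length_param q n - genus_param q n \<and>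
           int (s n) = length_param q n - 2 * l n \<and>
           quantum_code (q ^ (2 * n)) (nat (length_param q n)) (s n) (D n) (Q n) \<and>
           int (D n) \<ge> l n + 1 - genus_param q n) \<longrightarrow>
        ((\<lambda>n. rel_singleton_defect (nat (length_param q n)) (s n) (D n)) \<longlongrightarrow> 0)
          (inf sequentially (principal {n. odd n})))"
proof (intro conjI allI impI)
  have q2: "q \<ge> 2" using primepow_gt_Suc_0[OF assms] by simp
  {
    fix n :: nat and l :: int and s :: nat
    assume a: "n \<ge> 5 \<and> odd n \<and>
        3 * genus_param q n - 1 \<le> l \<and> l \<le> length_param q n - genus_param q n \<and>
        int s = length_param q n - 2 * l"
    have n0: "n > 0" "n \<ge> 2" using a by simp_all
    have g: "genus_param q n > 0" by (rule genus_param_pos[OF q2 n0(1)])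
    have len: "length_param q n > 0" by (rule length_param_pos[OF q2 n0(2)])
    define N where "N = nat (length_param q n)"
    have N: "int N = length_param q n" "N > 0" unfolding N_def using len by simp_all
    define k where "k = nat l"
    have k: "int k = l" unfolding k_def using a g by simp
    have s: "s = N - 2 * k" "2 * k \<le> N" using a N k by linarith+
    obtain Q D where QD: "quantum_code (q ^ (2 * n)) N (N - 2 * k) D Q" "int D \<ge> int k + 1 - genus_param q n"
      using ex_ggs_quantum_code[OF assms _ N(1) _ s(2)] a k g by auto
    have "rel_singleton_defect N s D \<le> 2 * real_of_int (genus_param q n) / real N"
      by (rule rel_singleton_defect_le[OF N(2), of s l]) (use a N QD k in simp_all)
    then show "\<exists>Q D. quantum_code (q ^ (2 * n)) (nat (length_param q n)) s D Q \<and>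
               int D \<ge> l + 1 - genus_param q n \<and>
               rel_singleton_defect (nat (length_param q n)) s D
                 \<le> 2 * real_of_int (genus_param q n) / real_of_int (length_param q n)"
      using QD unfolding N_def[symmetric] s(1)[symmetric] k N(1)[symmetric] by auto
    have "real_of_int (2 * genus_param q n) = (real q - 1) * (real q ^ (n + 1) + real q ^ n - real q ^ 2)"
      unfolding genus_param_double[OF n0(1)] by simp
    moreover have "real_of_int (length_param q n) = real q ^ (2 * n + 2) - real q ^ (n + 3) + real q ^ (n + 2)"
      unfolding length_param_def by simp
    ultimately show "2 * real_of_int (genus_param q n) / real_of_int (length_param q n)
          = (real q - 1) * (real q ^ (n + 1) + real q ^ n - real q ^ 2)
            / (real q ^ (2 * n + 2) - real q ^ (n + 3) + real q ^ (n + 2))" by simp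
  }
  fix l :: "nat \<Rightarrow> int" and s :: "nat \<Rightarrow> nat" and D :: "nat \<Rightarrow> nat" and Q :: "nat \<Rightarrow> qvec set"
  assume a: "\<forall>n. n \<ge> 5 \<and> odd n \<longrightarrow>
           3 * genus_param q n - 1 \<le> l n \<and> l n \<le> length_param q n - genus_param q n \<and>
           int (s n) = length_param q n - 2 * l n \<and>
           quantum_code (q ^ (2 * n)) (nat (length_param q n)) (s n) (D n) (Q n) \<and>
           int (D n) \<ge> l n + 1 - genus_param q n"
  have bounds: "norm (rel_singleton_defect (nat (length_param q n)) (s n) (D n)) \<le> norm (2 * (1 / 2 :: real) ^ n) * 1"
    if n: "n \<ge> 5" "odd n" for n
  proof -
    have an: "3 * genus_param q n - 1 \<le> l n" "int (s n) = length_param q n - 2 * l n"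
      "quantum_code (q ^ (2 * n)) (nat (length_param q n)) (s n) (D n) (Q n)"
      "int (D n) \<ge> l n + 1 - genus_param q n"
      using a n by blast+
    have n0: "n > 0" "n \<ge> 2" using n by simp_all
    have g: "genus_param q n > 0" by (rule genus_param_pos[OF q2 n0(1)])
    have len: "length_param q n > 0" by (rule length_param_pos[OF q2 n0(2)])
    define N where "N = nat (length_param q n)"
    have N: "int N = length_param q n" "N > 0" unfolding N_def using len by simp_all
    have "q ^ (2 * n) \<ge> 2" using q2 self_le_power[of q "2 * n"] n0 by linarith
    moreover have "D n \<ge> 1" using an(1,4) g by linarith
    \<comment> \<open>The codes are arbitrary here, so nonnegativity of the defect rests on the
      quantum Singleton bound; \<open>D n \<ge> 1\<close> holds because \<open>l n\<close> is at
      least three times the genus minus 1.\<close>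
    ultimately have "s n + 2 * D n \<le> N + 2"
      by (rule quantum_singleton_bound[OF an(3)[folded N_def]])
    then have "real (s n) + 2 * real (D n) \<le> real N + 2" by (simp flip: of_nat_mult of_nat_add)
    then have nonneg: "0 \<le> rel_singleton_defect N (s n) (D n)"
      unfolding rel_singleton_defect_def by simp
    have "rel_singleton_defect N (s n) (D n) \<le> 2 * real_of_int (genus_param q n) / real N"
      by (rule rel_singleton_defect_le[OF N(2), of _ "l n"]) (use an N in simp_all)
    also have "\<dots> \<le> real q ^ (n + 2) / real q ^ (2 * n + 1)"
    proof (rule frac_le)
      have "real_of_int (2 * genus_param q n) \<le> real_of_int (int q ^ (n + 2))"
        unfolding of_int_le_iff by (rule genus_param_upper[OF q2 n0(1)])
      then show "2 * real_of_int (genus_param q n) \<le> real q ^ (n + 2)" by simp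
      have "real_of_int (int q ^ (2 * n + 1)) \<le> real_of_int (int N)"
        unfolding of_int_le_iff N(1) by (rule length_param_lower[OF q2 n0(2)])
      then show "real q ^ (2 * n + 1) \<le> real N" by simp
      show "0 < real q ^ (2 * n + 1)" using q2 by simp
    qed simp
    also have "\<dots> = 1 / real q ^ (n - 1)"
    proof -
      have "2 * n + 1 = (n + 2) + (n - 1)" using n0 by simp
      then have "real q ^ (2 * n + 1) = real q ^ (n + 2) * real q ^ (n - 1)" by (simp only: power_add)
      then show ?thesis using q2 by simp
    qed
    also have "\<dots> \<le> 1 / 2 ^ (n - 1)" using q2 by (intro frac_le power_mono) auto
    also have "\<dots> = 2 * (1 / 2) ^ n"
    proof -
      have "n = Suc (n - 1)" using n0 by simp
      then have "(2::real) ^ n = 2 * 2 ^ (n - 1)" by (metis power_Suc)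
      then show ?thesis by (simp add: power_one_over)
    qed
    finally show ?thesis using nonneg unfolding N_def by simp
  qed
  have "(\<lambda>n. 2 * (1 / 2 :: real) ^ n) \<longlonglongrightarrow> 2 * 0"
    by (intro tendsto_mult tendsto_const LIMSEQ_realpow_zero) auto
  then have "((\<lambda>n. 2 * (1 / 2 :: real) ^ n) \<longlongrightarrow> 0) (inf sequentially (principal {n. odd n}))"
    using tendsto_mono[OF inf_le1] by fastforce
  then show "((\<lambda>n. rel_singleton_defect (nat (length_param q n)) (s n) (D n)) \<longlongrightarrow> 0)
          (inf sequentially (principal {n. odd n}))"
  proof (rule tendsto_0_le)
    show "\<forall>\<^sub>F n in inf sequentially (principal {n. odd n}).
        norm (rel_singleton_defect (nat (length_param q n)) (s n) (D n)) \<le> norm (2 * (1 / 2 :: real) ^ n) * 1"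
      unfolding eventually_inf_principal
      using eventually_ge_at_top[of 5] by eventually_elim (use bounds in auto)
  qed
qed

end
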